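(* Let $\Bbbk$ be an algebraically closed field of characteristic $p>0$, $G$ a finite group, $\mathfrak{h}$ a faithful finite-dimensional representation of $G$ over $\Bbbk$, $t\in\Bbbk$, and $c$ a conjugation-invariant $\Bbbk$-valued function on the reflections of $G$. For every irreducible $L\in\mathcal{O}_{t,c}(G,\mathfrak{h})$, there is a unique irreducible $G$-representation $\tau$ (up to isomorphism) and a unique $i\in\mathbb{Z}$ such that $L\cong L_{t,c}(G,\mathfrak{h},\tau)[i]$.
   Context: Let $\Bbbk$ be an algebraically closed field of characteristic $p>0$, $G$ a finite group, $\mathfrak{h}$ a faithful $n$-dimensional representation of $G$ over $\Bbbk$ (so $G\subseteq GL(\mathfrak{h})$), $\mathfrak{h}^*$ the dual representation, $(g.y,x)=(y,g^{-1}.x)$, and $(\cdot,\cdot)$ the canonical pairing. A reflection is an element $s\in GL(\mathfrak{h})$ such that $1-s$ has rank $1$ on $\mathfrak{h}$; $S$ is the set of reflections in $G$. For $s\in S$ choose $\alpha_s\in\mathfrak{h}^*$, $\alpha_s^\vee\in\mathfrak{h}$ with $s.x=x-(\alpha_s^\vee,x)\alpha_s$ for all $x\in\mathfrak{h}^*$. Let $t\in\Bbbk$ and let $c:S\to\Bbbk$, $s\mapsto c_s$, be conjugation invariant. The rational Cherednik algebra $H_{t,c}(G,\mathfrak{h})$ is the quotient of $\Bbbk G\ltimes T(\mathfrak{h}\oplus\mathfrak{h}^* )$ by the relations $[x,x']=0$, $[y,y']=0$, $[y,x]=(y,x)t-\sum_{s\in S}c_s((1-s).x,y)s$ for $x,x'\in\mathfrak{h}^*$,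 $y,y'\in\mathfrak{h}$. It is $\mathbb{Z}$-graded by $\deg x=1$, $\deg y=-1$, $\deg g=0$. For an irreducible finite-dimensional $G$-representation $\tau$ over $\Bbbk$, the Verma module is $M_{t,c}(\tau)=M_{t,c}(G,\mathfrak{h},\tau)=H_{t,c}(G,\mathfrak{h})\otimes_{\Bbbk G\ltimes S\mathfrak{h}}\tau$, where $\mathfrak{h}$ acts on $\tau$ by zero. As a graded space it is $S\mathfrak{h}^*\otimes\tau$, with $x\in\mathfrak{h}^*$ acting by multiplication, $g\in G$ diagonally, and $y\in\mathfrak{h}$ by the Dunkl operator $D_y=t\partial_y\otimes1-\sum_{s\in S}c_s\frac{(y,\alpha_s)}{\alpha_s}(1-s)\otimes s$. Contravariant form: let $\bar c(s)=c(s^{-1})$. The restricted dual $M^\dagger$ of a graded module $M$ with finite-dimensional pieces has $i$-th graded piece $(M_i)^*$. The isomorphism $H_{t,c}(G,\mathfrak{h})^{opp}\cong H_{t,\bar c}(G,\mathfrak{h}^* )$, identity on $\mathfrak{h},\mathfrak{h}^*$ and $g\mapsto g^{-1}$, makes $M_{t,\bar c}(G,\mathfrak{h}^*,\tau^* )^\dagger$ an $H_{t,c}(G,\mathfrak{h})$-module. Let $\phi:M_{t,c}(G,\mathfrak{h},\tau)\to M_{t,\bar c}(G,\mathfrak{h}^*,\tau^* )^\dagger$ be the unique homomorphism that is the identity on the lowest graded piece $\tau$; equivalently, it is a bilinear form $B:M_{t,c}(G,\mathfrak{h},\tau)\times M_{t,\bar c}(G,\mathfrak{h}^*,\tau^*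 )\to\Bbbk$. Put $\ker B=\ker\phi$ and $L_{t,c}(G,\mathfrak{h},\tau)=M_{t,c}(G,\mathfrak{h},\tau)/\ker B$, a graded module. Category $\mathcal{O}_{t,c}(G,\mathfrak{h})$ is the category of $\mathbb{Z}$-graded $H_{t,c}(G,\mathfrak{h})$-modules which are finite-dimensional over $\Bbbk$ (morphisms and isomorphisms preserve the grading). For a graded space $M$, $M[j]$ is the same space with shifted grading $M[j]_i=M_{i+j}$. *)

theory Defs
  imports
    "HOL-Algebra.QuotRing"
    "HOL-Algebra.Generated_Groups"
    "HOL-Library.Poly_Mapping"
    "HOL-Computational_Algebra.Polynomial"
    "Jordan_Normal_Form.VS_Connect"
begin

section \<open>Representations of a group over a field\<close>

record ('g, 'k, 'v) rep = "('k, 'v) module" +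
  act :: "'g \<Rightarrow> 'v \<Rightarrow> 'v"

definition is_rep :: "'g monoid \<Rightarrow> ('g, 'k::field, 'v) rep \<Rightarrow> bool" where
  "is_rep G V \<longleftrightarrow> vectorspace class_ring V \<and>
     (\<forall>g\<in>carrier G. linear_map class_ring V V (act V g)) \<and>
     (\<forall>v\<in>carrier V. act V \<one>\<^bsub>G\<^esub> v = v) \<and>
     (\<forall>g\<in>carrier G. \<forall>h\<in>carrier G. \<forall>v\<in>carrier V.
        act V (g \<otimes>\<^bsub>G\<^esub> h) v = act V g (act V h v))"

definition fin_dim_rep :: "'g monoid \<Rightarrow> ('g, 'k::field, 'v) rep \<Rightarrow> bool" where
  "fin_dim_rep G V \<longleftrightarrow> is_rep G V \<and> vectorspace.fin_dim class_ring V"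

definition faithful_rep :: "'g monoid \<Rightarrow> ('g, 'k::field, 'v) rep \<Rightarrow> bool" where
  "faithful_rep G V \<longleftrightarrow> is_rep G V \<and>
     (\<forall>g\<in>carrier G. (\<forall>v\<in>carrier V. act V g v = v) \<longrightarrow> g = \<one>\<^bsub>G\<^esub>)"

definition irreducible_rep :: "'g monoid \<Rightarrow> ('g, 'k::field, 'v) rep \<Rightarrow> bool" where
  "irreducible_rep G V \<longleftrightarrow> fin_dim_rep G V \<and> carrier V \<noteq> {\<zero>\<^bsub>V\<^esub>} \<and>
     (\<forall>W. VectorSpace.subspace class_ring W V \<and> (\<forall>g\<in>carrier G. \<forall>w\<in>W. act V g w \<in> W) \<longrightarrow>
        W = {\<zero>\<^bsub>V\<^esub>} \<or> W = carrier V)"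

definition rep_iso ::
    "'g monoid \<Rightarrow> ('g, 'k::field, 'v) rep \<Rightarrow> ('g, 'k, 'w) rep \<Rightarrow> bool" where
  "rep_iso G V W \<longleftrightarrow> (\<exists>f. linear_map class_ring V W f \<and> bij_betw f (carrier V) (carrier W) \<and>
     (\<forall>g\<in>carrier G. \<forall>v\<in>carrier V. f (act V g v) = act W g (f v)))"

definition dual_rep :: "'g monoid \<Rightarrow> ('g, 'k::field, 'v) rep \<Rightarrow> ('g, 'k, 'v \<Rightarrow> 'k) rep" where
  "dual_rep G V =
     \<lparr> carrier = {f \<in> extensional (carrier V).
          (\<forall>u\<in>carrier V. \<forall>v\<in>carrier V. f (u \<oplus>\<^bsub>V\<^esub> v) = f u + f v) \<and>
          (\<forall>a. \<forall>v\<in>carrier V. f (a \<odot>\<^bsub>V\<^esub> v) = a * f v)},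
       mult = undefined, one = undefined,
       zero = (\<lambda>v\<in>carrier V. 0),
       add = (\<lambda>f h. \<lambda>v\<in>carrier V. f v + h v),
       smult = (\<lambda>a f. \<lambda>v\<in>carrier V. a * f v),
       act = (\<lambda>g f. \<lambda>v\<in>carrier V. f (act V (inv\<^bsub>G\<^esub> g) v)) \<rparr>"

definition eval_at :: "'g monoid \<Rightarrow> ('g, 'k::field, 'v) rep \<Rightarrow> 'v \<Rightarrow> ('v \<Rightarrow> 'k) \<Rightarrow> 'k" where
  "eval_at G V v = (\<lambda>f\<in>carrier (dual_rep G V). f v)"

definition reflections :: "'g monoid \<Rightarrow> ('g, 'k::field, 'v) rep \<Rightarrow> 'g set" where
  "reflections G V = {s \<in> carrier G.
     vectorspace.dim class_ring
       (V\<lparr>carrier := (\<lambda>v. v \<ominus>\<^bsub>V\<^esub> act V s v) ` carrier V\<rparr>) = 1}"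


section \<open>The rational Cherednik algebra\<close>

text \<open>With concatenation as addition, finitely supported functions on words form the free
  associative algebra: the product of \<^typ>\<open>'a list \<Rightarrow>\<^sub>0 'k\<close> is convolution.\<close>

instantiation list :: (type) monoid_add
begin
definition zero_list :: "'a list" where "zero_list = []"
definition plus_list :: "'a list \<Rightarrow> 'a list \<Rightarrow> 'a list" where "plus_list = (@)"
instance by standard (simp_all add: zero_list_def plus_list_def)
end

definition free_algebra :: "'a set \<Rightarrow> ('a list \<Rightarrow>\<^sub>0 'k::field) ring" where
  "free_algebra S = \<lparr> carrier = {f. \<forall>w\<in>Poly_Mapping.keys f. set w \<subseteq> S},
     mult = (*), one = 1, zero = 0, add = (+) \<rparr>"

text \<open>\<open>Vec y\<close> stands for \<open>y \<in> \<hh>\<close>, \<open>Cov x\<close> for \<open>x \<in> \<hh>\<^sup>*\<close>.\<close>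

datatype ('g, 'y, 'x) letter = Grp 'g | Vec 'y | Cov 'x

type_synonym ('g, 'k, 'v) word_alg = "('g, 'v, 'v \<Rightarrow> 'k) letter list \<Rightarrow>\<^sub>0 'k"

type_synonym ('g, 'k, 'v) cher = "('g, 'k, 'v) word_alg set"

definition letters ::
    "'g monoid \<Rightarrow> ('g, 'k::field, 'v) rep \<Rightarrow> ('g, 'v, 'v \<Rightarrow> 'k) letter set" where
  "letters G V = Grp ` carrier G \<union> Vec ` carrier V \<union> Cov ` carrier (dual_rep G V)"

abbreviation sc :: "'k::field \<Rightarrow> ('a list \<Rightarrow>\<^sub>0 'k)" where
  "sc a \<equiv> Poly_Mapping.single [] a"

abbreviation lt :: "'a \<Rightarrow> ('a list \<Rightarrow>\<^sub>0 'k::field)" where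
  "lt z \<equiv> Poly_Mapping.single [z] 1"

text \<open>The free algebra on \<^const>\<open>letters\<close> modulo these relations is
  \<open>\<kk>G \<ltimes> T(\<hh> \<oplus> \<hh>\<^sup>*)\<close>.\<close>

definition smash_relations ::
    "'g monoid \<Rightarrow> ('g, 'k::field, 'v) rep \<Rightarrow> ('g, 'k, 'v) word_alg set" where
  "smash_relations G V = (let D = dual_rep G V in
     {lt (Vec (u \<oplus>\<^bsub>V\<^esub> v)) - lt (Vec u) - lt (Vec v) | u v. u \<in> carrier V \<and> v \<in> carrier V} \<union>
     {lt (Vec (a \<odot>\<^bsub>V\<^esub> v)) - sc a * lt (Vec v) | a v. v \<in> carrier V} \<union>
     {lt (Cov (x \<oplus>\<^bsub>D\<^esub> x')) - lt (Cov x) - lt (Cov x') | x x'. x \<in> carrier D \<and> x' \<in> carrier D} \<union>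
     {lt (Cov (a \<odot>\<^bsub>D\<^esub> x)) - sc a * lt (Cov x) | a x. x \<in> carrier D} \<union>
     {lt (Grp \<one>\<^bsub>G\<^esub>) - 1} \<union>
     {lt (Grp (g \<otimes>\<^bsub>G\<^esub> h)) - lt (Grp g) * lt (Grp h) | g h. g \<in> carrier G \<and> h \<in> carrier G} \<union>
     {lt (Grp g) * lt (Vec v) - lt (Vec (act V g v)) * lt (Grp g) | g v.
        g \<in> carrier G \<and> v \<in> carrier V} \<union>
     {lt (Grp g) * lt (Cov x) - lt (Cov (act D g x)) * lt (Grp g) | g x.
        g \<in> carrier G \<and> x \<in> carrier D})"

definition cherednik_relations ::
    "'g monoid \<Rightarrow> ('g, 'k::field, 'v) rep \<Rightarrow> 'k \<Rightarrow> ('g \<Rightarrow> 'k) \<Rightarrow> ('g, 'k, 'v) word_alg set" where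
  "cherednik_relations G V t c = (let D = dual_rep G V in
     {lt (Cov x) * lt (Cov x') - lt (Cov x') * lt (Cov x) | x x'.
        x \<in> carrier D \<and> x' \<in> carrier D} \<union>
     {lt (Vec y) * lt (Vec y') - lt (Vec y') * lt (Vec y) | y y'.
        y \<in> carrier V \<and> y' \<in> carrier V} \<union>
     {lt (Vec y) * lt (Cov x) - lt (Cov x) * lt (Vec y)
        - (sc (t * x y) - (\<Sum>s\<in>reflections G V. sc (c s * (x y - act D s x y)) * lt (Grp s))) | x y.
        x \<in> carrier D \<and> y \<in> carrier V})"

definition cher_ideal ::
    "'g monoid \<Rightarrow> ('g, 'k::field, 'v) rep \<Rightarrow> 'k \<Rightarrow> ('g \<Rightarrow> 'k) \<Rightarrow> ('g, 'k, 'v) cher" where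
  "cher_ideal G V t c =
     genideal (free_algebra (letters G V)) (smash_relations G V \<union> cherednik_relations G V t c)"

definition cherednik ::
    "'g monoid \<Rightarrow> ('g, 'k::field, 'v) rep \<Rightarrow> 'k \<Rightarrow> ('g \<Rightarrow> 'k) \<Rightarrow> ('g, 'k, 'v) cher ring" where
  "cherednik G V t c = free_algebra (letters G V) Quot cher_ideal G V t c"

definition cls :: "'g monoid \<Rightarrow> ('g, 'k::field, 'v) rep \<Rightarrow> 'k \<Rightarrow> ('g \<Rightarrow> 'k) \<Rightarrow>
    ('g, 'k, 'v) word_alg \<Rightarrow> ('g, 'k, 'v) cher" where
  "cls G V t c f = cher_ideal G V t c +>\<^bsub>free_algebra (letters G V)\<^esub> f"

fun letter_deg :: "('g, 'y, 'x) letter \<Rightarrow> int" where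
  "letter_deg (Grp g) = 0"
| "letter_deg (Vec y) = -1"
| "letter_deg (Cov x) = 1"

definition cher_grade :: "'g monoid \<Rightarrow> ('g, 'k::field, 'v) rep \<Rightarrow> 'k \<Rightarrow> ('g \<Rightarrow> 'k) \<Rightarrow>
    int \<Rightarrow> ('g, 'k, 'v) cher set" where
  "cher_grade G V t c i = cls G V t c ` {f \<in> carrier (free_algebra (letters G V)).
     \<forall>w\<in>Poly_Mapping.keys f. sum_list (map letter_deg w) = i}"


section \<open>Graded left modules\<close>

text \<open>The library locale \<^locale>\<open>module\<close> requires a commutative base ring.\<close>

locale left_module = R?: ring R + M?: abelian_group M
  for R :: "('a, 'r) ring_scheme" (structure) and M :: "('a, 'm, 'n) module_scheme" (structure) +
  assumes smult_closed:
      "\<lbrakk>a \<in> carrier R; x \<in> carrier M\<rbrakk> \<Longrightarrow> a \<odot>\<^bsub>M\<^esub> x \<in> carrier M"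
    and smult_l_distr:
      "\<lbrakk>a \<in> carrier R; b \<in> carrier R; x \<in> carrier M\<rbrakk> \<Longrightarrow>
        (a \<oplus>\<^bsub>R\<^esub> b) \<odot>\<^bsub>M\<^esub> x = a \<odot>\<^bsub>M\<^esub> x \<oplus>\<^bsub>M\<^esub> b \<odot>\<^bsub>M\<^esub> x"
    and smult_r_distr:
      "\<lbrakk>a \<in> carrier R; x \<in> carrier M; y \<in> carrier M\<rbrakk> \<Longrightarrow>
        a \<odot>\<^bsub>M\<^esub> (x \<oplus>\<^bsub>M\<^esub> y) = a \<odot>\<^bsub>M\<^esub> x \<oplus>\<^bsub>M\<^esub> a \<odot>\<^bsub>M\<^esub> y"
    and smult_assoc:
      "\<lbrakk>a \<in> carrier R; b \<in> carrier R; x \<in> carrier M\<rbrakk> \<Longrightarrow>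
        (a \<otimes>\<^bsub>R\<^esub> b) \<odot>\<^bsub>M\<^esub> x = a \<odot>\<^bsub>M\<^esub> (b \<odot>\<^bsub>M\<^esub> x)"
    and smult_one:
      "x \<in> carrier M \<Longrightarrow> \<one>\<^bsub>R\<^esub> \<odot>\<^bsub>M\<^esub> x = x"

record ('a, 'm) gmodule = "('a, 'm) module" +
  grade :: "int \<Rightarrow> 'm set"

definition homog_decomp :: "('a, 'm) gmodule \<Rightarrow> 'm \<Rightarrow> (int \<Rightarrow> 'm) \<Rightarrow> bool" where
  "homog_decomp M v f \<longleftrightarrow> (\<forall>i. f i \<in> grade M i) \<and> finite {i. f i \<noteq> \<zero>\<^bsub>M\<^esub>} \<and>
     v = (\<Oplus>\<^bsub>M\<^esub>i\<in>{i. f i \<noteq> \<zero>\<^bsub>M\<^esub>}. f i)"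

definition is_gmodule :: "'a ring \<Rightarrow> (int \<Rightarrow> 'a set) \<Rightarrow> ('a, 'm) gmodule \<Rightarrow> bool" where
  "is_gmodule R Rgr M \<longleftrightarrow> left_module R M \<and>
     (\<forall>i. subgroup (grade M i) (add_monoid M)) \<and>
     (\<forall>v\<in>carrier M. \<exists>!f. homog_decomp M v f) \<and>
     (\<forall>i j. \<forall>r\<in>Rgr i. \<forall>v\<in>grade M j. r \<odot>\<^bsub>M\<^esub> v \<in> grade M (i + j))"

definition is_gsubmodule :: "'a ring \<Rightarrow> 'm set \<Rightarrow> ('a, 'm) gmodule \<Rightarrow> bool" where
  "is_gsubmodule R N M \<longleftrightarrow> Module.submodule N R M \<and>
     (\<forall>v\<in>N. \<exists>f. homog_decomp M v f \<and> (\<forall>i. f i \<in> N))"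

definition gmodule_iso :: "'a ring \<Rightarrow> ('a, 'm) gmodule \<Rightarrow> ('a, 'n) gmodule \<Rightarrow> bool" where
  "gmodule_iso R M N \<longleftrightarrow> (\<exists>f. bij_betw f (carrier M) (carrier N) \<and>
     (\<forall>u\<in>carrier M. \<forall>v\<in>carrier M. f (u \<oplus>\<^bsub>M\<^esub> v) = f u \<oplus>\<^bsub>N\<^esub> f v) \<and>
     (\<forall>r\<in>carrier R. \<forall>v\<in>carrier M. f (r \<odot>\<^bsub>M\<^esub> v) = r \<odot>\<^bsub>N\<^esub> f v) \<and>
     (\<forall>i. f ` grade M i = grade N i))"

definition shift :: "('a, 'm) gmodule \<Rightarrow> int \<Rightarrow> ('a, 'm) gmodule" where
  "shift M j = M\<lparr>grade := (\<lambda>i. grade M (i + j))\<rparr>"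

definition gquot :: "('a, 'm) gmodule \<Rightarrow> 'm set \<Rightarrow> ('a, 'm set) gmodule" where
  "gquot M N =
     \<lparr> carrier = a_rcosets\<^bsub>M\<^esub> N,
       mult = undefined, one = undefined,
       zero = N,
       add = set_add M,
       smult = (\<lambda>r A. \<Union>m\<in>A. N +>\<^bsub>M\<^esub> (r \<odot>\<^bsub>M\<^esub> m)),
       grade = (\<lambda>i. (\<lambda>m. N +>\<^bsub>M\<^esub> m) ` grade M i) \<rparr>"

definition scalars :: "'g monoid \<Rightarrow> ('g, 'k::field, 'v) rep \<Rightarrow> 'k \<Rightarrow> ('g \<Rightarrow> 'k) \<Rightarrow>
    (('g, 'k, 'v) cher, 'm) gmodule \<Rightarrow> ('k, 'm) module" where
  "scalars G V t c M =
     \<lparr> carrier = carrier M, mult = mult M, one = one M, zero = zero M, add = add M,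
       smult = (\<lambda>a m. cls G V t c (sc a) \<odot>\<^bsub>M\<^esub> m) \<rparr>"

definition category_O :: "'g monoid \<Rightarrow> ('g, 'k::field, 'v) rep \<Rightarrow> 'k \<Rightarrow> ('g \<Rightarrow> 'k) \<Rightarrow>
    (('g, 'k, 'v) cher, 'm) gmodule set" where
  "category_O G V t c = {M. is_gmodule (cherednik G V t c) (cher_grade G V t c) M \<and>
     vectorspace.fin_dim class_ring (scalars G V t c M)}"

definition irreducible_O :: "'g monoid \<Rightarrow> ('g, 'k::field, 'v) rep \<Rightarrow> 'k \<Rightarrow> ('g \<Rightarrow> 'k) \<Rightarrow>
    (('g, 'k, 'v) cher, 'm) gmodule \<Rightarrow> bool" where
  "irreducible_O G V t c M \<longleftrightarrow> M \<in> category_O G V t c \<and> carrier M \<noteq> {\<zero>\<^bsub>M\<^esub>} \<and>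
     (\<forall>N. is_gsubmodule (cherednik G V t c) N M \<longrightarrow> N = {\<zero>\<^bsub>M\<^esub>} \<or> N = carrier M)"


section \<open>Verma modules\<close>

text \<open>\<open>(b, w, u) \<in> kGSh_action G V t c W\<close> means that \<open>b\<close> is the image in the Cherednik algebra of
  an element of \<open>\<kk>G \<ltimes> S\<hh>\<close> which maps \<open>w\<close> to \<open>u\<close>, where \<open>\<hh>\<close> acts on \<open>W\<close> by zero.\<close>

inductive_set kGSh_action :: "'g monoid \<Rightarrow> ('g, 'k::field, 'v) rep \<Rightarrow> 'k \<Rightarrow> ('g \<Rightarrow> 'k) \<Rightarrow>
    ('g, 'k, 'w) rep \<Rightarrow> (('g, 'k, 'v) cher \<times> 'w \<times> 'w) set"
  for G V t c W where
  scalar: "w \<in> carrier W \<Longrightarrow> (cls G V t c (sc a), w, a \<odot>\<^bsub>W\<^esub> w) \<in> kGSh_action G V t c W"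
| grp: "g \<in> carrier G \<Longrightarrow> w \<in> carrier W \<Longrightarrow>
    (cls G V t c (lt (Grp g)), w, act W g w) \<in> kGSh_action G V t c W"
| vec: "y \<in> carrier V \<Longrightarrow> w \<in> carrier W \<Longrightarrow>
    (cls G V t c (lt (Vec y)), w, \<zero>\<^bsub>W\<^esub>) \<in> kGSh_action G V t c W"
| sum: "(b, w, u) \<in> kGSh_action G V t c W \<Longrightarrow> (b', w, u') \<in> kGSh_action G V t c W \<Longrightarrow>
    (b \<oplus>\<^bsub>cherednik G V t c\<^esub> b', w, u \<oplus>\<^bsub>W\<^esub> u') \<in> kGSh_action G V t c W"
| prod: "(b, w, u) \<in> kGSh_action G V t c W \<Longrightarrow> (b', u, u') \<in> kGSh_action G V t c W \<Longrightarrow>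
    (b' \<otimes>\<^bsub>cherednik G V t c\<^esub> b, w, u') \<in> kGSh_action G V t c W"

text \<open>The tensor product over \<open>\<kk>G \<ltimes> S\<hh>\<close> is the free abelian group on pairs modulo
  the subgroup \<open>tensor_relations\<close>. The operation \<open>r \<cdot> (r', w) = (r r', w)\<close>, extended additively, is a
  left module structure only on the quotient, and likewise \<open>grade\<close> is a grading only there.\<close>

definition pairs :: "'g monoid \<Rightarrow> ('g, 'k::field, 'v) rep \<Rightarrow> 'k \<Rightarrow> ('g \<Rightarrow> 'k) \<Rightarrow>
    ('g, 'k, 'w) rep \<Rightarrow> (('g, 'k, 'v) cher, ('g, 'k, 'v) cher \<times> 'w \<Rightarrow>\<^sub>0 int) gmodule" where
  "pairs G V t c W = (let H = cherednik G V t c in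
     \<lparr> carrier = {f. Poly_Mapping.keys f \<subseteq> carrier H \<times> carrier W},
       mult = undefined, one = undefined, zero = 0, add = (+),
       smult = (\<lambda>r. frag_extend (\<lambda>(r', w). frag_of (r \<otimes>\<^bsub>H\<^esub> r', w))),
       grade = (\<lambda>i. {f. Poly_Mapping.keys f \<subseteq> cher_grade G V t c i \<times> carrier W}) \<rparr>)"

definition tensor_relations :: "'g monoid \<Rightarrow> ('g, 'k::field, 'v) rep \<Rightarrow> 'k \<Rightarrow> ('g \<Rightarrow> 'k) \<Rightarrow>
    ('g, 'k, 'w) rep \<Rightarrow> (('g, 'k, 'v) cher \<times> 'w \<Rightarrow>\<^sub>0 int) set" where
  "tensor_relations G V t c W = (let H = cherednik G V t c in
     generate (add_monoid (pairs G V t c W))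
       ({frag_of (r \<oplus>\<^bsub>H\<^esub> r', w) - frag_of (r, w) - frag_of (r', w) | r r' w.
           r \<in> carrier H \<and> r' \<in> carrier H \<and> w \<in> carrier W} \<union>
        {frag_of (r, w \<oplus>\<^bsub>W\<^esub> w') - frag_of (r, w) - frag_of (r, w') | r w w'.
           r \<in> carrier H \<and> w \<in> carrier W \<and> w' \<in> carrier W} \<union>
        {frag_of (r \<otimes>\<^bsub>H\<^esub> b, w) - frag_of (r, u) | r b w u.
           r \<in> carrier H \<and> (b, w, u) \<in> kGSh_action G V t c W}))"

definition verma :: "'g monoid \<Rightarrow> ('g, 'k::field, 'v) rep \<Rightarrow> 'k \<Rightarrow> ('g \<Rightarrow> 'k) \<Rightarrow>
    ('g, 'k, 'w) rep \<Rightarrow> (('g, 'k, 'v) cher, (('g, 'k, 'v) cher \<times> 'w \<Rightarrow>\<^sub>0 int) set) gmodule" where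
  "verma G V t c W = gquot (pairs G V t c W) (tensor_relations G V t c W)"

definition pure_tensor :: "'g monoid \<Rightarrow> ('g, 'k::field, 'v) rep \<Rightarrow> 'k \<Rightarrow> ('g \<Rightarrow> 'k) \<Rightarrow>
    ('g, 'k, 'w) rep \<Rightarrow> ('g, 'k, 'v) cher \<Rightarrow> 'w \<Rightarrow> (('g, 'k, 'v) cher \<times> 'w \<Rightarrow>\<^sub>0 int) set" where
  "pure_tensor G V t c W r w = tensor_relations G V t c W +>\<^bsub>pairs G V t c W\<^esub> frag_of (r, w)"


section \<open>The contravariant form\<close>

definition cbar :: "'g monoid \<Rightarrow> ('g \<Rightarrow> 'k) \<Rightarrow> 'g \<Rightarrow> 'k" where
  "cbar G c s = c (inv\<^bsub>G\<^esub> s)"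

text \<open>The generators of the algebra of \<open>\<hh>\<^sup>*\<close> are \<open>Vec x\<close> for \<open>x \<in> \<hh>\<^sup>*\<close> and \<open>Cov \<xi>\<close> for
  \<open>\<xi> \<in> \<hh>\<^sup>*\<^sup>*\<close>; \<^const>\<open>eval_at\<close> is the canonical identification of \<open>\<hh>\<close> with \<open>\<hh>\<^sup>*\<^sup>*\<close>.
  The invariance clauses for \<open>g\<close>, \<open>y\<close>, \<open>x\<close> say that \<open>m \<mapsto> B m\<close> commutes with these generators, which
  act on the restricted dual through \<open>y \<mapsto> y\<close>, \<open>x \<mapsto> x\<close>, \<open>g \<mapsto> g\<inverse>\<close>; the last two clauses say
  that it preserves degrees and is the identity of \<open>\<tau>\<close> in degree \<open>0\<close>.\<close>

definition contravariant_form :: "'g monoid \<Rightarrow> ('g, 'k::field, 'v) rep \<Rightarrow> 'k \<Rightarrow> ('g \<Rightarrow> 'k) \<Rightarrow>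
    ('g, 'k, 'w) rep \<Rightarrow>
    ((('g, 'k, 'v) cher \<times> 'w \<Rightarrow>\<^sub>0 int) set \<Rightarrow>
     (('g, 'k, 'v \<Rightarrow> 'k) cher \<times> ('w \<Rightarrow> 'k) \<Rightarrow>\<^sub>0 int) set \<Rightarrow> 'k) \<Rightarrow> bool" where
  "contravariant_form G V t c \<tau> B \<longleftrightarrow>
    (let D = dual_rep G V; \<tau>' = dual_rep G \<tau>; c' = cbar G c;
         M = verma G V t c \<tau>; M' = verma G D t c' \<tau>';
         e = cls G V t c; e' = cls G D t c' in
     (\<forall>m\<in>carrier M. \<forall>n\<in>carrier M. \<forall>m'\<in>carrier M'. B (m \<oplus>\<^bsub>M\<^esub> n) m' = B m m' + B n m') \<and>
     (\<forall>m\<in>carrier M. \<forall>m'\<in>carrier M'. \<forall>n'\<in>carrier M'. B m (m' \<oplus>\<^bsub>M'\<^esub> n') = B m m' + B m n') \<and>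
     (\<forall>a. \<forall>m\<in>carrier M. \<forall>m'\<in>carrier M'. B (e (sc a) \<odot>\<^bsub>M\<^esub> m) m' = a * B m m') \<and>
     (\<forall>a. \<forall>m\<in>carrier M. \<forall>m'\<in>carrier M'. B m (e' (sc a) \<odot>\<^bsub>M'\<^esub> m') = a * B m m') \<and>
     (\<forall>g\<in>carrier G. \<forall>m\<in>carrier M. \<forall>m'\<in>carrier M'.
        B (e (lt (Grp g)) \<odot>\<^bsub>M\<^esub> m) m' = B m (e' (lt (Grp (inv\<^bsub>G\<^esub> g))) \<odot>\<^bsub>M'\<^esub> m')) \<and>
     (\<forall>y\<in>carrier V. \<forall>m\<in>carrier M. \<forall>m'\<in>carrier M'.
        B (e (lt (Vec y)) \<odot>\<^bsub>M\<^esub> m) m' = B m (e' (lt (Cov (eval_at G V y))) \<odot>\<^bsub>M'\<^esub> m')) \<and>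
     (\<forall>x\<in>carrier D. \<forall>m\<in>carrier M. \<forall>m'\<in>carrier M'.
        B (e (lt (Cov x)) \<odot>\<^bsub>M\<^esub> m) m' = B m (e' (lt (Vec x)) \<odot>\<^bsub>M'\<^esub> m')) \<and>
     (\<forall>i j. i \<noteq> j \<longrightarrow> (\<forall>m\<in>grade M i. \<forall>m'\<in>grade M' j. B m m' = 0)) \<and>
     (\<forall>w\<in>carrier \<tau>. \<forall>f\<in>carrier \<tau>'.
        B (pure_tensor G V t c \<tau> \<one>\<^bsub>cherednik G V t c\<^esub> w)
          (pure_tensor G D t c' \<tau>' \<one>\<^bsub>cherednik G D t c'\<^esub> f) = f w))"

text \<open>There is exactly one contravariant form up to its values outside the carriers, so the
  quantifier over \<open>B\<close> below selects the kernel of that form.\<close>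

definition form_kernel :: "'g monoid \<Rightarrow> ('g, 'k::field, 'v) rep \<Rightarrow> 'k \<Rightarrow> ('g \<Rightarrow> 'k) \<Rightarrow>
    ('g, 'k, 'w) rep \<Rightarrow> (('g, 'k, 'v) cher \<times> 'w \<Rightarrow>\<^sub>0 int) set set" where
  "form_kernel G V t c \<tau> = {m \<in> carrier (verma G V t c \<tau>). \<forall>B. contravariant_form G V t c \<tau> B \<longrightarrow>
     (\<forall>m'\<in>carrier (verma G (dual_rep G V) t (cbar G c) (dual_rep G \<tau>)). B m m' = 0)}"

definition simple_quotient :: "'g monoid \<Rightarrow> ('g, 'k::field, 'v) rep \<Rightarrow> 'k \<Rightarrow> ('g \<Rightarrow> 'k) \<Rightarrow>
    ('g, 'k, 'w) rep \<Rightarrow>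
    (('g, 'k, 'v) cher, (('g, 'k, 'v) cher \<times> 'w \<Rightarrow>\<^sub>0 int) set set) gmodule" where
  "simple_quotient G V t c \<tau> = gquot (verma G V t c \<tau>) (form_kernel G V t c \<tau>)"

end

theory Submission
  imports "HOL-Algebra.Free_Abelian_Groups" Defs
begin

text \<open>
  Let \<open>L\<close> be irreducible and let \<open>d\<close> be the lowest degree in which it does not vanish; it exists
  because \<open>L\<close> is finite-dimensional. Elements of \<open>\<hh>\<close> lower degrees, so they kill \<open>\<tau> = L\<^sub>d\<close>. The defining
  relations allow one to move the elements of \<open>\<hh>\<close> to the right and those of \<open>\<hh>\<^sup>*\<close> to the left
  (\<open>cov_span_smult\<close>). Hence a \<open>G\<close>-stable subspace \<open>U\<close> of \<open>L\<^sub>d\<close> generates a graded submodule whose part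
  of degree \<open>d\<close> is \<open>U\<close>. Irreducibility of \<open>L\<close> therefore makes \<open>\<tau>\<close> irreducible
  (\<open>\<tau>_irreducible\<close>) and makes the map \<open>\<pi>\<close> from the Verma module of \<open>\<tau>\<close> to \<open>L\<close> with
  \<open>\<pi> (r \<otimes> w) = r w\<close> surjective (\<open>\<pi>_surj\<close>).

  It remains to see that the kernel of \<open>\<pi>\<close> is the kernel of the contravariant form
  (\<open>form_kernel_eq\<close>). The form is obtained from \<open>L\<close> itself. The algebra of \<open>\<hh>\<^sup>*\<close> maps to that
  of \<open>\<hh>\<close> by an anti-homomorphism that is the identity on \<open>\<hh>\<close> and \<open>\<hh>\<^sup>*\<close> and inverts group
  elements (\<open>adjoint\<close>), and \<open>B m (r \<otimes> f) = f ((adjoint r \<cdot> \<pi> m)\<^sub>d)\<close> is a contravariant form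
  (\<open>\<psi>_form\<close>). An element \<open>v\<close> of \<open>L\<close> with \<open>(r v)\<^sub>d = 0\<close> for all \<open>r\<close> vanishes, because these elements
  form a proper graded submodule; so this form has kernel \<open>ker \<pi>\<close>. Every other contravariant form
  agrees with it: invariance moves \<open>r\<close> to the other side, so only the values \<open>B m (1 \<otimes> f)\<close> matter;
  these depend on the part of \<open>m\<close> of degree \<open>0\<close> only, which lies in \<open>1 \<otimes> \<tau>\<close>, where the form is
  prescribed (\<open>form_lowest\<close>).

  For uniqueness, an isomorphism of \<open>L\<close> with the simple quotient attached to \<open>\<sigma>\<close>, shifted by
  \<open>j\<close>, gives a surjection of the Verma module of \<open>\<sigma>\<close> onto \<open>L\<close> that lowers degrees by \<open>j\<close>. That Verma
  module vanishes in negative degrees and is generated by its part \<open>1 \<otimes> \<sigma>\<close> of degree \<open>0\<close>. So the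
  lowest degree of \<open>L\<close> is \<open>- j\<close>, and \<open>\<sigma> \<rightarrow> L\<^sub>d\<close> is a surjective map of representations, which is
  injective because \<open>\<sigma>\<close> is irreducible (\<open>lowest_weight_unique\<close>).
\<close>

section \<open>Linear functionals\<close>

text \<open>Being extensional, two functionals are equal as soon as they agree on the carrier. This is the
  carrier of the dual representation.\<close>

definition functionals :: "('k::field, 'v, 'm) module_scheme \<Rightarrow> ('v \<Rightarrow> 'k) set" where
  "functionals V = {f \<in> extensional (carrier V).
     (\<forall>u\<in>carrier V. \<forall>v\<in>carrier V. f (u \<oplus>\<^bsub>V\<^esub> v) = f u + f v) \<and>
     (\<forall>a. \<forall>v\<in>carrier V. f (a \<odot>\<^bsub>V\<^esub> v) = a * f v)}"

lemma functionalsD: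
  assumes "f \<in> functionals V"
  shows "\<And>u v. u \<in> carrier V \<Longrightarrow> v \<in> carrier V \<Longrightarrow> f (u \<oplus>\<^bsub>V\<^esub> v) = f u + f v"
    and "\<And>a v. v \<in> carrier V \<Longrightarrow> f (a \<odot>\<^bsub>V\<^esub> v) = a * f v"
    and "f \<in> extensional (carrier V)"
  using assms by (auto simp: functionals_def)

lemma functional_zero:
  assumes "vectorspace class_ring V" "f \<in> functionals V"
  shows "f \<zero>\<^bsub>V\<^esub> = 0"
proof -
  interpret vectorspace class_ring V by fact
  have "f (0 \<odot>\<^bsub>V\<^esub> \<zero>\<^bsub>V\<^esub>) = 0 * f \<zero>\<^bsub>V\<^esub>" by (rule functionalsD(2)[OF assms(2)]) simp
  thus ?thesis by simp
qed

lemma functional_lincomb: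
  assumes "vectorspace class_ring V" "f \<in> functionals V" "finite A" "A \<subseteq> carrier V"
  shows "f (module.lincomb V a A) = (\<Sum>v\<in>A. a v * f v)"
proof -
  interpret vectorspace class_ring V by fact
  show ?thesis using assms(3,4)
  proof (induction A rule: finite_induct)
    case empty
    then show ?case using functional_zero[OF assms(1,2)] by (simp add: lincomb_def)
  next
    case (insert v A)
    have "lincomb a (insert v A) = a v \<odot>\<^bsub>V\<^esub> v \<oplus>\<^bsub>V\<^esub> lincomb a A"
      using lincomb_insert[of A a v] insert by simp
    moreover have "lincomb a A \<in> carrier V" using insert by (intro lincomb_closed) auto
    ultimately show ?case using insert functionalsD(1,2)[OF assms(2)] by simp
  qed
qed

text \<open>The coordinates with respect to a finite basis are functionals. Separation of points, finite
  dimension of the dual and biduality all follow from this expansion.\<close>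

lemma dual_basis:
  assumes "vectorspace class_ring V" "vectorspace.fin_dim class_ring V"
  obtains A \<phi> where "finite A" "A \<subseteq> carrier V" "\<And>a. a \<in> A \<Longrightarrow> \<phi> a \<in> functionals V"
    "\<And>v. v \<in> carrier V \<Longrightarrow> v = module.lincomb V (\<lambda>a. \<phi> a v) A"
proof -
  interpret vectorspace class_ring V by fact
  obtain A where A: "finite A" "basis A" using finite_basis_exists assms(2) by blast
  hence Ac: "A \<subseteq> carrier V" by (simp add: basis_def)
  define co where "co v = (THE a. a \<in> A \<rightarrow>\<^sub>E UNIV \<and> lincomb a A = v)" for v
  have ex1: "\<exists>!a. a \<in> A \<rightarrow>\<^sub>E UNIV \<and> lincomb a A = v" if "v \<in> carrier V" for v
    using basis_criterion[OF A(1) Ac] A(2) that by simp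
  have co: "co v \<in> A \<rightarrow>\<^sub>E UNIV" "lincomb (co v) A = v" if "v \<in> carrier V" for v
    using theI'[OF ex1[OF that]] unfolding co_def by auto
  have coeq: "a \<in> A \<Longrightarrow> co v a = b a" if "v \<in> carrier V" "lincomb b A = v" for v b a
  proof -
    assume a: "a \<in> A"
    have "lincomb (restrict b A) A = lincomb b A"
      by (rule lincomb_cong) (use Ac in auto)
    hence "co v = restrict b A"
      using ex1[OF that(1)] co[OF that(1)] that(2) by (metis restrict_PiE_iff UNIV_I)
    thus ?thesis using a by simp
  qed
  define \<phi> where "\<phi> a = (\<lambda>v\<in>carrier V. co v a)" for a
  show ?thesis
  proof (rule that[OF A(1) Ac])
    fix a assume a: "a \<in> A"
    have "co (u \<oplus>\<^bsub>V\<^esub> v) a = co u a + co v a" if "u \<in> carrier V" "v \<in> carrier V" for u v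
    proof (rule coeq[OF _ _ a])
      show "lincomb (\<lambda>a. co u a + co v a) A = u \<oplus>\<^bsub>V\<^esub> v"
        using lincomb_sum[OF A(1) Ac, of "co u" "co v"] co that by simp
    qed (use that in auto)
    moreover have "co (b \<odot>\<^bsub>V\<^esub> v) a = b * co v a" if "v \<in> carrier V" for b v
    proof (rule coeq[OF _ _ a])
      show "lincomb (\<lambda>a. b * co v a) A = b \<odot>\<^bsub>V\<^esub> v"
        using lincomb_smult[OF Ac, of "co v" b] co that by simp
    qed (use that in auto)
    ultimately show "\<phi> a \<in> functionals V" by (simp add: \<phi>_def functionals_def)
  next
    fix v assume v: "v \<in> carrier V"
    show "v = lincomb (\<lambda>a. \<phi> a v) A" using co[OF v] v by (simp add: \<phi>_def)
  qed
qed

lemma functionals_separate: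
  assumes "vectorspace class_ring V" "vectorspace.fin_dim class_ring V"
    "u \<in> carrier V" "v \<in> carrier V" "\<And>f. f \<in> functionals V \<Longrightarrow> f u = f v"
  shows "u = v"
proof -
  interpret vectorspace class_ring V by fact
  obtain A \<phi> where A: "finite A" "A \<subseteq> carrier V" "\<And>a. a \<in> A \<Longrightarrow> \<phi> a \<in> functionals V"
    "\<And>v. v \<in> carrier V \<Longrightarrow> v = lincomb (\<lambda>a. \<phi> a v) A"
    using dual_basis[OF assms(1,2)] by blast
  have "lincomb (\<lambda>a. \<phi> a u) A = lincomb (\<lambda>a. \<phi> a v) A"
    by (rule lincomb_cong) (use A assms(5) in auto)
  thus ?thesis using A(4) assms(3,4) by metis
qed

text \<open>The coefficients of a functional in the dual basis are its values on the basis.\<close>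

lemma functional_expand:
  assumes "vectorspace class_ring V" "finite A" "A \<subseteq> carrier V"
    "\<And>v. v \<in> carrier V \<Longrightarrow> v = module.lincomb V (\<lambda>a. \<phi> a v) A" "f \<in> functionals V"
  shows "f = (\<lambda>v\<in>carrier V. \<Sum>a\<in>A. f a * \<phi> a v)"
proof
  fix v
  show "f v = (\<lambda>v\<in>carrier V. \<Sum>a\<in>A. f a * \<phi> a v) v"
  proof (cases "v \<in> carrier V")
    case True
    have "f v = f (module.lincomb V (\<lambda>a. \<phi> a v) A)" using assms(4)[OF True] by simp
    also have "\<dots> = (\<Sum>a\<in>A. \<phi> a v * f a)"
      using functional_lincomb[OF assms(1,5,2,3)] .
    finally show ?thesis using True by (simp add: mult.commute)
  next
    case False
    then show ?thesis using functionalsD(3)[OF assms(5)] by (auto simp: extensional_def)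
  qed
qed

section \<open>Dual representations\<close>

lemma dual_rep_simps [simp]:
  "carrier (dual_rep G V) = functionals V"
  "\<zero>\<^bsub>dual_rep G V\<^esub> = (\<lambda>v\<in>carrier V. 0)"
  "add (dual_rep G V) = (\<lambda>f h. \<lambda>v\<in>carrier V. f v + h v)"
  "smult (dual_rep G V) = (\<lambda>a f. \<lambda>v\<in>carrier V. a * f v)"
  "act (dual_rep G V) = (\<lambda>g f. \<lambda>v\<in>carrier V. f (act V (inv\<^bsub>G\<^esub> g) v))"
  by (simp_all add: dual_rep_def functionals_def)

lemma field_class_ring: "field (class_ring :: 'k::field ring)"
  by (rule class_field.field_axioms)

lemma is_repD:
  assumes "is_rep G V"
  shows "vectorspace class_ring V"
    and "\<And>g v. g \<in> carrier G \<Longrightarrow> v \<in> carrier V \<Longrightarrow> act V g v \<in> carrier V"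
    and "\<And>g u v. g \<in> carrier G \<Longrightarrow> u \<in> carrier V \<Longrightarrow> v \<in> carrier V \<Longrightarrow>
      act V g (u \<oplus>\<^bsub>V\<^esub> v) = act V g u \<oplus>\<^bsub>V\<^esub> act V g v"
    and "\<And>g a v. g \<in> carrier G \<Longrightarrow> v \<in> carrier V \<Longrightarrow> act V g (a \<odot>\<^bsub>V\<^esub> v) = a \<odot>\<^bsub>V\<^esub> act V g v"
    and "\<And>v. v \<in> carrier V \<Longrightarrow> act V \<one>\<^bsub>G\<^esub> v = v"
    and "\<And>g h v. g \<in> carrier G \<Longrightarrow> h \<in> carrier G \<Longrightarrow> v \<in> carrier V \<Longrightarrow>
      act V (g \<otimes>\<^bsub>G\<^esub> h) v = act V g (act V h v)"
proof -
  have lin: "linear_map class_ring V V (act V g)" if "g \<in> carrier G" for g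
    using assms that by (simp add: is_rep_def)
  show "vectorspace class_ring V" using assms by (simp add: is_rep_def)
  show "act V g v \<in> carrier V" if "g \<in> carrier G" "v \<in> carrier V" for g v
  proof -
    interpret T: linear_map class_ring V V "act V g" by (rule lin[OF that(1)])
    show ?thesis using that(2) by (rule T.T_im)
  qed
  show "act V g (u \<oplus>\<^bsub>V\<^esub> v) = act V g u \<oplus>\<^bsub>V\<^esub> act V g v"
    if "g \<in> carrier G" "u \<in> carrier V" "v \<in> carrier V" for g u v
  proof -
    interpret T: linear_map class_ring V V "act V g" by (rule lin[OF that(1)])
    show ?thesis using that(2,3) by (rule T.T_add)
  qed
  show "act V g (a \<odot>\<^bsub>V\<^esub> v) = a \<odot>\<^bsub>V\<^esub> act V g v" if "g \<in> carrier G" "v \<in> carrier V" for g a v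
  proof -
    interpret T: linear_map class_ring V V "act V g" by (rule lin[OF that(1)])
    show ?thesis using that(2) by (intro T.T_smult) auto
  qed
  show "act V \<one>\<^bsub>G\<^esub> v = v" if "v \<in> carrier V" for v
    using assms that unfolding is_rep_def by blast
  show "act V (g \<otimes>\<^bsub>G\<^esub> h) v = act V g (act V h v)"
    if "g \<in> carrier G" "h \<in> carrier G" "v \<in> carrier V" for g h v
    using assms that unfolding is_rep_def by blast
qed

lemma linear_mapI:
  fixes V :: "('k::field, 'v, 'm) module_scheme" and W :: "('k, 'w, 'n) module_scheme"
  assumes "vectorspace class_ring V" "vectorspace class_ring W"
    and "\<And>v. v \<in> carrier V \<Longrightarrow> f v \<in> carrier W"
    and "\<And>u v. u \<in> carrier V \<Longrightarrow> v \<in> carrier V \<Longrightarrow> f (u \<oplus>\<^bsub>V\<^esub> v) = f u \<oplus>\<^bsub>W\<^esub> f v"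
    and "\<And>a v. v \<in> carrier V \<Longrightarrow> f (a \<odot>\<^bsub>V\<^esub> v) = a \<odot>\<^bsub>W\<^esub> f v"
  shows "linear_map class_ring V W f"
proof -
  have "f \<in> LinearCombinations.module_hom class_ring V W"
    unfolding LinearCombinations.module_hom_def using assms(3-5) by auto
  thus ?thesis
    using assms(1,2) unfolding linear_map_def mod_hom_def mod_hom_axioms_def vectorspace_def by blast
qed

lemma is_repI:
  assumes "vectorspace class_ring V"
    and "\<And>g v. g \<in> carrier G \<Longrightarrow> v \<in> carrier V \<Longrightarrow> act V g v \<in> carrier V"
    and "\<And>g u v. g \<in> carrier G \<Longrightarrow> u \<in> carrier V \<Longrightarrow> v \<in> carrier V \<Longrightarrow>
      act V g (u \<oplus>\<^bsub>V\<^esub> v) = act V g u \<oplus>\<^bsub>V\<^esub> act V g v"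
    and "\<And>g a v. g \<in> carrier G \<Longrightarrow> v \<in> carrier V \<Longrightarrow> act V g (a \<odot>\<^bsub>V\<^esub> v) = a \<odot>\<^bsub>V\<^esub> act V g v"
    and "\<And>v. v \<in> carrier V \<Longrightarrow> act V \<one>\<^bsub>G\<^esub> v = v"
    and "\<And>g h v. g \<in> carrier G \<Longrightarrow> h \<in> carrier G \<Longrightarrow> v \<in> carrier V \<Longrightarrow>
      act V (g \<otimes>\<^bsub>G\<^esub> h) v = act V g (act V h v)"
  shows "is_rep G V"
  unfolding is_rep_def by (intro conjI ballI linear_mapI assms)

lemma vectorspace_closed:
  assumes "vectorspace class_ring V"
  shows "\<And>u v. u \<in> carrier V \<Longrightarrow> v \<in> carrier V \<Longrightarrow> u \<oplus>\<^bsub>V\<^esub> v \<in> carrier V"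
    and "\<And>a v. v \<in> carrier V \<Longrightarrow> a \<odot>\<^bsub>V\<^esub> v \<in> carrier V"
    and "\<zero>\<^bsub>V\<^esub> \<in> carrier V"
proof -
  interpret vectorspace class_ring V by fact
  show "u \<oplus>\<^bsub>V\<^esub> v \<in> carrier V" if "u \<in> carrier V" "v \<in> carrier V" for u v
    using that by (rule a_closed)
  show "a \<odot>\<^bsub>V\<^esub> v \<in> carrier V" if "v \<in> carrier V" for a v
    using that by (intro smult_closed) auto
  show "\<zero>\<^bsub>V\<^esub> \<in> carrier V" by (rule M.zero_closed)
qed

lemma restrict_functional:
  assumes "vectorspace class_ring V"
    and "\<And>u v. u \<in> carrier V \<Longrightarrow> v \<in> carrier V \<Longrightarrow> f (u \<oplus>\<^bsub>V\<^esub> v) = f u + f v"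
    and "\<And>a v. v \<in> carrier V \<Longrightarrow> f (a \<odot>\<^bsub>V\<^esub> v) = a * f v"
  shows "(\<lambda>v\<in>carrier V. f v) \<in> functionals V"
  using vectorspace_closed[OF assms(1)] by (simp add: functionals_def assms(2,3))

lemma dual_is_vectorspace:
  assumes "vectorspace class_ring (V :: ('g, 'k::field, 'v) rep)"
  shows "vectorspace class_ring (dual_rep G V)"
proof -
  let ?D = "dual_rep G V"
  have add: "f \<oplus>\<^bsub>?D\<^esub> h \<in> functionals V" if "f \<in> functionals V" "h \<in> functionals V" for f h
    unfolding dual_rep_simps
    by (rule restrict_functional[OF assms])
      (simp_all add: functionalsD[OF that(1)] functionalsD[OF that(2)] algebra_simps)
  have smult: "a \<odot>\<^bsub>?D\<^esub> f \<in> functionals V" if "f \<in> functionals V" for f a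
    unfolding dual_rep_simps
    by (rule restrict_functional[OF assms]) (simp_all add: functionalsD[OF that] algebra_simps)
  have zero: "\<zero>\<^bsub>?D\<^esub> \<in> functionals V"
    unfolding dual_rep_simps by (rule restrict_functional[OF assms]) simp_all
  have neg: "\<exists>h\<in>carrier ?D. f \<oplus>\<^bsub>?D\<^esub> h = \<zero>\<^bsub>?D\<^esub>" if "f \<in> carrier ?D" for f
  proof (rule bexI)
    show "f \<oplus>\<^bsub>?D\<^esub> (- 1 \<odot>\<^bsub>?D\<^esub> f) = \<zero>\<^bsub>?D\<^esub>" by (simp add: fun_eq_iff restrict_def)
    show "- 1 \<odot>\<^bsub>?D\<^esub> f \<in> carrier ?D" using smult that by (simp only: dual_rep_simps(1))
  qed
  have r: "restrict f (carrier V) v = (if v \<in> carrier V then f v else undefined)" for f :: "'v \<Rightarrow> 'k" and v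
    by (simp add: restrict_def)
  have ev: "f v = undefined" if "f \<in> functionals V" "v \<notin> carrier V" for f v
    using functionalsD(3)[OF that(1)] that(2) by (simp add: extensional_def)
  show ?thesis
  proof (rule vs_criteria[OF field_class_ring])
    show "\<forall>v\<in>carrier ?D. \<exists>neg_v\<in>carrier ?D. v \<oplus>\<^bsub>?D\<^esub> neg_v = \<zero>\<^bsub>?D\<^esub>" using neg by blast
    show "\<zero>\<^bsub>?D\<^esub> \<in> carrier ?D" using zero by (simp only: dual_rep_simps(1))
    show "\<forall>v w. v \<in> carrier ?D \<and> w \<in> carrier ?D \<longrightarrow> v \<oplus>\<^bsub>?D\<^esub> w \<in> carrier ?D"
      using add by (simp only: dual_rep_simps(1)) blast
    show "\<forall>c v. c \<in> carrier class_ring \<and> v \<in> carrier ?D \<longrightarrow> c \<odot>\<^bsub>?D\<^esub> v \<in> carrier ?D"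
      using smult by (simp only: dual_rep_simps(1)) blast
    show "\<forall>v\<in>carrier ?D. v \<oplus>\<^bsub>?D\<^esub> \<zero>\<^bsub>?D\<^esub> = v"
    proof
      fix v assume v: "v \<in> carrier ?D"
      hence "v \<in> functionals V" by (simp only: dual_rep_simps(1))
      from ev[OF this] show "v \<oplus>\<^bsub>?D\<^esub> \<zero>\<^bsub>?D\<^esub> = v"
        unfolding dual_rep_simps by (simp only: fun_eq_iff r) auto
    qed
    show "\<forall>v\<in>carrier ?D. \<one>\<^bsub>class_ring\<^esub> \<odot>\<^bsub>?D\<^esub> v = v"
    proof
      fix v assume v: "v \<in> carrier ?D"
      hence "v \<in> functionals V" by (simp only: dual_rep_simps(1))
      from ev[OF this] show "\<one>\<^bsub>class_ring\<^esub> \<odot>\<^bsub>?D\<^esub> v = v"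
        unfolding dual_rep_simps by (simp only: fun_eq_iff r) auto
    qed
  qed (use add smult in \<open>auto simp: fun_eq_iff r algebra_simps simp del: restrict_apply\<close>)
qed

lemma dual_is_rep:
  assumes "group G" "is_rep G (V :: ('g, 'k::field, 'v) rep)"
  shows "is_rep G (dual_rep G V)"
proof -
  note V = is_repD[OF assms(2)]
  note cl = vectorspace_closed[OF V(1)]
  have inv: "inv\<^bsub>G\<^esub> g \<in> carrier G" if "g \<in> carrier G" for g
    using assms(1) that by (rule group.inv_closed)
  have r: "restrict f (carrier V) v = (if v \<in> carrier V then f v else undefined)" for f :: "'v \<Rightarrow> 'k" and v
    by (simp add: restrict_def)
  show ?thesis
  proof (rule is_repI[OF dual_is_vectorspace[OF V(1)]])
    fix g f assume g: "g \<in> carrier G" and "f \<in> carrier (dual_rep G V)"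
    hence f: "f \<in> functionals V" by (simp only: dual_rep_simps(1))
    show "act (dual_rep G V) g f \<in> carrier (dual_rep G V)"
      unfolding dual_rep_simps
      by (rule restrict_functional[OF V(1)]) (simp_all add: functionalsD[OF f] V(2-4) inv[OF g])
  next
    fix f assume "f \<in> carrier (dual_rep G V)"
    hence f: "f \<in> functionals V" by (simp only: dual_rep_simps(1))
    have "inv\<^bsub>G\<^esub> \<one>\<^bsub>G\<^esub> = \<one>\<^bsub>G\<^esub>" by (rule monoid.inv_one[OF group.is_monoid[OF assms(1)]])
    thus "act (dual_rep G V) \<one>\<^bsub>G\<^esub> f = f"
      using functionalsD(3)[OF f] unfolding dual_rep_simps
      by (simp only: fun_eq_iff r extensional_def) (simp add: V(5))
  next
    fix g h f assume gh: "g \<in> carrier G" "h \<in> carrier G"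
    show "act (dual_rep G V) (g \<otimes>\<^bsub>G\<^esub> h) f = act (dual_rep G V) g (act (dual_rep G V) h f)"
      unfolding dual_rep_simps
      by (simp only: fun_eq_iff r)
        (simp add: V(2,6) group.inv_mult_group[OF assms(1) gh] inv[OF gh(1)] inv[OF gh(2)])
  qed (auto simp: fun_eq_iff r V(2) inv cl)
qed

lemma dual_fin_dim:
  assumes "vectorspace class_ring (V :: ('g, 'k::field, 'v) rep)" "vectorspace.fin_dim class_ring V"
  shows "vectorspace.fin_dim class_ring (dual_rep G V)"
proof -
  let ?D = "dual_rep G V"
  interpret V: vectorspace class_ring V by fact
  interpret D: vectorspace class_ring ?D by (rule dual_is_vectorspace[OF assms(1)])
  obtain A \<phi> where A: "finite A" "A \<subseteq> carrier V" "\<And>a. a \<in> A \<Longrightarrow> \<phi> a \<in> functionals V"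
    "\<And>v. v \<in> carrier V \<Longrightarrow> v = V.lincomb (\<lambda>a. \<phi> a v) A"
    using dual_basis[OF assms(1,2)] by blast
  have sub: "\<phi> ` A \<subseteq> carrier ?D" using A(3) by auto
  interpret sp: LinearCombinations.submodule class_ring "D.span (\<phi> ` A)" ?D
    by (rule D.span_is_submodule[OF sub])
  have part: "(\<lambda>v\<in>carrier V. \<Sum>a\<in>B. b a * \<phi> a v) \<in> D.span (\<phi> ` A)" if "finite B" "B \<subseteq> A" for B b
    using that
  proof (induction B rule: finite_induct)
    case empty
    then show ?case using sp.zero_closed by (simp only: sum.empty dual_rep_simps)
  next
    case (insert a B)
    have "\<phi> a \<in> D.span (\<phi> ` A)" using insert D.in_own_span[OF sub] by auto
    have IH: "(\<lambda>v\<in>carrier V. \<Sum>a\<in>B. b a * \<phi> a v) \<in> D.span (\<phi> ` A)"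
      using insert.IH insert.prems by blast
    have "b a \<odot>\<^bsub>?D\<^esub> \<phi> a \<in> D.span (\<phi> ` A)" by (rule sp.smult_closed[OF _ \<open>\<phi> a \<in> _\<close>]) simp
    hence "(b a \<odot>\<^bsub>?D\<^esub> \<phi> a) \<oplus>\<^bsub>?D\<^esub> (\<lambda>v\<in>carrier V. \<Sum>a\<in>B. b a * \<phi> a v) \<in> D.span (\<phi> ` A)"
      using IH by (rule sp.m_closed)
    also have "(b a \<odot>\<^bsub>?D\<^esub> \<phi> a) \<oplus>\<^bsub>?D\<^esub> (\<lambda>v\<in>carrier V. \<Sum>a\<in>B. b a * \<phi> a v) =
      (\<lambda>v\<in>carrier V. \<Sum>a\<in>insert a B. b a * \<phi> a v)"
      using insert by (simp add: fun_eq_iff)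
    finally show ?case .
  qed
  have "carrier ?D \<subseteq> D.span (\<phi> ` A)"
  proof
    fix f assume "f \<in> carrier ?D"
    hence "f = (\<lambda>v\<in>carrier V. \<Sum>a\<in>A. f a * \<phi> a v)"
      using functional_expand[OF assms(1) A(1,2,4)] by simp
    thus "f \<in> D.span (\<phi> ` A)" using part[of A f] A(1) by simp
  qed
  hence "D.span (\<phi> ` A) = carrier ?D" using D.span_is_subset2[OF sub] by blast
  thus ?thesis unfolding D.fin_dim_def using A(1) sub by (intro exI[of _ "\<phi> ` A"]) auto
qed

lemma eval_at_closed:
  assumes "vectorspace class_ring (V :: ('g, 'k::field, 'v) rep)" "v \<in> carrier V"
  shows "eval_at G V v \<in> carrier (dual_rep G (dual_rep G V))"
proof -
  have "eval_at G V v \<in> functionals (dual_rep G V)"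
    unfolding eval_at_def
    by (rule restrict_functional[OF dual_is_vectorspace[OF assms(1)]]) (use assms(2) in simp_all)
  thus ?thesis by simp
qed

text \<open>A preimage of \<open>\<xi>\<close> is the vector whose coordinates are the values of \<open>\<xi>\<close> on the dual basis.\<close>

lemma eval_at_bij:
  assumes "vectorspace class_ring (V :: ('g, 'k::field, 'v) rep)" "vectorspace.fin_dim class_ring V"
  shows "bij_betw (eval_at G V) (carrier V) (carrier (dual_rep G (dual_rep G V)))"
proof -
  let ?D = "dual_rep G V"
  interpret V: vectorspace class_ring V by fact
  note D = dual_is_vectorspace[OF assms(1), of G]
  obtain A \<phi> where A: "finite A" "A \<subseteq> carrier V" "\<And>a. a \<in> A \<Longrightarrow> \<phi> a \<in> functionals V"
    "\<And>v. v \<in> carrier V \<Longrightarrow> v = V.lincomb (\<lambda>a. \<phi> a v) A"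
    using dual_basis[OF assms(1,2)] by blast
  have inj: "inj_on (eval_at G V) (carrier V)"
  proof (rule inj_onI)
    fix u v assume *: "u \<in> carrier V" "v \<in> carrier V" "eval_at G V u = eval_at G V v"
    show "u = v"
    proof (rule functionals_separate[OF assms *(1,2)])
      fix f assume f: "f \<in> functionals V"
      show "f u = f v" using fun_cong[OF *(3), of f] f by (simp add: eval_at_def)
    qed
  qed
  have surj: "\<exists>y\<in>carrier V. \<xi> = eval_at G V y" if "\<xi> \<in> carrier (dual_rep G ?D)" for \<xi>
  proof -
    define y where "y = V.lincomb (\<lambda>a. \<xi> (\<phi> a)) A"
    have y: "y \<in> carrier V" unfolding y_def using A by (intro V.lincomb_closed) auto
    have \<xi>: "\<xi> \<in> functionals ?D" using that by simp
    have \<xi>sum: "(\<lambda>v\<in>carrier V. \<Sum>a\<in>B. b a * \<phi> a v) \<in> carrier ?D \<and>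
       \<xi> (\<lambda>v\<in>carrier V. \<Sum>a\<in>B. b a * \<phi> a v) = (\<Sum>a\<in>B. b a * \<xi> (\<phi> a))"
      if "finite B" "B \<subseteq> A" for B b
      using that
    proof (induction B rule: finite_induct)
      case empty
      have "(\<lambda>v\<in>carrier V. \<Sum>a\<in>{}. b a * \<phi> a v) = \<zero>\<^bsub>?D\<^esub>" by (simp only: sum.empty dual_rep_simps)
      then show ?case using functional_zero[OF D \<xi>] vectorspace_closed(3)[OF D] by (simp only: sum.empty)
    next
      case (insert a B)
      let ?s = "\<lambda>v\<in>carrier V. \<Sum>a\<in>B. b a * \<phi> a v"
      have IH: "?s \<in> carrier ?D" "\<xi> ?s = (\<Sum>a\<in>B. b a * \<xi> (\<phi> a))"
        using insert.IH insert.prems by blast+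
      have pa: "\<phi> a \<in> carrier ?D" using A(3) insert by auto
      interpret D: vectorspace class_ring ?D by (rule D)
      have ba: "b a \<odot>\<^bsub>?D\<^esub> \<phi> a \<in> carrier ?D" using pa D.smult_closed[of "b a"] by simp
      have eq: "(\<lambda>v\<in>carrier V. \<Sum>a\<in>insert a B. b a * \<phi> a v) = (b a \<odot>\<^bsub>?D\<^esub> \<phi> a) \<oplus>\<^bsub>?D\<^esub> ?s"
        using insert by (simp add: fun_eq_iff)
      have add: "\<xi> (f \<oplus>\<^bsub>?D\<^esub> h) = \<xi> f + \<xi> h" if "f \<in> carrier ?D" "h \<in> carrier ?D" for f h
        using functionalsD(1)[OF \<xi> that] .
      have sm: "\<xi> (k \<odot>\<^bsub>?D\<^esub> f) = k * \<xi> f" if "f \<in> carrier ?D" for f k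
        using functionalsD(2)[OF \<xi> that] .
      have "\<xi> ((b a \<odot>\<^bsub>?D\<^esub> \<phi> a) \<oplus>\<^bsub>?D\<^esub> ?s) = (\<Sum>a\<in>insert a B. b a * \<xi> (\<phi> a))"
        using add[OF ba IH(1)] sm[OF pa] IH(2) by (simp only: sum.insert[OF insert.hyps])
      thus ?case unfolding eq using D.a_closed[OF ba IH(1)] by blast
    qed
    have "\<xi> f = eval_at G V y f" for f
    proof (cases "f \<in> carrier ?D")
      case True
      hence f: "f \<in> functionals V" by simp
      have "\<xi> f = (\<Sum>a\<in>A. f a * \<xi> (\<phi> a))"
        using \<xi>sum[of A f] A(1) functional_expand[OF assms(1) A(1,2,4) f] by simp
      also have "\<dots> = f y"
        unfolding y_def using functional_lincomb[OF assms(1) f A(1,2), of "\<lambda>a. \<xi> (\<phi> a)"]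
        by (simp add: mult.commute)
      finally show ?thesis using True by (simp add: eval_at_def)
    next
      case False
      thus ?thesis using functionalsD(3)[OF \<xi>] by (auto simp: eval_at_def extensional_def)
    qed
    thus ?thesis using y by blast
  qed
  show ?thesis unfolding bij_betw_def
    using inj surj eval_at_closed[OF assms(1)] by (auto simp del: dual_rep_simps)
qed

lemma eval_at_add:
  assumes "vectorspace class_ring V" "u \<in> carrier V" "v \<in> carrier V"
  shows "eval_at G V u \<oplus>\<^bsub>dual_rep G (dual_rep G V)\<^esub> eval_at G V v = eval_at G V (u \<oplus>\<^bsub>V\<^esub> v)"
  by (rule ext, rename_tac f, case_tac "f \<in> functionals V")
    (simp_all add: eval_at_def restrict_def functionalsD(1)[OF _ assms(2,3)])

lemma eval_at_smult:
  assumes "vectorspace class_ring V" "v \<in> carrier V"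
  shows "a \<odot>\<^bsub>dual_rep G (dual_rep G V)\<^esub> eval_at G V v = eval_at G V (a \<odot>\<^bsub>V\<^esub> v)"
  by (rule ext, rename_tac f, case_tac "f \<in> functionals V")
    (simp_all add: eval_at_def restrict_def functionalsD(2)[OF _ assms(2)])

lemma eval_at_act:
  assumes "group G" "is_rep G V" "g \<in> carrier G" "v \<in> carrier V"
  shows "act (dual_rep G (dual_rep G V)) g (eval_at G V v) = eval_at G V (act V g v)"
proof
  fix f
  have i: "inv\<^bsub>G\<^esub> g \<in> carrier G" using assms(1,3) by (rule group.inv_closed)
  have f: "act (dual_rep G V) (inv\<^bsub>G\<^esub> g) f \<in> carrier (dual_rep G V)" if "f \<in> carrier (dual_rep G V)"
    using is_repD(2)[OF dual_is_rep[OF assms(1,2)] i that] .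
  show "act (dual_rep G (dual_rep G V)) g (eval_at G V v) f = eval_at G V (act V g v) f"
    unfolding dual_rep_simps(5)[of G "dual_rep G V"]
    using f assms(4) by (simp add: eval_at_def restrict_def group.inv_inv[OF assms(1,3)])
qed

section \<open>Reflections on the dual\<close>

text \<open>Dimension one in terms of elements, so that the rank of \<open>1 - s\<close> can be compared on a
  representation and on its dual without comparing bases.\<close>

lemma dim_eq_one_iff:
  assumes "vectorspace class_ring V" "vectorspace.fin_dim class_ring V"
  shows "vectorspace.dim class_ring V = 1 \<longleftrightarrow>
    (\<exists>v\<in>carrier V. v \<noteq> \<zero>\<^bsub>V\<^esub>) \<and> (\<exists>a\<in>carrier V. \<forall>v\<in>carrier V. \<exists>l. v = l \<odot>\<^bsub>V\<^esub> a)"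
proof -
  interpret vectorspace class_ring V by fact
  have sp0: "lincomb f {} = \<zero>\<^bsub>V\<^esub>" for f by (simp add: lincomb_def)
  have sp1: "lincomb f {a} = f a \<odot>\<^bsub>V\<^esub> a" if "a \<in> carrier V" for f a
    using lincomb_insert[of "{}" f a] that by (simp add: sp0)
  show ?thesis
  proof
    assume d: "dim = 1"
    obtain B where B: "finite B" "basis B" using finite_basis_exists assms(2) by blast
    hence "card B = 1" using dim_basis d by simp
    then obtain a where Ba: "B = {a}" by (rule card_1_singletonE)
    have a: "a \<in> carrier V" "a \<noteq> \<zero>\<^bsub>V\<^esub>"
      using B(2) Ba vs_zero_lin_dep[of B] by (auto simp: basis_def)
    have "\<exists>l. v = l \<odot>\<^bsub>V\<^esub> a" if "v \<in> carrier V" for v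
    proof -
      have "v \<in> span {a}" using B(2) Ba that by (simp add: basis_def)
      then obtain f where "lincomb f {a} = v" using finite_in_span[of "{a}" v] a by auto
      thus ?thesis using sp1[OF a(1), of f] by metis
    qed
    thus "(\<exists>v\<in>carrier V. v \<noteq> \<zero>\<^bsub>V\<^esub>) \<and> (\<exists>a\<in>carrier V. \<forall>v\<in>carrier V. \<exists>l. v = l \<odot>\<^bsub>V\<^esub> a)"
      using a by blast
  next
    assume "(\<exists>v\<in>carrier V. v \<noteq> \<zero>\<^bsub>V\<^esub>) \<and> (\<exists>a\<in>carrier V. \<forall>v\<in>carrier V. \<exists>l. v = l \<odot>\<^bsub>V\<^esub> a)"
    then obtain v a where v: "v \<in> carrier V" "v \<noteq> \<zero>\<^bsub>V\<^esub>"
      and a: "a \<in> carrier V" "\<And>v. v \<in> carrier V \<Longrightarrow> \<exists>l. v = l \<odot>\<^bsub>V\<^esub> a" by blast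
    have "w \<in> span {a}" if w: "w \<in> carrier V" for w
    proof -
      obtain l where "w = l \<odot>\<^bsub>V\<^esub> a" using a(2)[OF w] ..
      hence "w = lincomb (\<lambda>_. l) {a}" using sp1[OF a(1)] by simp
      thus ?thesis unfolding span_def by auto
    qed
    hence gen: "gen_set {a}" using span_is_subset2[of "{a}"] a(1) by auto
    hence "dim \<le> 1" using gen_ge_dim[of "{a}"] a(1) by simp
    moreover have "dim \<noteq> 0"
    proof
      assume d: "dim = 0"
      obtain B where B: "finite B" "basis B" using finite_basis_exists assms(2) by blast
      hence "B = {}" using dim_basis d by simp
      hence "v \<in> span {}" using B(2) v(1) by (simp add: basis_def)
      thus False using v(2) sp0 by (auto simp: span_def)
    qed
    ultimately show "dim = 1" by simp
  qed
qed

text \<open>The equation \<open>v = s v + l a\<close> instead of \<open>v - s v = l a\<close> contains sums and multiples only, so functionals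
  and evaluation maps can be applied to it directly.\<close>

lemma reflections_iff:
  fixes V :: "('g, 'k::field, 'v) rep"
  assumes "fin_dim_rep G V"
  shows "s \<in> reflections G V \<longleftrightarrow> s \<in> carrier G \<and>
    (\<exists>v\<in>carrier V. act V s v \<noteq> v) \<and>
    (\<exists>a\<in>carrier V. \<forall>v\<in>carrier V. \<exists>l. v = act V s v \<oplus>\<^bsub>V\<^esub> l \<odot>\<^bsub>V\<^esub> a)"
proof (cases "s \<in> carrier G")
  case True
  have rep: "is_rep G V" and fd: "vectorspace.fin_dim class_ring V"
    using assms by (auto simp: fin_dim_rep_def)
  note V = is_repD[OF rep]
  interpret V: vectorspace class_ring V by (rule V)
  let ?T = "\<lambda>v. v \<ominus>\<^bsub>V\<^esub> act V s v"
  let ?I = "V\<lparr>carrier := ?T ` carrier V\<rparr>"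
  have lin: "linear_map class_ring V V ?T"
  proof (rule linear_mapI[OF V(1) V(1)])
    fix u v assume "u \<in> carrier V" "v \<in> carrier V"
    thus "?T (u \<oplus>\<^bsub>V\<^esub> v) = ?T u \<oplus>\<^bsub>V\<^esub> ?T v"
      using V(2)[OF True] by (simp add: V(3)[OF True] a_minus_def V.minus_add V.a_ac)
  next
    fix a v assume v: "v \<in> carrier V"
    show "?T (a \<odot>\<^bsub>V\<^esub> v) = a \<odot>\<^bsub>V\<^esub> ?T v"
      using v V(2)[OF True v] by (simp add: V(4)[OF True] a_minus_def V.smult_r_distr V.smult_r_minus)
  qed (use V(2)[OF True] in simp)
  interpret T: linear_map class_ring V V ?T by (rule lin)
  have sub: "VectorSpace.subspace class_ring (?T ` carrier V) V"
    using T.imT_is_subspace by (simp add: T.im_def)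
  have vsI: "vectorspace class_ring ?I" by (rule V.subspace_is_vs[OF sub])
  have linI: "linear_map class_ring V ?I ?T"
    by (rule linear_mapI[OF V(1) vsI]) auto
  interpret TI: linear_map class_ring V ?I ?T by (rule linI)
  have fdI: "vectorspace.fin_dim class_ring ?I"
    using TI.rank_nullity_main(2)[OF fd] by simp
  have diff: "?T v = w \<longleftrightarrow> v = act V s v \<oplus>\<^bsub>V\<^esub> w" if "v \<in> carrier V" "w \<in> carrier V" for v w
  proof
    assume "?T v = w"
    thus "v = act V s v \<oplus>\<^bsub>V\<^esub> w"
      using that V(2)[OF True that(1)] by (metis V.add.inv_solve_right' a_minus_def V.a_comm)
  next
    assume *: "v = act V s v \<oplus>\<^bsub>V\<^esub> w"
    show "?T v = w"
      by (subst (1) *) (use that V(2)[OF True that(1)] in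
        \<open>simp add: a_minus_def V.a_ac V.r_neg1 V.r_neg V.l_neg\<close>)
  qed
  have nz: "?T v \<noteq> \<zero>\<^bsub>V\<^esub> \<longleftrightarrow> act V s v \<noteq> v" if "v \<in> carrier V" for v
    using diff[OF that V.zero_closed] V(2)[OF True that] by auto
  have "s \<in> reflections G V \<longleftrightarrow> vectorspace.dim class_ring ?I = 1"
    using True by (simp add: reflections_def)
  also have "\<dots> \<longleftrightarrow> (\<exists>v\<in>carrier ?I. v \<noteq> \<zero>\<^bsub>?I\<^esub>) \<and>
      (\<exists>a\<in>carrier ?I. \<forall>v\<in>carrier ?I. \<exists>l. v = l \<odot>\<^bsub>?I\<^esub> a)"
    by (rule dim_eq_one_iff[OF vsI fdI])
  also have "(\<exists>v\<in>carrier ?I. v \<noteq> \<zero>\<^bsub>?I\<^esub>) \<longleftrightarrow> (\<exists>v\<in>carrier V. act V s v \<noteq> v)"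
    using nz by auto
  also have "(\<exists>a\<in>carrier ?I. \<forall>v\<in>carrier ?I. \<exists>l. v = l \<odot>\<^bsub>?I\<^esub> a) \<longleftrightarrow>
      (\<exists>a\<in>?T ` carrier V. \<forall>v\<in>carrier V. \<exists>l. ?T v = l \<odot>\<^bsub>V\<^esub> a)" by simp
  also have "(\<exists>v\<in>carrier V. act V s v \<noteq> v) \<and> (\<exists>a\<in>?T ` carrier V. \<forall>v\<in>carrier V. \<exists>l. ?T v = l \<odot>\<^bsub>V\<^esub> a)
    \<longleftrightarrow> (\<exists>v\<in>carrier V. act V s v \<noteq> v) \<and> (\<exists>a\<in>carrier V. \<forall>v\<in>carrier V. \<exists>l. ?T v = l \<odot>\<^bsub>V\<^esub> a)"
    (is "?N \<and> ?P \<longleftrightarrow> ?N \<and> ?Q")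
  proof (intro conj_cong refl iffI)
    assume ?P
    then obtain a where "a \<in> ?T ` carrier V" "\<forall>v\<in>carrier V. \<exists>l. ?T v = l \<odot>\<^bsub>V\<^esub> a" by blast
    moreover have "a \<in> carrier V" using \<open>a \<in> ?T ` carrier V\<close> T.T_im by blast
    ultimately show ?Q by blast
  next
    assume ?N ?Q
    then obtain v a where v: "v \<in> carrier V" "act V s v \<noteq> v" and a: "a \<in> carrier V"
      "\<And>v. v \<in> carrier V \<Longrightarrow> \<exists>l. ?T v = l \<odot>\<^bsub>V\<^esub> a" by blast
    obtain l where l: "?T v = l \<odot>\<^bsub>V\<^esub> a" using a(2)[OF v(1)] ..
    have l0: "l \<noteq> 0"
    proof
      assume "l = 0"
      hence "?T v = \<zero>\<^bsub>V\<^esub>" using l a(1) V.smult_l_null by simp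
      thus False using nz[OF v(1)] v(2) by simp
    qed
    have "\<exists>m. ?T w = m \<odot>\<^bsub>V\<^esub> ?T v" if w: "w \<in> carrier V" for w
    proof -
      obtain m where "?T w = m \<odot>\<^bsub>V\<^esub> a" using a(2)[OF w] ..
      also have "\<dots> = (m / l) \<odot>\<^bsub>V\<^esub> (l \<odot>\<^bsub>V\<^esub> a)"
        using V.smult_assoc1[of "m / l" l a] a(1) l0 by simp
      finally show ?thesis unfolding l by blast
    qed
    thus ?P using v(1) by blast
  qed
  also have "\<dots> \<longleftrightarrow> ?N \<and> (\<exists>a\<in>carrier V. \<forall>v\<in>carrier V. \<exists>l. v = act V s v \<oplus>\<^bsub>V\<^esub> l \<odot>\<^bsub>V\<^esub> a)"
    using diff V.smult_closed by (metis (no_types, lifting) UNIV_I partial_object.select_convs(1))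
  finally show ?thesis using True by blast
qed (simp add: reflections_def)

lemma rep_inv_act:
  assumes "group G" "is_rep G V" "g \<in> carrier G" "v \<in> carrier V"
  shows "act V g (act V (inv\<^bsub>G\<^esub> g) v) = v" "act V (inv\<^bsub>G\<^esub> g) (act V g v) = v"
proof -
  note V = is_repD[OF assms(2)]
  have i: "inv\<^bsub>G\<^esub> g \<in> carrier G" using assms by (simp add: group.inv_closed)
  show "act V g (act V (inv\<^bsub>G\<^esub> g) v) = v"
    using V(6)[OF assms(3) i assms(4)] V(5)[OF assms(4)] group.r_inv[OF assms(1,3)] by simp
  show "act V (inv\<^bsub>G\<^esub> g) (act V g v) = v"
    using V(6)[OF i assms(3,4)] V(5)[OF assms(4)] group.l_inv[OF assms(1,3)] by simp
qed

lemma dual_fin_dim_rep: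
  assumes "group G" "fin_dim_rep G (V :: ('g, 'k::field, 'v) rep)"
  shows "fin_dim_rep G (dual_rep G V)"
  using assms dual_is_rep[of G V] dual_fin_dim[of V G] is_repD(1)[of G V]
  by (simp add: fin_dim_rep_def)

text \<open>If \<open>v = s v + \<lambda>(v) a\<close> for all \<open>v\<close>, then \<open>x - s x = - x(a) \<mu>\<close> for every functional \<open>x\<close>, where
  \<open>\<mu>(u) = \<lambda>(s\<^sup>-\<^sup>1 u)\<close>. That \<open>\<mu>\<close> is linear is seen by expressing \<open>\<lambda>\<close> through one functional \<open>x0\<close> that does
  not vanish on \<open>a\<close>.\<close>

lemma reflections_dual_subset:
  fixes V :: "('g, 'k::field, 'v) rep"
  assumes "group G" "fin_dim_rep G V" "s \<in> reflections G V"
  shows "s \<in> reflections G (dual_rep G V)"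
proof -
  let ?D = "dual_rep G V"
  have rep: "is_rep G V" and fd: "vectorspace.fin_dim class_ring V"
    using assms by (auto simp: fin_dim_rep_def)
  note V = is_repD[OF rep]
  note cl = vectorspace_closed[OF V(1)]
  note sep = functionals_separate[OF V(1) fd]
  note rD = reflections_iff[OF dual_fin_dim_rep[OF assms(1,2)]]
  note rV = reflections_iff[OF assms(2)]
  have dadd: "(f \<oplus>\<^bsub>?D\<^esub> m \<odot>\<^bsub>?D\<^esub> h) v = f v + m * h v" if "v \<in> carrier V" for f h m v
    using that by simp
  have sinv: "inv\<^bsub>G\<^esub> s \<in> carrier G" if "s \<in> carrier G"
    using assms(1) that by (rule group.inv_closed)
  obtain a v0 where s: "s \<in> carrier G" and v0: "v0 \<in> carrier V" "act V s v0 \<noteq> v0"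
    and a: "a \<in> carrier V" "\<And>v. v \<in> carrier V \<Longrightarrow> \<exists>l. v = act V s v \<oplus>\<^bsub>V\<^esub> l \<odot>\<^bsub>V\<^esub> a"
    using assms(3) unfolding rV by blast
  note sv = V(2)[OF s] and iv = V(2)[OF sinv[OF s]]
  obtain x0 where x0: "x0 \<in> functionals V" "x0 (act V s v0) \<noteq> x0 v0"
    using sep[OF sv[OF v0(1)] v0(1)] v0(2) by blast
  have expand: "\<exists>l. \<forall>x\<in>functionals V. x v = x (act V s v) + l * x a" if v: "v \<in> carrier V" for v
  proof -
    obtain l where l: "v = act V s v \<oplus>\<^bsub>V\<^esub> l \<odot>\<^bsub>V\<^esub> a" using a(2)[OF v] ..
    have "x v = x (act V s v) + l * x a" if x: "x \<in> functionals V" for x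
      using arg_cong[OF l, of x] functionalsD(1)[OF x sv[OF v] cl(2)[OF a(1)]]
        functionalsD(2)[OF x a(1)] by simp
    thus ?thesis by blast
  qed
  have x0a: "x0 a \<noteq> 0" using expand[OF v0(1)] x0 by auto
  define \<mu> where "\<mu> = (\<lambda>u\<in>carrier V. (x0 (act V (inv\<^bsub>G\<^esub> s) u) - x0 u) / x0 a)"
  have \<mu>: "\<mu> \<in> functionals V" unfolding \<mu>_def
  proof (rule restrict_functional[OF V(1)])
    fix u v assume u: "u \<in> carrier V" and v: "v \<in> carrier V"
    show "(x0 (act V (inv\<^bsub>G\<^esub> s) (u \<oplus>\<^bsub>V\<^esub> v)) - x0 (u \<oplus>\<^bsub>V\<^esub> v)) / x0 a =
      (x0 (act V (inv\<^bsub>G\<^esub> s) u) - x0 u) / x0 a + (x0 (act V (inv\<^bsub>G\<^esub> s) v) - x0 v) / x0 a"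
      using u v x0a by (simp add: V(3)[OF sinv[OF s]] functionalsD(1)[OF x0(1)] iv field_simps)
  next
    fix b v assume v: "v \<in> carrier V"
    show "(x0 (act V (inv\<^bsub>G\<^esub> s) (b \<odot>\<^bsub>V\<^esub> v)) - x0 (b \<odot>\<^bsub>V\<^esub> v)) / x0 a =
      b * ((x0 (act V (inv\<^bsub>G\<^esub> s) v) - x0 v) / x0 a)"
      using v x0a by (simp add: V(4)[OF sinv[OF s]] functionalsD(2)[OF x0(1)] iv field_simps)
  qed
  have "act ?D s x0 (act V s v0) = x0 v0"
    using sv[OF v0(1)] rep_inv_act(2)[OF assms(1) rep s v0(1)] by simp
  hence "act ?D s x0 \<noteq> x0" using x0(2) by metis
  moreover have "x = act ?D s x \<oplus>\<^bsub>?D\<^esub> (- x a) \<odot>\<^bsub>?D\<^esub> \<mu>" if x: "x \<in> functionals V" for x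
    proof
      fix u
      show "x u = (act ?D s x \<oplus>\<^bsub>?D\<^esub> (- x a) \<odot>\<^bsub>?D\<^esub> \<mu>) u"
      proof (cases "u \<in> carrier V")
        case True
        obtain l where l: "\<forall>y\<in>functionals V. y (act V (inv\<^bsub>G\<^esub> s) u) = y u + l * y a"
          using expand[OF iv[OF True]] rep_inv_act(1)[OF assms(1) rep s True] by auto
        have "x0 (act V (inv\<^bsub>G\<^esub> s) u) = x0 u + l * x0 a" using l x0(1) by blast
        hence "\<mu> u = l" using True x0a by (simp add: \<mu>_def)
        thus ?thesis using bspec[OF l x] True unfolding dadd[OF True] by simp
      next
        case False
        thus ?thesis using functionalsD(3)[OF x] by (simp add: extensional_def)
      qed
    qed
  ultimately show "s \<in> reflections G ?D" 
    unfolding rD dual_rep_simps(1) using s x0(1) \<mu> by blast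
qed

text \<open>Passing to the dual twice leads to the bidual, where evaluation identifies the action with the
  original one.\<close>

lemma reflections_dual:
  fixes V :: "('g, 'k::field, 'v) rep"
  assumes "group G" "fin_dim_rep G V"
  shows "reflections G (dual_rep G V) = reflections G V"
proof (intro Set.set_eqI iffI)
  fix s
  let ?DD = "dual_rep G (dual_rep G V)" and ?e = "eval_at G V"
  have rep: "is_rep G V" and fd: "vectorspace.fin_dim class_ring V"
    using assms(2) by (auto simp: fin_dim_rep_def)
  note V = is_repD[OF rep] and cl = vectorspace_closed[OF is_repD(1)[OF rep]]
  have inj: "u = v" if "?e u = ?e v" "u \<in> carrier V" "v \<in> carrier V" for u v
    using eval_at_bij[OF V(1) fd, of G] that by (auto simp: bij_betw_def inj_on_def)
  have surj: "\<exists>v\<in>carrier V. x = ?e v" if "x \<in> carrier ?DD" for x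
    using eval_at_bij[OF V(1) fd, of G] that by (auto simp: bij_betw_def simp del: dual_rep_simps)
  assume "s \<in> reflections G (dual_rep G V)"
  hence "s \<in> reflections G ?DD"
    by (rule reflections_dual_subset[OF assms(1) dual_fin_dim_rep[OF assms]])
  then obtain x b where s: "s \<in> carrier G" and x: "x \<in> carrier ?DD" "act ?DD s x \<noteq> x"
    and b: "b \<in> carrier ?DD" "\<And>y. y \<in> carrier ?DD \<Longrightarrow> \<exists>l. y = act ?DD s y \<oplus>\<^bsub>?DD\<^esub> l \<odot>\<^bsub>?DD\<^esub> b"
    unfolding reflections_iff[OF dual_fin_dim_rep[OF assms(1) dual_fin_dim_rep[OF assms]]] by blast
  obtain v a where v: "v \<in> carrier V" "x = ?e v" and a: "a \<in> carrier V" "b = ?e a"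
    using surj[OF x(1)] surj[OF b(1)] by blast
  note ev = eval_at_act[OF assms(1) rep s] eval_at_add[OF V(1)] eval_at_smult[OF V(1)]
  have "act V s v \<noteq> v" using x(2) v by (metis ev(1))
  moreover have "\<exists>l. u = act V s u \<oplus>\<^bsub>V\<^esub> l \<odot>\<^bsub>V\<^esub> a" if u: "u \<in> carrier V" for u
  proof -
    obtain l where l: "?e u = act ?DD s (?e u) \<oplus>\<^bsub>?DD\<^esub> l \<odot>\<^bsub>?DD\<^esub> ?e a"
      using b(2)[OF eval_at_closed[OF V(1) u]] a(2) by blast
    hence "?e u = ?e (act V s u \<oplus>\<^bsub>V\<^esub> l \<odot>\<^bsub>V\<^esub> a)"
      unfolding ev(1)[OF u] ev(3)[OF a(1)] ev(2)[OF V(2)[OF s u] cl(2)[OF a(1)]] .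
    thus ?thesis using inj u V(2)[OF s u] cl a(1) by blast
  qed
  ultimately show "s \<in> reflections G V" unfolding reflections_iff[OF assms(2)] using s v(1) a(1) by blast
qed (rule reflections_dual_subset[OF assms])

text \<open>The inverse of \<open>s\<close> moves vectors along the same line as \<open>s\<close>.\<close>

lemma reflections_inv:
  fixes V :: "('g, 'k::field, 'v) rep"
  assumes "group G" "fin_dim_rep G V" "s \<in> reflections G V"
  shows "inv\<^bsub>G\<^esub> s \<in> reflections G V"
proof -
  have rep: "is_rep G V" using assms(2) by (simp add: fin_dim_rep_def)
  note V = is_repD[OF rep]
  interpret V: vectorspace class_ring V by (rule V)
  note iff = reflections_iff[OF assms(2)]
  obtain v0 a where s: "s \<in> carrier G" and v0: "v0 \<in> carrier V" "act V s v0 \<noteq> v0"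
    and a: "a \<in> carrier V" "\<And>v. v \<in> carrier V \<Longrightarrow> \<exists>l. v = act V s v \<oplus>\<^bsub>V\<^esub> l \<odot>\<^bsub>V\<^esub> a"
    using assms(3) unfolding iff by blast
  have i: "inv\<^bsub>G\<^esub> s \<in> carrier G" using assms(1) s by (rule group.inv_closed)
  note inv1 = rep_inv_act(1)[OF assms(1) rep s] and inv2 = rep_inv_act(2)[OF assms(1) rep s]
  have "act V (inv\<^bsub>G\<^esub> s) v0 \<noteq> v0" using inv1[OF v0(1)] v0(2) by metis
  moreover have "\<exists>l. v = act V (inv\<^bsub>G\<^esub> s) v \<oplus>\<^bsub>V\<^esub> l \<odot>\<^bsub>V\<^esub> a" if v: "v \<in> carrier V" for v
  proof -
    let ?u = "act V (inv\<^bsub>G\<^esub> s) v"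
    have u: "?u \<in> carrier V" using V(2)[OF i v] .
    obtain l where l: "?u = v \<oplus>\<^bsub>V\<^esub> l \<odot>\<^bsub>V\<^esub> a" using a(2)[OF u] inv1[OF v] by auto
    have "?u \<oplus>\<^bsub>V\<^esub> (- l) \<odot>\<^bsub>V\<^esub> a = v \<oplus>\<^bsub>V\<^esub> (l \<odot>\<^bsub>V\<^esub> a \<oplus>\<^bsub>V\<^esub> (- l) \<odot>\<^bsub>V\<^esub> a)"
      unfolding l using v a(1) V.smult_closed by (simp add: V.a_assoc)
    also have "l \<odot>\<^bsub>V\<^esub> a \<oplus>\<^bsub>V\<^esub> (- l) \<odot>\<^bsub>V\<^esub> a = \<zero>\<^bsub>V\<^esub>"
      using V.smult_l_distr[of l "- l" a] V.smult_l_null[OF a(1)] a(1) by simp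
    finally show ?thesis using v by (intro exI[of _ "- l"]) simp
  qed
  ultimately show ?thesis unfolding iff using i v0(1) a(1) by blast
qed

declare dual_rep_simps [simp del]

section \<open>The Cherednik algebra by generators and relations\<close>

lemma poly_mapping_sum_single: "f = (\<Sum>w\<in>Poly_Mapping.keys f. Poly_Mapping.single w (Poly_Mapping.lookup f w))"
  by (rule poly_mapping_eqI) (simp add: lookup_sum lookup_single when_def in_keys_iff)

lemma poly_mapping_add_induct [case_names zero single add]:
  fixes f :: "'a \<Rightarrow>\<^sub>0 'b::comm_monoid_add"
  assumes "P 0" "\<And>w a. P (Poly_Mapping.single w a)" "\<And>f g. P f \<Longrightarrow> P g \<Longrightarrow> P (f + g)"
  shows "P f"
proof -
  have "P (\<Sum>w\<in>A. Poly_Mapping.single w (Poly_Mapping.lookup f w))" for A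
    by (induction A rule: infinite_finite_induct) (use assms in auto)
  thus ?thesis using poly_mapping_sum_single[of f] by metis
qed

lemma free_algebra_simps [simp]:
  "mult (free_algebra S) = (*)" "one (free_algebra S) = 1"
  "\<zero>\<^bsub>free_algebra S\<^esub> = 0" "add (free_algebra S) = (+)"
  by (simp_all add: free_algebra_def)

lemma free_algebra_carrier:
  "f \<in> carrier (free_algebra S) \<longleftrightarrow> (\<forall>w\<in>Poly_Mapping.keys f. set w \<subseteq> S)"
  by (simp add: free_algebra_def)

lemma free_algebra_single [simp]:
  "Poly_Mapping.single w a \<in> carrier (free_algebra S) \<longleftrightarrow> a = 0 \<or> set w \<subseteq> S"
  by (simp add: free_algebra_carrier)

lemma free_algebra_closed [intro]:
  assumes "f \<in> carrier (free_algebra S)" "g \<in> carrier (free_algebra S)"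
  shows "f + g \<in> carrier (free_algebra S)" "f - g \<in> carrier (free_algebra S)"
    "f * g \<in> carrier (free_algebra S)" "- f \<in> carrier (free_algebra S)"
proof -
  show "f + g \<in> carrier (free_algebra S)"
    using assms Poly_Mapping.keys_add[of f g] by (auto simp: free_algebra_carrier)
  show m: "- f \<in> carrier (free_algebra S)"
    using assms by (auto simp: free_algebra_carrier)
  show "f - g \<in> carrier (free_algebra S)"
    using assms keys_diff[of f g] by (auto simp: free_algebra_carrier)
  show "f * g \<in> carrier (free_algebra S)"
    using assms Poly_Mapping.keys_mult[of f g] by (fastforce simp: free_algebra_carrier plus_list_def)
qed

lemma free_algebra_zero_one [simp]:
  "0 \<in> carrier (free_algebra S)" "1 \<in> carrier (free_algebra S)"
  by (auto simp: free_algebra_carrier zero_list_def)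

lemma free_algebra_sum:
  "(\<And>i. i \<in> I \<Longrightarrow> f i \<in> carrier (free_algebra S)) \<Longrightarrow> sum f I \<in> carrier (free_algebra S)"
  by (induction I rule: infinite_finite_induct) auto

lemma ring_free_algebra: "ring (free_algebra S :: ('a list \<Rightarrow>\<^sub>0 'k::field) ring)"
proof (rule ringI)
  show "abelian_group (free_algebra S :: ('a list \<Rightarrow>\<^sub>0 'k) ring)"
    by (rule abelian_groupI) (auto simp: add.assoc add.commute intro!: bexI[of _ "- _"])
  show "Group.monoid (free_algebra S :: ('a list \<Rightarrow>\<^sub>0 'k) ring)"
    by (rule monoidI) (auto simp: mult.assoc)
qed (auto simp: distrib_left distrib_right)

lemma free_algebra_uminus [simp]:
  "f \<in> carrier (free_algebra S) \<Longrightarrow> \<ominus>\<^bsub>free_algebra S\<^esub> f = - (f :: 'a list \<Rightarrow>\<^sub>0 'k::field)"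
proof -
  interpret ring "free_algebra S :: ('a list \<Rightarrow>\<^sub>0 'k) ring" by (rule ring_free_algebra)
  assume "f \<in> carrier (free_algebra S)"
  thus ?thesis by (intro minus_equality) auto
qed

lemma single_Cons: "Poly_Mapping.single (z # w) a = lt z * Poly_Mapping.single w (a :: 'k::field)"
  by (simp add: mult_single plus_list_def)

lemma sc_mult_single: "sc a * Poly_Mapping.single w b = Poly_Mapping.single w (a * b :: 'k::field)"
  by (simp add: mult_single plus_list_def)

lemma single_mult_sc: "Poly_Mapping.single w b * sc a = Poly_Mapping.single w (a * b :: 'k::field)"
  by (simp add: mult_single plus_list_def mult.commute)

lemma sc_one: "sc (1::'k::field) = 1"
  unfolding zero_list_def[symmetric] by (rule single_one)

lemma sc_simps: "sc (0::'k::field) = 0" "sc (a::'k) * sc b = sc (a * b)"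
  "sc (a + b) = sc a + sc b" "sc (- a) = - sc a"
  by (simp_all add: mult_single plus_list_def single_add single_uminus)

locale cherednik_algebra =
  fixes G :: "'g monoid" and V :: "('g, 'k::field, 'v) rep" and t :: 'k and c :: "'g \<Rightarrow> 'k"
  assumes grp: "group G" and fdr: "fin_dim_rep G V"
begin

abbreviation F :: "('g, 'k, 'v) word_alg ring" where "F \<equiv> free_algebra (letters G V)"
abbreviation "H \<equiv> cherednik G V t c"
abbreviation "E \<equiv> cls G V t c"
abbreviation "I \<equiv> cher_ideal G V t c"
abbreviation "D \<equiv> dual_rep G V"

lemma rep: "is_rep G V" using fdr by (simp add: fin_dim_rep_def)
lemma vs: "vectorspace class_ring V" using is_repD(1)[OF rep] .
lemma fd: "vectorspace.fin_dim class_ring V" using fdr by (simp add: fin_dim_rep_def)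
lemma D_rep: "is_rep G D" by (rule dual_is_rep[OF grp rep])
lemma D_vs: "vectorspace class_ring D" by (rule is_repD(1)[OF D_rep])

lemma letters_iff [simp]:
  "Grp g \<in> letters G V \<longleftrightarrow> g \<in> carrier G"
  "Vec y \<in> letters G V \<longleftrightarrow> y \<in> carrier V"
  "Cov x \<in> letters G V \<longleftrightarrow> x \<in> carrier D"
  by (auto simp: letters_def)

lemma inv_closed [simp]: "g \<in> carrier G \<Longrightarrow> inv\<^bsub>G\<^esub> g \<in> carrier G"
  using grp by (rule group.inv_closed)

lemma mult_closed [simp]: "g \<in> carrier G \<Longrightarrow> h \<in> carrier G \<Longrightarrow> g \<otimes>\<^bsub>G\<^esub> h \<in> carrier G"
  using group.is_monoid[OF grp] by (rule monoid.m_closed)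

lemma one_closed [simp]: "\<one>\<^bsub>G\<^esub> \<in> carrier G"
  using group.is_monoid[OF grp] by (rule monoid.one_closed)

lemma reflections_subset: "reflections G V \<subseteq> carrier G"
  by (auto simp: reflections_def)

lemma V_closed [simp]:
  "u \<in> carrier V \<Longrightarrow> v \<in> carrier V \<Longrightarrow> u \<oplus>\<^bsub>V\<^esub> v \<in> carrier V"
  "v \<in> carrier V \<Longrightarrow> a \<odot>\<^bsub>V\<^esub> v \<in> carrier V"
  "g \<in> carrier G \<Longrightarrow> v \<in> carrier V \<Longrightarrow> act V g v \<in> carrier V"
  using vectorspace_closed[OF vs] is_repD(2)[OF rep] by blast+

lemma D_closed:
  "x \<in> carrier D \<Longrightarrow> x' \<in> carrier D \<Longrightarrow> x \<oplus>\<^bsub>D\<^esub> x' \<in> carrier D"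
  "x \<in> carrier D \<Longrightarrow> a \<odot>\<^bsub>D\<^esub> x \<in> carrier D"
  "g \<in> carrier G \<Longrightarrow> x \<in> carrier D \<Longrightarrow> act D g x \<in> carrier D"
  using vectorspace_closed[OF D_vs] is_repD(2)[OF D_rep] by blast+

lemma relations_carrier: "smash_relations G V \<union> cherednik_relations G V t c \<subseteq> carrier F"
proof -
  have "s \<in> reflections G V \<Longrightarrow> s \<in> carrier G" for s using reflections_subset by blast
  note [simp] = this
  show ?thesis
    unfolding smash_relations_def cherednik_relations_def Let_def
    by (auto intro!: free_algebra_closed free_algebra_sum simp: D_closed)
qed

lemma ideal_I: "ideal I F"
  unfolding cher_ideal_def by (rule ring.genideal_ideal[OF ring_free_algebra relations_carrier])

lemma ring_H: "ring H"
  unfolding cherednik_def by (rule ideal.quotient_is_ring[OF ideal_I])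

lemma E_ring_hom: "E \<in> Ring.ring_hom F H"
proof -
  have "E = (+>\<^bsub>F\<^esub>) I" by (rule ext) (simp add: cls_def)
  thus ?thesis using ideal.rcos_ring_hom[OF ideal_I] by (simp add: cherednik_def)
qed

lemma E_closed [simp]: "f \<in> carrier F \<Longrightarrow> E f \<in> carrier H"
  using ring_hom_closed[OF E_ring_hom] .
lemma E_add: "f \<in> carrier F \<Longrightarrow> g \<in> carrier F \<Longrightarrow> E (f + g) = E f \<oplus>\<^bsub>H\<^esub> E g"
  using ring_hom_add[OF E_ring_hom] by simp
lemma E_mult: "f \<in> carrier F \<Longrightarrow> g \<in> carrier F \<Longrightarrow> E (f * g) = E f \<otimes>\<^bsub>H\<^esub> E g"
  using ring_hom_mult[OF E_ring_hom] by simp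
lemma E_one: "E 1 = \<one>\<^bsub>H\<^esub>"
  using ring_hom_one[OF E_ring_hom] by simp
lemma E_zero: "E 0 = \<zero>\<^bsub>H\<^esub>"
  using ring_hom_zero[OF E_ring_hom ring_free_algebra ring_H] by simp

lemma carrier_H: "r \<in> carrier H \<longleftrightarrow> (\<exists>f\<in>carrier F. r = E f)"
  by (auto simp: cherednik_def FactRing_def A_RCOSETS_def' cls_def)

lemma E_eq_zero: "f \<in> carrier F \<Longrightarrow> E f = \<zero>\<^bsub>H\<^esub> \<longleftrightarrow> f \<in> I"
proof -
  assume f: "f \<in> carrier F"
  interpret ideal I F by (rule ideal_I)
  have z: "\<zero>\<^bsub>H\<^esub> = I" by (simp add: cherednik_def FactRing_def)
  show ?thesis unfolding z cls_def using f a_rcos_self a_rcos_const by metis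
qed

lemma E_relation: "f \<in> smash_relations G V \<union> cherednik_relations G V t c \<Longrightarrow> E f = \<zero>\<^bsub>H\<^esub>"
  using E_eq_zero relations_carrier ring.genideal_self[OF ring_free_algebra relations_carrier]
  unfolding cher_ideal_def by blast

text \<open>A map on words descends to the algebra if its kernel is an ideal that contains the relations.\<close>

lemma E_kernel_subset:
  assumes "ideal K F" "smash_relations G V \<union> cherednik_relations G V t c \<subseteq> K"
    and "f \<in> carrier F" "E f = \<zero>\<^bsub>H\<^esub>"
  shows "f \<in> K"
  using assms E_eq_zero[OF assms(3)] ring.genideal_minimal[OF ring_free_algebra assms(1,2)]
  unfolding cher_ideal_def by blast

lemma E_uminus: "f \<in> carrier F \<Longrightarrow> E (- f) = \<ominus>\<^bsub>H\<^esub> E f"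
proof -
  assume f: "f \<in> carrier F"
  interpret ring H by (rule ring_H)
  have "E (- f) \<oplus>\<^bsub>H\<^esub> E f = \<zero>\<^bsub>H\<^esub>"
    using E_add[of "- f" f] f free_algebra_closed(4)[OF f f] E_zero by simp
  thus ?thesis using minus_equality f free_algebra_closed(4)[OF f f] by simp
qed

lemma E_diff_zero:
  assumes "f \<in> carrier F" "g \<in> carrier F"
  shows "E (f - g) = \<zero>\<^bsub>H\<^esub> \<longleftrightarrow> E f = E g"
proof -
  interpret ring H by (rule ring_H)
  have "E (f - g) = E f \<ominus>\<^bsub>H\<^esub> E g"
    using E_add[of f "- g"] E_uminus assms free_algebra_closed(4)[OF assms(2) assms(2)]
    by (simp add: a_minus_def)
  thus ?thesis using assms by simp
qed

lemma E_relation_eq: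
  "f - g \<in> smash_relations G V \<union> cherednik_relations G V t c \<Longrightarrow>
    f \<in> carrier F \<Longrightarrow> g \<in> carrier F \<Longrightarrow> E f = E g"
  using E_relation E_diff_zero by blast

lemma F_induct [consumes 1, case_names zero single add]:
  assumes "f \<in> carrier F"
    and "P 0"
    and "\<And>w a. w \<in> Poly_Mapping.keys f \<Longrightarrow> set w \<subseteq> letters G V \<Longrightarrow> P (Poly_Mapping.single w a)"
    and "\<And>f g. f \<in> carrier F \<Longrightarrow> g \<in> carrier F \<Longrightarrow> P f \<Longrightarrow> P g \<Longrightarrow> P (f + g)"
  shows "P f"
proof -
  have "(\<Sum>w\<in>A. Poly_Mapping.single w (Poly_Mapping.lookup f w)) \<in> carrier F \<and>
    P (\<Sum>w\<in>A. Poly_Mapping.single w (Poly_Mapping.lookup f w))"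
    if "finite A" "A \<subseteq> Poly_Mapping.keys f" for A
    using that
  proof (induction A rule: finite_induct)
    case (insert w A)
    have w: "set w \<subseteq> letters G V" using insert assms(1) by (auto simp: free_algebra_carrier)
    show ?case using insert w assms(3)[of w] by (auto intro!: assms(4))
  qed (simp add: assms(2))
  from this[of "Poly_Mapping.keys f"] show ?thesis
    using poly_mapping_sum_single[of f] by simp
qed

text \<open>The free algebra is spanned by words, and a word is a product of letters.\<close>

lemma H_induct [consumes 1, case_names scalar letter add mult]:
  assumes "r \<in> carrier H"
    and sc: "\<And>a. P (E (sc a))"
    and lt: "\<And>z. z \<in> letters G V \<Longrightarrow> P (E (lt z))"
    and add: "\<And>r s. r \<in> carrier H \<Longrightarrow> s \<in> carrier H \<Longrightarrow> P r \<Longrightarrow> P s \<Longrightarrow> P (r \<oplus>\<^bsub>H\<^esub> s)"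
    and mult: "\<And>r s. r \<in> carrier H \<Longrightarrow> s \<in> carrier H \<Longrightarrow> P r \<Longrightarrow> P s \<Longrightarrow> P (r \<otimes>\<^bsub>H\<^esub> s)"
  shows "P r"
proof -
  obtain f where f: "f \<in> carrier F" "r = E f" using assms(1) by (auto simp: carrier_H)
  have word: "P (E (Poly_Mapping.single w a))" if "set w \<subseteq> letters G V" for w a
    using that
  proof (induction w)
    case Nil
    then show ?case using sc by simp
  next
    case (Cons z w)
    hence "P (E (lt z) \<otimes>\<^bsub>H\<^esub> E (Poly_Mapping.single w a))"
      by (intro mult lt) auto
    thus ?case using Cons.prems by (subst single_Cons, subst E_mult) auto
  qed
  from f(1) have "P (E f)"
  proof (induction rule: F_induct)
    case zero
    then show ?case using sc[of 0] by simp
  qed (auto simp: E_add intro!: word add)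
  thus ?thesis using f by simp
qed

definition word_deg :: "('g, 'v, 'v \<Rightarrow> 'k) letter list \<Rightarrow> int" where
  "word_deg w = sum_list (map letter_deg w)"

lemma grade_induct [consumes 1, case_names zero single add]:
  assumes "r \<in> cher_grade G V t c i"
    and "P \<zero>\<^bsub>H\<^esub>"
    and "\<And>w a. set w \<subseteq> letters G V \<Longrightarrow> word_deg w = i \<Longrightarrow> P (E (Poly_Mapping.single w a))"
    and "\<And>r s. r \<in> carrier H \<Longrightarrow> s \<in> carrier H \<Longrightarrow> P r \<Longrightarrow> P s \<Longrightarrow> P (r \<oplus>\<^bsub>H\<^esub> s)"
  shows "P r"
proof -
  obtain f where f: "f \<in> carrier F" "r = E f" "\<forall>w\<in>Poly_Mapping.keys f. word_deg w = i"
    using assms(1) by (auto simp: cher_grade_def word_deg_def)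
  from f(1) have "P (E f)"
    by (induction rule: F_induct) (use f(3) in \<open>auto simp: E_zero E_add intro!: assms(2-4)\<close>)
  thus ?thesis using f by simp
qed

lemma grade_single: "set w \<subseteq> letters G V \<Longrightarrow> word_deg w = i \<Longrightarrow>
    E (Poly_Mapping.single w a) \<in> cher_grade G V t c i"
  unfolding cher_grade_def word_deg_def by (intro imageI) auto

lemma grade_carrier: "r \<in> cher_grade G V t c i \<Longrightarrow> r \<in> carrier H"
  by (auto simp: cher_grade_def)

lemma grade_letter: "z \<in> letters G V \<Longrightarrow> E (lt z) \<in> cher_grade G V t c (letter_deg z)"
  using grade_single[of "[z]"] by (simp add: word_deg_def)

lemma grade_scalar: "E (sc a) \<in> cher_grade G V t c 0"
  using grade_single[of "[]"] by (simp add: word_deg_def)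

lemma grade_mult:
  assumes "r \<in> cher_grade G V t c i" "s \<in> cher_grade G V t c j"
  shows "r \<otimes>\<^bsub>H\<^esub> s \<in> cher_grade G V t c (i + j)"
proof -
  obtain f g where f: "f \<in> carrier F" "r = E f" "\<forall>w\<in>Poly_Mapping.keys f. sum_list (map letter_deg w) = i"
    and g: "g \<in> carrier F" "s = E g" "\<forall>w\<in>Poly_Mapping.keys g. sum_list (map letter_deg w) = j"
    using assms by (auto simp: cher_grade_def)
  have "\<forall>w\<in>Poly_Mapping.keys (f * g). sum_list (map letter_deg w) = i + j"
  proof
    fix w assume "w \<in> Poly_Mapping.keys (f * g)"
    then obtain u v where "u \<in> Poly_Mapping.keys f" "v \<in> Poly_Mapping.keys g" "w = u @ v"
      using Poly_Mapping.keys_mult[of f g] by (auto simp: plus_list_def)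
    thus "sum_list (map letter_deg w) = i + j" using f g by simp
  qed
  moreover have "r \<otimes>\<^bsub>H\<^esub> s = E (f * g)" using f g by (simp add: E_mult)
  ultimately show ?thesis unfolding cher_grade_def using free_algebra_closed(3)[OF f(1) g(1)] by blast
qed

lemma homogeneous_induct [consumes 1, case_names homogeneous add]:
  assumes "r \<in> carrier H"
    and "\<And>i r. r \<in> cher_grade G V t c i \<Longrightarrow> P r"
    and "\<And>r s. r \<in> carrier H \<Longrightarrow> s \<in> carrier H \<Longrightarrow> P r \<Longrightarrow> P s \<Longrightarrow> P (r \<oplus>\<^bsub>H\<^esub> s)"
  shows "P r"
proof -
  obtain f where f: "f \<in> carrier F" "r = E f" using assms(1) by (auto simp: carrier_H)
  from f(1) have "P (E f)"
  proof (induction rule: F_induct)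
    case zero
    then show ?case using assms(2)[OF grade_scalar[of 0]] by simp
  next
    case (single w a)
    then show ?case using assms(2)[OF grade_single[of w "word_deg w"]] by simp
  next
    case (add f g)
    then show ?case by (simp add: E_add assms(3))
  qed
  thus ?thesis using f by simp
qed

end

section \<open>Graded modules\<close>

context left_module
begin

lemma smult_r_zero [simp]: "a \<in> carrier R \<Longrightarrow> a \<odot>\<^bsub>M\<^esub> \<zero>\<^bsub>M\<^esub> = \<zero>\<^bsub>M\<^esub>"
proof -
  assume a: "a \<in> carrier R"
  have "a \<odot>\<^bsub>M\<^esub> \<zero>\<^bsub>M\<^esub> \<oplus>\<^bsub>M\<^esub> a \<odot>\<^bsub>M\<^esub> \<zero>\<^bsub>M\<^esub> = a \<odot>\<^bsub>M\<^esub> \<zero>\<^bsub>M\<^esub>"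
    using smult_r_distr[OF a, of "\<zero>\<^bsub>M\<^esub>" "\<zero>\<^bsub>M\<^esub>"] by simp
  thus ?thesis using smult_closed[OF a, of "\<zero>\<^bsub>M\<^esub>"] by (metis M.add.l_cancel_one M.zero_closed)
qed

lemma smult_l_zero [simp]: "x \<in> carrier M \<Longrightarrow> \<zero>\<^bsub>R\<^esub> \<odot>\<^bsub>M\<^esub> x = \<zero>\<^bsub>M\<^esub>"
proof -
  assume x: "x \<in> carrier M"
  have "\<zero>\<^bsub>R\<^esub> \<odot>\<^bsub>M\<^esub> x \<oplus>\<^bsub>M\<^esub> \<zero>\<^bsub>R\<^esub> \<odot>\<^bsub>M\<^esub> x = \<zero>\<^bsub>R\<^esub> \<odot>\<^bsub>M\<^esub> x"
    using smult_l_distr[of "\<zero>\<^bsub>R\<^esub>" "\<zero>\<^bsub>R\<^esub>" x] x by simp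
  thus ?thesis using smult_closed[of "\<zero>\<^bsub>R\<^esub>" x] x by (metis M.add.l_cancel_one R.zero_closed)
qed

end

text \<open>Used for elements of a graded module only, where the decomposition exists and is unique.\<close>

definition component :: "('a, 'm) gmodule \<Rightarrow> int \<Rightarrow> 'm \<Rightarrow> 'm" where
  "component M k v = (THE f. homog_decomp M v f) k"

locale graded_module =
  fixes R :: "'a ring" and Rgr :: "int \<Rightarrow> 'a set" and M :: "('a, 'm) gmodule"
  assumes gm: "is_gmodule R Rgr M" and Rgr_carrier: "Rgr i \<subseteq> carrier R"
begin

sublocale lm: left_module R M
  using gm by (simp add: is_gmodule_def)

lemma grade_subgroup: "subgroup (grade M i) (add_monoid M)"
  using gm by (simp add: is_gmodule_def)

lemma grade_zero [simp]: "\<zero>\<^bsub>M\<^esub> \<in> grade M i"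
  using subgroup.one_closed[OF grade_subgroup] by simp

lemma grade_add: "u \<in> grade M i \<Longrightarrow> v \<in> grade M i \<Longrightarrow> u \<oplus>\<^bsub>M\<^esub> v \<in> grade M i"
  using subgroup.m_closed[OF grade_subgroup] by simp

lemma grade_closed: "u \<in> grade M i \<Longrightarrow> u \<in> carrier M"
  using subgroup.subset[OF grade_subgroup] by auto

lemma grade_smult: "r \<in> Rgr i \<Longrightarrow> v \<in> grade M j \<Longrightarrow> r \<odot>\<^bsub>M\<^esub> v \<in> grade M (i + j)"
  using gm by (simp add: is_gmodule_def)

lemma homog_decompI:
  assumes "finite A" "\<And>i. f i \<in> grade M i" "\<And>i. i \<notin> A \<Longrightarrow> f i = \<zero>\<^bsub>M\<^esub>" "v = finsum M f A"
  shows "homog_decomp M v f"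
proof -
  have sub: "{i. f i \<noteq> \<zero>\<^bsub>M\<^esub>} \<subseteq> A" using assms(3) by auto
  have "finsum M f {i. f i \<noteq> \<zero>\<^bsub>M\<^esub>} = finsum M f A"
    by (rule lm.add.finprod_mono_neutral_cong_left) (use assms sub grade_closed[OF assms(2)] in auto)
  thus ?thesis
    using assms finite_subset[OF sub] by (simp add: homog_decomp_def)
qed

lemma homog_decompD:
  assumes "homog_decomp M v f"
  shows "f i \<in> grade M i" "finite {i. f i \<noteq> \<zero>\<^bsub>M\<^esub>}"
    "\<And>A. finite A \<Longrightarrow> {i. f i \<noteq> \<zero>\<^bsub>M\<^esub>} \<subseteq> A \<Longrightarrow> v = finsum M f A"
proof -
  show f: "f i \<in> grade M i" "finite {i. f i \<noteq> \<zero>\<^bsub>M\<^esub>}" for i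
    using assms by (auto simp: homog_decomp_def)
  fix A assume "finite A" and sub: "{i. f i \<noteq> \<zero>\<^bsub>M\<^esub>} \<subseteq> A"
  have "finsum M f {i. f i \<noteq> \<zero>\<^bsub>M\<^esub>} = finsum M f A"
    by (rule lm.add.finprod_mono_neutral_cong_left) (use \<open>finite A\<close> sub grade_closed[OF f(1)] in auto)
  thus "v = finsum M f A" using assms by (simp add: homog_decomp_def)
qed

lemma decomp_unique: "v \<in> carrier M \<Longrightarrow> \<exists>!f. homog_decomp M v f"
  using gm by (simp add: is_gmodule_def)

lemma component_decomp: "v \<in> carrier M \<Longrightarrow> homog_decomp M v (\<lambda>k. component M k v)"
  unfolding component_def by (rule theI'[OF decomp_unique])

lemma component_eq: "v \<in> carrier M \<Longrightarrow> homog_decomp M v f \<Longrightarrow> component M k v = f k"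
  using component_decomp decomp_unique by (metis (full_types))

lemma component_grade [simp]: "v \<in> carrier M \<Longrightarrow> component M k v \<in> grade M k"
  using homog_decompD(1)[OF component_decomp] .

lemma component_closed [simp]: "v \<in> carrier M \<Longrightarrow> component M k v \<in> carrier M"
  using component_grade grade_closed by blast

lemma component_homogeneous:
  assumes "v \<in> grade M i"
  shows "component M k v = (if k = i then v else \<zero>\<^bsub>M\<^esub>)"
proof (rule component_eq[OF grade_closed[OF assms]])
  show "homog_decomp M v (\<lambda>k. if k = i then v else \<zero>\<^bsub>M\<^esub>)"
    by (rule homog_decompI[of "{i}"]) (use assms grade_closed[OF assms] in auto)
qed

lemma component_add:
  assumes "u \<in> carrier M" "v \<in> carrier M"
  shows "component M k (u \<oplus>\<^bsub>M\<^esub> v) = component M k u \<oplus>\<^bsub>M\<^esub> component M k v"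
proof (rule component_eq)
  let ?f = "\<lambda>k. component M k u" and ?g = "\<lambda>k. component M k v"
  let ?A = "{i. ?f i \<noteq> \<zero>\<^bsub>M\<^esub>} \<union> {i. ?g i \<noteq> \<zero>\<^bsub>M\<^esub>}"
  note f = homog_decompD[OF component_decomp[OF assms(1)]]
  note g = homog_decompD[OF component_decomp[OF assms(2)]]
  have fin: "finite ?A" using f(2) g(2) by simp
  show "homog_decomp M (u \<oplus>\<^bsub>M\<^esub> v) (\<lambda>k. ?f k \<oplus>\<^bsub>M\<^esub> ?g k)"
  proof (rule homog_decompI[OF fin])
    have "u = finsum M ?f ?A" "v = finsum M ?g ?A"
      by (rule f(3)[OF fin] g(3)[OF fin]; blast)+
    moreover have "finsum M (\<lambda>k. ?f k \<oplus>\<^bsub>M\<^esub> ?g k) ?A = finsum M ?f ?A \<oplus>\<^bsub>M\<^esub> finsum M ?g ?A"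
      by (rule lm.finsum_addf) (use assms in auto)
    ultimately show "u \<oplus>\<^bsub>M\<^esub> v = finsum M (\<lambda>k. ?f k \<oplus>\<^bsub>M\<^esub> ?g k) ?A" by simp
  qed (use assms grade_add in auto)
qed (use assms in simp)

lemma component_zero [simp]: "component M k \<zero>\<^bsub>M\<^esub> = \<zero>\<^bsub>M\<^esub>"
  using component_homogeneous[OF grade_zero, of k] by simp

text \<open>An element is the sum of its components, only finitely many of which are nonzero.\<close>

lemma component_sum_closed:
  assumes "v \<in> carrier M" "\<And>k. component M k v \<in> U" "\<zero>\<^bsub>M\<^esub> \<in> U"
    "\<And>x y. x \<in> U \<Longrightarrow> y \<in> U \<Longrightarrow> x \<oplus>\<^bsub>M\<^esub> y \<in> U"
  shows "v \<in> U"
proof -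
  note f = homog_decompD[OF component_decomp[OF assms(1)]]
  have "finsum M (\<lambda>k. component M k v) A \<in> U" if "finite A" for A
    using that
  proof (induction A rule: finite_induct)
    case (insert k A)
    thus ?case using assms by (simp add: lm.M.finsum_insert Pi_def)
  qed (use assms in simp)
  from this[OF f(2)] show ?thesis unfolding f(3)[OF f(2) order.refl, symmetric] .
qed

lemma homogeneous_module_induct [consumes 1, case_names homogeneous add]:
  assumes "v \<in> carrier M"
    and "\<And>i u. u \<in> grade M i \<Longrightarrow> P u"
    and "\<And>u v. u \<in> carrier M \<Longrightarrow> v \<in> carrier M \<Longrightarrow> P u \<Longrightarrow> P v \<Longrightarrow> P (u \<oplus>\<^bsub>M\<^esub> v)"
  shows "P v"
proof -
  have "v \<in> {u \<in> carrier M. P u}"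
    by (rule component_sum_closed[OF assms(1)])
      (use assms(1) assms(2)[OF component_grade[OF assms(1)]] assms(2)[OF grade_zero] assms(3) in auto)
  thus ?thesis by simp
qed

lemma component_eqI:
  assumes "u \<in> carrier M" "v \<in> carrier M" "\<And>k. component M k u = component M k v"
  shows "u = v"
  using component_decomp[OF assms(1)] component_decomp[OF assms(2)] assms(3)
  by (simp add: homog_decomp_def)

lemma component_smult:
  assumes "r \<in> Rgr j" "v \<in> carrier M"
  shows "component M k (r \<odot>\<^bsub>M\<^esub> v) = r \<odot>\<^bsub>M\<^esub> component M (k - j) v"
  using assms(2)
proof (induction rule: homogeneous_module_induct)
  case (homogeneous i u)
  have "r \<in> carrier R" using assms(1) Rgr_carrier by blast
  thus ?case using component_homogeneous[OF homogeneous] component_homogeneous[OF grade_smult[OF assms(1) homogeneous]]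
    by (auto simp: algebra_simps)
next
  case (add u v)
  have r: "r \<in> carrier R" using assms(1) Rgr_carrier by blast
  show ?case using add by (simp add: lm.smult_r_distr[OF r] lm.smult_closed[OF r] component_add)
qed

end

section \<open>Quotients by submodules\<close>

text \<open>These hypotheses on the action are weaker than the module axioms: the free abelian group on pairs
  satisfies them, although it becomes a module over the algebra only after dividing by the tensor
  relations.\<close>

locale module_quotient =
  fixes C :: "'a set" and M :: "('a, 'm) gmodule" and N :: "'m set"
  assumes ab: "abelian_group M" and sub: "subgroup N (add_monoid M)"
    and sm_closed: "\<And>r m. r \<in> C \<Longrightarrow> m \<in> carrier M \<Longrightarrow> r \<odot>\<^bsub>M\<^esub> m \<in> carrier M"
    and sm_add: "\<And>r m n. r \<in> C \<Longrightarrow> m \<in> carrier M \<Longrightarrow> n \<in> carrier M \<Longrightarrow>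
      r \<odot>\<^bsub>M\<^esub> (m \<oplus>\<^bsub>M\<^esub> n) = r \<odot>\<^bsub>M\<^esub> m \<oplus>\<^bsub>M\<^esub> r \<odot>\<^bsub>M\<^esub> n"
    and sm_sub: "\<And>r m. r \<in> C \<Longrightarrow> m \<in> N \<Longrightarrow> r \<odot>\<^bsub>M\<^esub> m \<in> N"
begin

lemma abelian_subgroup: "abelian_subgroup N M"
  by (rule abelian_subgroupI3[OF additive_subgroup.intro[OF sub] ab])

abbreviation "Q \<equiv> gquot M N"
abbreviation q where "q m \<equiv> N +>\<^bsub>M\<^esub> m"

lemma q_closed [simp]: "m \<in> carrier M \<Longrightarrow> q m \<in> carrier Q"
  by (auto simp: gquot_def A_RCOSETS_def')

lemma q_surj: "X \<in> carrier Q \<Longrightarrow> \<exists>m\<in>carrier M. X = q m"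
  by (auto simp: gquot_def A_RCOSETS_def')

lemma q_add: "m \<in> carrier M \<Longrightarrow> n \<in> carrier M \<Longrightarrow> q m \<oplus>\<^bsub>Q\<^esub> q n = q (m \<oplus>\<^bsub>M\<^esub> n)"
  using abelian_subgroup.a_rcos_sum[OF abelian_subgroup] by (simp add: gquot_def)

lemma q_grade: "grade Q i = q ` grade M i"
  by (simp add: gquot_def)

lemma N_closed: "n \<in> N \<Longrightarrow> n \<in> carrier M"
  using subgroup.subset[OF sub] by auto

lemma q_eq_iff:
  assumes "m \<in> carrier M" "n \<in> carrier M"
  shows "q m = q n \<longleftrightarrow> m \<ominus>\<^bsub>M\<^esub> n \<in> N"
proof -
  interpret abelian_subgroup N M by (rule abelian_subgroup)
  show ?thesis
  proof
    assume "q m = q n"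
    hence "m \<in> q n" using a_rcos_self[OF assms(1)] by simp
    thus "m \<ominus>\<^bsub>M\<^esub> n \<in> N" using a_rcos_module[OF assms(2,1)] by (simp add: a_minus_def)
  next
    assume "m \<ominus>\<^bsub>M\<^esub> n \<in> N"
    hence "m \<in> q n" using a_rcos_module[OF assms(2,1)] by (simp add: a_minus_def)
    thus "q m = q n" using a_repr_independence assms(2) a_subgroup by metis
  qed
qed

lemma q_zero: "\<zero>\<^bsub>Q\<^esub> = q \<zero>\<^bsub>M\<^esub>"
proof -
  interpret abelian_subgroup N M by (rule abelian_subgroup)
  have "\<zero>\<^bsub>M\<^esub> \<in> N" using subgroup.one_closed[OF sub] by simp
  thus ?thesis using a_rcos_const by (simp add: gquot_def)
qed

lemma q_smult:
  assumes "r \<in> C" "m \<in> carrier M"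
  shows "r \<odot>\<^bsub>Q\<^esub> q m = q (r \<odot>\<^bsub>M\<^esub> m)"
proof -
  interpret abelian_subgroup N M by (rule abelian_subgroup)
  have "q (r \<odot>\<^bsub>M\<^esub> n) = q (r \<odot>\<^bsub>M\<^esub> m)" if n: "n \<in> q m" for n
  proof -
    obtain k where k: "k \<in> N" "n = k \<oplus>\<^bsub>M\<^esub> m" using n by (auto simp: a_r_coset_def')
    have rk: "r \<odot>\<^bsub>M\<^esub> k \<in> N" using sm_sub assms(1) k(1) by blast
    have "r \<odot>\<^bsub>M\<^esub> n = r \<odot>\<^bsub>M\<^esub> k \<oplus>\<^bsub>M\<^esub> r \<odot>\<^bsub>M\<^esub> m" using sm_add assms k N_closed by simp
    hence "r \<odot>\<^bsub>M\<^esub> n \<in> q (r \<odot>\<^bsub>M\<^esub> m)" using rk by (auto simp: a_r_coset_def')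
    thus ?thesis using a_repr_independence sm_closed[OF assms] a_subgroup by metis
  qed
  hence "(\<Union>n\<in>q m. q (r \<odot>\<^bsub>M\<^esub> n)) = (\<Union>n\<in>q m. q (r \<odot>\<^bsub>M\<^esub> m))" by (intro SUP_cong refl)
  also have "\<dots> = q (r \<odot>\<^bsub>M\<^esub> m)" using a_rcos_self[OF assms(2)] by blast
  also have "(\<Union>n\<in>q m. q (r \<odot>\<^bsub>M\<^esub> n)) = r \<odot>\<^bsub>Q\<^esub> q m" unfolding gquot_def by simp
  finally show ?thesis .
qed

lemma Q_abelian_group: "abelian_group Q"
proof (rule abelian_groupI)
  interpret abelian_group M by (rule ab)
  show "X \<oplus>\<^bsub>Q\<^esub> Y \<in> carrier Q" if "X \<in> carrier Q" "Y \<in> carrier Q" for X Y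
    using q_surj[OF that(1)] q_surj[OF that(2)] by (auto simp: q_add)
  show "X \<oplus>\<^bsub>Q\<^esub> Y \<oplus>\<^bsub>Q\<^esub> Z = X \<oplus>\<^bsub>Q\<^esub> (Y \<oplus>\<^bsub>Q\<^esub> Z)"
    if "X \<in> carrier Q" "Y \<in> carrier Q" "Z \<in> carrier Q" for X Y Z
    using q_surj[OF that(1)] q_surj[OF that(2)] q_surj[OF that(3)] by (auto simp: q_add a_assoc)
  show "X \<oplus>\<^bsub>Q\<^esub> Y = Y \<oplus>\<^bsub>Q\<^esub> X" if "X \<in> carrier Q" "Y \<in> carrier Q" for X Y
    using q_surj[OF that(1)] q_surj[OF that(2)] by (auto simp: q_add a_comm)
  show "\<zero>\<^bsub>Q\<^esub> \<in> carrier Q" by (simp add: q_zero)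
  show "\<zero>\<^bsub>Q\<^esub> \<oplus>\<^bsub>Q\<^esub> X = X" if "X \<in> carrier Q" for X
    using q_surj[OF that] by (auto simp: q_add q_zero)
  show "\<exists>Y\<in>carrier Q. Y \<oplus>\<^bsub>Q\<^esub> X = \<zero>\<^bsub>Q\<^esub>" if X: "X \<in> carrier Q" for X
  proof -
    obtain m where m: "m \<in> carrier M" "X = q m" using q_surj[OF X] by blast
    show ?thesis
      by (rule bexI[of _ "q (\<ominus>\<^bsub>M\<^esub> m)"]) (use m in \<open>auto simp: q_add q_zero l_neg\<close>)
  qed
qed

end

section \<open>The triangular decomposition\<close>

locale cherednik_module = cherednik_algebra G V t c
  for G :: "'g monoid" and V :: "('g, 'k::field, 'v) rep" and t :: 'k and c :: "'g \<Rightarrow> 'k" +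
  fixes N :: "(('g, 'k, 'v) cher, 'm) gmodule"
  assumes lmod: "left_module (cherednik G V t c) N"
begin

sublocale lm: left_module H N by (rule lmod)

lemma act_closed [simp]: "f \<in> carrier F \<Longrightarrow> v \<in> carrier N \<Longrightarrow> E f \<odot>\<^bsub>N\<^esub> v \<in> carrier N"
  by (simp add: lm.smult_closed)

lemma act_add: "f \<in> carrier F \<Longrightarrow> g \<in> carrier F \<Longrightarrow> v \<in> carrier N \<Longrightarrow>
    E (f + g) \<odot>\<^bsub>N\<^esub> v = E f \<odot>\<^bsub>N\<^esub> v \<oplus>\<^bsub>N\<^esub> E g \<odot>\<^bsub>N\<^esub> v"
  by (simp add: E_add lm.smult_l_distr)

lemma act_mult: "f \<in> carrier F \<Longrightarrow> g \<in> carrier F \<Longrightarrow> v \<in> carrier N \<Longrightarrow>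
    E (f * g) \<odot>\<^bsub>N\<^esub> v = E f \<odot>\<^bsub>N\<^esub> (E g \<odot>\<^bsub>N\<^esub> v)"
  by (simp add: E_mult lm.smult_assoc)

lemma act_scalar_commute:
  assumes "z \<in> letters G V" "v \<in> carrier N"
  shows "E (sc a) \<odot>\<^bsub>N\<^esub> (E (lt z) \<odot>\<^bsub>N\<^esub> v) = E (lt z) \<odot>\<^bsub>N\<^esub> (E (sc a) \<odot>\<^bsub>N\<^esub> v)"
  using act_mult[of "sc a" "lt z" v] act_mult[of "lt z" "sc a" v] assms
  by (simp add: sc_mult_single single_mult_sc)

lemma act_grp_cov:
  assumes "g \<in> carrier G" "x \<in> carrier D" "v \<in> carrier N"
  shows "E (lt (Grp g)) \<odot>\<^bsub>N\<^esub> (E (lt (Cov x)) \<odot>\<^bsub>N\<^esub> v) =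
    E (lt (Cov (act D g x))) \<odot>\<^bsub>N\<^esub> (E (lt (Grp g)) \<odot>\<^bsub>N\<^esub> v)"
proof -
  note gx = D_closed(3)[OF assms(1,2)]
  have "E (lt (Grp g) * lt (Cov x)) = E (lt (Cov (act D g x)) * lt (Grp g))"
  proof (rule E_relation_eq)
    show "lt (Grp g) * lt (Cov x) - lt (Cov (act D g x)) * lt (Grp g)
      \<in> smash_relations G V \<union> cherednik_relations G V t c"
      unfolding smash_relations_def Let_def using assms by blast
  qed (use assms gx in \<open>auto intro!: free_algebra_closed\<close>)
  thus ?thesis
    using act_mult[of "lt (Grp g)" "lt (Cov x)" v] act_mult[of "lt (Cov (act D g x))" "lt (Grp g)" v]
      assms gx by (simp)
qed

lemma act_scalar_central:
  assumes "r \<in> carrier H" "v \<in> carrier N"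
  shows "E (sc a) \<odot>\<^bsub>N\<^esub> (r \<odot>\<^bsub>N\<^esub> v) = r \<odot>\<^bsub>N\<^esub> (E (sc a) \<odot>\<^bsub>N\<^esub> v)"
proof -
  obtain f where f: "f \<in> carrier F" "r = E f" using assms(1) by (auto simp: carrier_H)
  have "sc a * f = f * sc a"
    by (induction f rule: poly_mapping_add_induct)
      (auto simp: sc_mult_single single_mult_sc distrib_left distrib_right)
  thus ?thesis using f assms(2) by (simp flip: act_mult)
qed

lemma act_scalar_one: "v \<in> carrier N \<Longrightarrow> E (sc 1) \<odot>\<^bsub>N\<^esub> v = v"
  by (simp add: sc_one E_one lm.smult_one)

lemma act_scalar_mult: "v \<in> carrier N \<Longrightarrow> E (sc (a * b)) \<odot>\<^bsub>N\<^esub> v = E (sc a) \<odot>\<^bsub>N\<^esub> (E (sc b) \<odot>\<^bsub>N\<^esub> v)"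
  by (simp flip: act_mult add: sc_simps(2))

lemma act_scalar_add: "v \<in> carrier N \<Longrightarrow> E (sc (a + b)) \<odot>\<^bsub>N\<^esub> v = E (sc a) \<odot>\<^bsub>N\<^esub> v \<oplus>\<^bsub>N\<^esub> E (sc b) \<odot>\<^bsub>N\<^esub> v"
  by (simp flip: act_add add: sc_simps(3))

lemma act_scalar_neg: "v \<in> carrier N \<Longrightarrow> E (sc (- 1)) \<odot>\<^bsub>N\<^esub> v = \<ominus>\<^bsub>N\<^esub> v"
proof -
  assume v: "v \<in> carrier N"
  have "E (sc (- 1)) \<odot>\<^bsub>N\<^esub> v \<oplus>\<^bsub>N\<^esub> v = \<zero>\<^bsub>N\<^esub>"
    using act_scalar_add[OF v, of "- 1" 1] v by (simp add: act_scalar_one E_zero)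
  thus ?thesis using lm.M.minus_equality v by simp
qed

text \<open>The record \<open>R\<close> is arbitrary because this is applied to \<open>scalars\<close> as well as to representations on
  parts of the module.\<close>

lemma scalar_vectorspace:
  fixes R :: "('k, 'm, 'z) module_scheme"
  assumes sub: "carrier R \<subseteq> carrier N" and z: "\<zero>\<^bsub>R\<^esub> = \<zero>\<^bsub>N\<^esub>" and a: "add R = add N"
    and s: "smult R = (\<lambda>a m. E (sc a) \<odot>\<^bsub>N\<^esub> m)"
    and zc: "\<zero>\<^bsub>N\<^esub> \<in> carrier R"
    and ac: "\<And>u v. u \<in> carrier R \<Longrightarrow> v \<in> carrier R \<Longrightarrow> u \<oplus>\<^bsub>N\<^esub> v \<in> carrier R"
    and sc: "\<And>a v. v \<in> carrier R \<Longrightarrow> E (sc a) \<odot>\<^bsub>N\<^esub> v \<in> carrier R"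
  shows "vectorspace class_ring R"
proof -
  have in_N: "v \<in> carrier N" if "v \<in> carrier R" for v using sub that by blast
  have neg: "\<exists>w\<in>carrier R. v \<oplus>\<^bsub>R\<^esub> w = \<zero>\<^bsub>R\<^esub>" if "v \<in> carrier R" for v
    using sc[OF that, of "- 1"] act_scalar_neg[OF in_N[OF that]] in_N[OF that]
    by (intro bexI[of _ "\<ominus>\<^bsub>N\<^esub> v"]) (simp_all add: a z lm.M.r_neg)
  show ?thesis
  proof (rule vs_criteria[OF field_class_ring])
    show "\<forall>v\<in>carrier R. \<exists>neg_v\<in>carrier R. v \<oplus>\<^bsub>R\<^esub> neg_v = \<zero>\<^bsub>R\<^esub>" using neg by blast
  qed (use zc ac sc in_N in \<open>auto simp: a z s act_scalar_one act_scalar_mult act_scalar_add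
      lm.smult_r_distr lm.M.a_ac\<close>)
qed

lemma submodule_crit:
  assumes "U \<subseteq> carrier N" "\<zero>\<^bsub>N\<^esub> \<in> U" "\<And>u v. u \<in> U \<Longrightarrow> v \<in> U \<Longrightarrow> u \<oplus>\<^bsub>N\<^esub> v \<in> U"
    and "\<And>r u. r \<in> carrier H \<Longrightarrow> u \<in> U \<Longrightarrow> r \<odot>\<^bsub>N\<^esub> u \<in> U"
  shows "Module.submodule U H N"
proof (rule Module.submodule.intro)
  show "subgroup U (add_monoid N)"
  proof (rule group.subgroupI[OF lm.M.a_group])
    fix u assume "u \<in> U"
    hence "\<ominus>\<^bsub>N\<^esub> u \<in> U" using assms(4)[of "E (sc (- 1))" u] assms(1) by (auto simp: act_scalar_neg)
    thus "inv\<^bsub>add_monoid N\<^esub> u \<in> U" by (simp add: a_inv_def)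
  qed (use assms in auto)
qed (use assms(4) in \<open>simp add: Module.submodule_axioms_def\<close>)

definition subspace_rep :: "'m set \<Rightarrow> ('g, 'k, 'm) rep" where
  "subspace_rep U = \<lparr>carrier = U, mult = undefined, one = undefined, zero = \<zero>\<^bsub>N\<^esub>, add = add N,
     smult = (\<lambda>a m. E (sc a) \<odot>\<^bsub>N\<^esub> m), act = (\<lambda>g m. E (lt (Grp g)) \<odot>\<^bsub>N\<^esub> m)\<rparr>"

lemma subspace_rep_simps [simp]:
  "carrier (subspace_rep U) = U" "\<zero>\<^bsub>subspace_rep U\<^esub> = \<zero>\<^bsub>N\<^esub>" "add (subspace_rep U) = add N"
  "a \<odot>\<^bsub>subspace_rep U\<^esub> m = E (sc a) \<odot>\<^bsub>N\<^esub> m" "act (subspace_rep U) g m = E (lt (Grp g)) \<odot>\<^bsub>N\<^esub> m"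
  by (simp_all add: subspace_rep_def)

lemma act_one_grp: "v \<in> carrier N \<Longrightarrow> E (lt (Grp \<one>\<^bsub>G\<^esub>)) \<odot>\<^bsub>N\<^esub> v = v"
proof -
  assume v: "v \<in> carrier N"
  have "lt (Grp \<one>\<^bsub>G\<^esub>) - 1 \<in> smash_relations G V \<union> cherednik_relations G V t c"
    unfolding smash_relations_def Let_def by blast
  hence "E (lt (Grp \<one>\<^bsub>G\<^esub>)) = E 1" by (rule E_relation_eq) auto
  thus ?thesis using v by (simp add: E_one lm.smult_one)
qed

lemma act_mult_grp:
  assumes "g \<in> carrier G" "h \<in> carrier G" "v \<in> carrier N"
  shows "E (lt (Grp (g \<otimes>\<^bsub>G\<^esub> h))) \<odot>\<^bsub>N\<^esub> v = E (lt (Grp g)) \<odot>\<^bsub>N\<^esub> (E (lt (Grp h)) \<odot>\<^bsub>N\<^esub> v)"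
proof -
  have "lt (Grp (g \<otimes>\<^bsub>G\<^esub> h)) - lt (Grp g) * lt (Grp h) \<in> smash_relations G V \<union> cherednik_relations G V t c"
    unfolding smash_relations_def Let_def using assms by blast
  hence "E (lt (Grp (g \<otimes>\<^bsub>G\<^esub> h))) = E (lt (Grp g) * lt (Grp h))"
    by (rule E_relation_eq) (use assms in \<open>auto intro!: free_algebra_closed(3)\<close>)
  thus ?thesis using assms by (simp add: act_mult)
qed

lemma subspace_is_rep:
  assumes sub: "U \<subseteq> carrier N" and "\<zero>\<^bsub>N\<^esub> \<in> U"
    and "\<And>u v. u \<in> U \<Longrightarrow> v \<in> U \<Longrightarrow> u \<oplus>\<^bsub>N\<^esub> v \<in> U"
    and "\<And>a v. v \<in> U \<Longrightarrow> E (sc a) \<odot>\<^bsub>N\<^esub> v \<in> U"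
    and "\<And>g v. g \<in> carrier G \<Longrightarrow> v \<in> U \<Longrightarrow> E (lt (Grp g)) \<odot>\<^bsub>N\<^esub> v \<in> U"
  shows "is_rep G (subspace_rep U)"
proof (rule is_repI)
  have in_N: "v \<in> carrier N" if "v \<in> U" for v using sub that by blast
  show "vectorspace class_ring (subspace_rep U)"
    by (rule scalar_vectorspace) (use assms in \<open>auto simp: subspace_rep_def\<close>)
  fix g v assume "g \<in> carrier G" "v \<in> carrier (subspace_rep U)"
  thus "act (subspace_rep U) g (a \<odot>\<^bsub>subspace_rep U\<^esub> v) = a \<odot>\<^bsub>subspace_rep U\<^esub> act (subspace_rep U) g v" for a
    using in_N by (simp add: act_scalar_central)
qed (use assms sub in \<open>auto simp: act_one_grp act_mult_grp lm.smult_r_distr subset_iff\<close>)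

text \<open>The value that the relations prescribe for \<open>[y, x]\<close>.\<close>

definition commutator :: "'v \<Rightarrow> ('v \<Rightarrow> 'k) \<Rightarrow> ('g, 'k, 'v) word_alg" where
  "commutator y x = sc (t * x y) - (\<Sum>s\<in>reflections G V. sc (c s * (x y - act D s x y)) * lt (Grp s))"

lemma commutator_closed: "commutator y x \<in> carrier F"
  unfolding commutator_def
  by (intro free_algebra_closed free_algebra_sum) (use reflections_subset in auto)

lemma act_vec_cov:
  assumes "y \<in> carrier V" "x \<in> carrier D" "v \<in> carrier N"
  shows "E (lt (Vec y)) \<odot>\<^bsub>N\<^esub> (E (lt (Cov x)) \<odot>\<^bsub>N\<^esub> v) =
    E (lt (Cov x)) \<odot>\<^bsub>N\<^esub> (E (lt (Vec y)) \<odot>\<^bsub>N\<^esub> v) \<oplus>\<^bsub>N\<^esub> E (commutator y x) \<odot>\<^bsub>N\<^esub> v"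
proof -
  have closed: "lt (Vec y) \<in> carrier F" "lt (Cov x) \<in> carrier F"
    using assms by (auto)
  have "E (lt (Vec y) * lt (Cov x)) = E (lt (Cov x) * lt (Vec y) + commutator y x)"
  proof (rule E_relation_eq)
    have "lt (Vec y) * lt (Cov x) - (lt (Cov x) * lt (Vec y) + commutator y x) =
      lt (Vec y) * lt (Cov x) - lt (Cov x) * lt (Vec y) - commutator y x" by simp
    also have "\<dots> \<in> cherednik_relations G V t c"
      unfolding cherednik_relations_def Let_def commutator_def using assms by blast
    finally show "lt (Vec y) * lt (Cov x) - (lt (Cov x) * lt (Vec y) + commutator y x)
      \<in> smash_relations G V \<union> cherednik_relations G V t c" by blast
  qed (intro free_algebra_closed commutator_closed closed)+
  thus ?thesis
    using assms closed commutator_closed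
    by (simp add: act_mult act_add free_algebra_closed flip: act_mult)
qed

end

text \<open>A representation of \<open>G\<close> inside a module on which \<open>\<hh>\<close> acts by zero. The degrees
  below count the factors from \<open>\<hh>\<^sup>*\<close>; they are integers so that elements of \<open>\<hh>\<close> can lower them
  past zero.\<close>

locale lowest_weight_space = cherednik_module G V t c N
  for G :: "'g monoid" and V :: "('g, 'k::field, 'v) rep" and t :: 'k and c :: "'g \<Rightarrow> 'k"
    and N :: "(('g, 'k, 'v) cher, 'm) gmodule" +
  fixes W
  assumes W_sub: "W \<subseteq> carrier N"
    and W_zero: "\<zero>\<^bsub>N\<^esub> \<in> W"
    and W_add: "\<And>u v. u \<in> W \<Longrightarrow> v \<in> W \<Longrightarrow> u \<oplus>\<^bsub>N\<^esub> v \<in> W"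
    and W_sc: "\<And>a w. w \<in> W \<Longrightarrow> E (sc a) \<odot>\<^bsub>N\<^esub> w \<in> W"
    and W_grp: "\<And>g w. g \<in> carrier G \<Longrightarrow> w \<in> W \<Longrightarrow> E (lt (Grp g)) \<odot>\<^bsub>N\<^esub> w \<in> W"
    and W_vec: "\<And>y w. y \<in> carrier V \<Longrightarrow> w \<in> W \<Longrightarrow> E (lt (Vec y)) \<odot>\<^bsub>N\<^esub> w = \<zero>\<^bsub>N\<^esub>"
begin

text \<open>The image of \<open>S\<^sup>k \<hh>\<^sup>* \<otimes> W\<close>. It is zero for \<open>k < 0\<close>.\<close>

inductive cov_span :: "int \<Rightarrow> 'm \<Rightarrow> bool" where
  base: "w \<in> W \<Longrightarrow> cov_span 0 w"
| zero: "cov_span k \<zero>\<^bsub>N\<^esub>"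
| add: "cov_span k u \<Longrightarrow> cov_span k v \<Longrightarrow> cov_span k (u \<oplus>\<^bsub>N\<^esub> v)"
| cov: "cov_span k u \<Longrightarrow> x \<in> carrier D \<Longrightarrow> cov_span (k + 1) (E (lt (Cov x)) \<odot>\<^bsub>N\<^esub> u)"

lemma cov_span_closed: "cov_span k u \<Longrightarrow> u \<in> carrier N"
  by (induction rule: cov_span.induct) (use W_sub in \<open>auto\<close>)

lemma cov_span_negative: "cov_span k u \<Longrightarrow> k < 0 \<Longrightarrow> u = \<zero>\<^bsub>N\<^esub>"
  by (induction rule: cov_span.induct) (auto)

text \<open>The rule for \<open>\<hh>\<^sup>*\<close> reaches degree zero only from degree \<open>-1\<close>, where there is nothing but zero.\<close>

lemma cov_span_degree_zero: "cov_span k u \<Longrightarrow> k = 0 \<Longrightarrow> u \<in> W"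
proof (induction rule: cov_span.induct)
  case (cov k u x)
  hence "u = \<zero>\<^bsub>N\<^esub>" using cov_span_negative by simp
  thus ?case using cov W_zero by (simp)
qed (use W_zero W_add in auto)

lemma cov_span_scalar: "cov_span k u \<Longrightarrow> cov_span k (E (sc a) \<odot>\<^bsub>N\<^esub> u)"
proof (induction rule: cov_span.induct)
  case (add k u v)
  thus ?case using cov_span_closed by (simp add: lm.smult_r_distr cov_span.add)
next
  case (cov k u x)
  thus ?case using cov_span_closed by (simp add: act_scalar_commute cov_span.cov)
qed (auto intro: cov_span.intros W_sc)

lemma cov_span_grp:
  assumes g: "g \<in> carrier G"
  shows "cov_span k u \<Longrightarrow> cov_span k (E (lt (Grp g)) \<odot>\<^bsub>N\<^esub> u)"
proof (induction rule: cov_span.induct)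
  case (add k u v)
  thus ?case using cov_span_closed g by (simp add: lm.smult_r_distr cov_span.add)
next
  case (cov k u x)
  thus ?case using cov_span_closed g D_closed(3)[OF g]
    by (simp add: act_grp_cov cov_span.cov)
qed (use g in \<open>auto intro: cov_span.intros W_grp\<close>)

text \<open>The commutator of \<open>y\<close> and \<open>x\<close> is a combination of group elements, all of which preserve the degree.\<close>

lemma cov_span_commutator:
  assumes "cov_span k u"
  shows "cov_span k (E (commutator y x) \<odot>\<^bsub>N\<^esub> u)"
proof -
  have u: "u \<in> carrier N" using assms cov_span_closed by blast
  let ?K = "{f \<in> carrier F. cov_span k (E f \<odot>\<^bsub>N\<^esub> u)}"
  have add: "f + g \<in> ?K" if "f \<in> ?K" "g \<in> ?K" for f g
    using that u by (auto simp: act_add intro: cov_span.add)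
  have minus: "f - g \<in> ?K" if f: "f \<in> ?K" and g: "g \<in> ?K" for f g
  proof -
    have gF: "g \<in> carrier F" using g by simp
    have eq: "f - g = f + sc (-1) * g" by (simp add: sc_simps(4) sc_one)
    have "sc (-1) * g \<in> ?K"
      using g u gF cov_span_scalar[of k "E g \<odot>\<^bsub>N\<^esub> u" "-1"] by (auto simp: act_mult)
    thus ?thesis unfolding eq by (rule add[OF f])
  qed
  have zero: "0 \<in> ?K" using u by (simp add: E_zero cov_span.zero)
  have refl: "sc a * lt (Grp s) \<in> ?K" if "s \<in> reflections G V" for a s
  proof -
    have "s \<in> carrier G" using that reflections_subset by blast
    thus ?thesis using u cov_span_scalar[OF cov_span_grp[OF _ assms]]
      by (auto simp: act_mult)
  qed
  have "(\<Sum>s\<in>A. sc (b s) * lt (Grp s)) \<in> ?K" if "A \<subseteq> reflections G V" for A b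
    using that
    by (induction A rule: infinite_finite_induct)
      (use zero add refl in \<open>auto simp del: mem_Collect_eq\<close>)
  moreover have "sc a \<in> ?K" for a using cov_span_scalar[OF assms] by simp
  ultimately have "commutator y x \<in> ?K" unfolding commutator_def by (intro minus) auto
  thus ?thesis by simp
qed

text \<open>The commutation relation moves \<open>y \<in> \<hh>\<close> to the right past all \<open>x \<in> \<hh>\<^sup>*\<close>, where it kills \<open>W\<close>.\<close>

lemma cov_span_vec:
  assumes y: "y \<in> carrier V"
  shows "cov_span k u \<Longrightarrow> cov_span (k - 1) (E (lt (Vec y)) \<odot>\<^bsub>N\<^esub> u)"
proof (induction rule: cov_span.induct)
  case (base w)
  thus ?case using y W_vec by (simp add: cov_span.zero)
next
  case (add k u v)
  thus ?case using cov_span_closed y by (simp add: lm.smult_r_distr cov_span.add)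
next
  case (cov k u x)
  from cov_span.cov[OF cov.IH cov.hyps(2)]
  have "cov_span k (E (lt (Cov x)) \<odot>\<^bsub>N\<^esub> (E (lt (Vec y)) \<odot>\<^bsub>N\<^esub> u))" by simp
  thus ?case using cov cov_span_closed y cov_span_commutator[OF cov.hyps(1)]
    by (simp add: act_vec_cov cov_span.add)
qed (use y in \<open>auto intro: cov_span.intros\<close>)

text \<open>A word acts letter by letter: \<open>x\<close> raises the degree, \<open>g\<close> preserves it and \<open>y\<close> lowers it.\<close>

lemma cov_span_smult:
  assumes "r \<in> cher_grade G V t c i" "cov_span k u"
  shows "cov_span (i + k) (r \<odot>\<^bsub>N\<^esub> u)"
proof -
  have u: "u \<in> carrier N" using assms(2) cov_span_closed by blast
  have letter: "cov_span (letter_deg z + k) (E (lt z) \<odot>\<^bsub>N\<^esub> u)"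
    if "z \<in> letters G V" "cov_span k u" for z k u
  proof (cases z)
    case (Cov x)
    then show ?thesis using cov_span.cov[OF that(2), of x] that by (simp add: add.commute)
  qed (use that cov_span_grp cov_span_vec in auto)
  have word: "cov_span (word_deg w + k) (E (Poly_Mapping.single w a) \<odot>\<^bsub>N\<^esub> u)"
    if "set w \<subseteq> letters G V" for w a
    using that
  proof (induction w)
    case Nil
    then show ?case using cov_span_scalar[OF assms(2)] by (simp add: word_deg_def)
  next
    case (Cons z w)
    hence "cov_span (letter_deg z + (word_deg w + k))
        (E (lt z) \<odot>\<^bsub>N\<^esub> (E (Poly_Mapping.single w a) \<odot>\<^bsub>N\<^esub> u))"
      by (intro letter) auto
    thus ?case using Cons.prems u
      by (subst single_Cons, subst act_mult) (auto simp: word_deg_def add.assoc)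
  qed
  from assms(1) show ?thesis
  proof (induction rule: grade_induct)
    case zero
    show ?case using u by (simp add: cov_span.zero)
  next
    case (single w a)
    then show ?case using word by blast
  next
    case (add r s)
    then show ?case using u by (simp add: lm.smult_l_distr cov_span.add)
  qed
qed

end

section \<open>Verma modules\<close>

locale verma_setting = cherednik_algebra G V t c
  for G :: "'g monoid" and V :: "('g, 'k::field, 'v) rep" and t :: 'k and c :: "'g \<Rightarrow> 'k" +
  fixes W :: "('g, 'k, 'w) rep"
  assumes W_rep: "is_rep G W"
begin

abbreviation "P \<equiv> pairs G V t c W"
abbreviation "T \<equiv> tensor_relations G V t c W"
abbreviation "M \<equiv> verma G V t c W"
abbreviation "pt \<equiv> pure_tensor G V t c W"
abbreviation "X \<equiv> kGSh_action G V t c W"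

lemma W_vs: "vectorspace class_ring W" using is_repD(1)[OF W_rep] .

lemma W_closed [simp]:
  "u \<in> carrier W \<Longrightarrow> v \<in> carrier W \<Longrightarrow> u \<oplus>\<^bsub>W\<^esub> v \<in> carrier W"
  "v \<in> carrier W \<Longrightarrow> a \<odot>\<^bsub>W\<^esub> v \<in> carrier W"
  "g \<in> carrier G \<Longrightarrow> v \<in> carrier W \<Longrightarrow> act W g v \<in> carrier W"
  "\<zero>\<^bsub>W\<^esub> \<in> carrier W"
  using vectorspace_closed[OF W_vs] is_repD(2)[OF W_rep] by blast+

lemma X_closed: "(b, w, u) \<in> X \<Longrightarrow> b \<in> carrier H \<and> w \<in> carrier W \<and> u \<in> carrier W"
proof (induction rule: kGSh_action.induct)
  case (sum b w u b' u')
  thus ?case using ring.ring_simprules(1)[OF ring_H] by simp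
next
  case (prod b w u b' u')
  thus ?case using ring.ring_simprules(5)[OF ring_H] by simp
qed auto

lemma P_simps [simp]:
  "f \<in> carrier P \<longleftrightarrow> Poly_Mapping.keys f \<subseteq> carrier H \<times> carrier W"
  "\<zero>\<^bsub>P\<^esub> = 0" "f \<oplus>\<^bsub>P\<^esub> g = f + g"
  by (simp_all add: pairs_def Let_def)

lemma P_frag [simp]: "frag_of (r, w) \<in> carrier P \<longleftrightarrow> r \<in> carrier H \<and> w \<in> carrier W"
  by simp

lemma P_add: "f \<in> carrier P \<Longrightarrow> g \<in> carrier P \<Longrightarrow> f + g \<in> carrier P"
  using Poly_Mapping.keys_add[of f g] by auto

lemma P_diff: "f \<in> carrier P \<Longrightarrow> g \<in> carrier P \<Longrightarrow> f - g \<in> carrier P"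
  using keys_diff[of f g] by auto

lemma P_uminus: "f \<in> carrier P \<Longrightarrow> - f \<in> carrier P"
  by simp

lemma P_zero: "0 \<in> carrier P"
  by simp

lemma P_abelian_group: "abelian_group P"
  by (rule abelian_groupI)
    (use P_add in \<open>auto simp: add.assoc add.commute simp del: P_simps(1) intro!: bexI[of _ "- _"] P_uminus P_zero\<close>)

lemma P_a_inv: "f \<in> carrier P \<Longrightarrow> \<ominus>\<^bsub>P\<^esub> f = - f"
proof -
  interpret abelian_group P by (rule P_abelian_group)
  assume "f \<in> carrier P"
  thus ?thesis using minus_equality[of "- f" f] P_uminus[of f] by (simp del: P_simps(1))
qed

lemma P_a_minus: "f \<in> carrier P \<Longrightarrow> g \<in> carrier P \<Longrightarrow> f \<ominus>\<^bsub>P\<^esub> g = f - g"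
  by (simp add: a_minus_def P_a_inv del: P_simps(1))

definition tensor_gens :: "(('g, 'k, 'v) cher \<times> 'w \<Rightarrow>\<^sub>0 int) set" where
  "tensor_gens =
     {frag_of (r \<oplus>\<^bsub>H\<^esub> r', w) - frag_of (r, w) - frag_of (r', w) | r r' w.
        r \<in> carrier H \<and> r' \<in> carrier H \<and> w \<in> carrier W} \<union>
     {frag_of (r, w \<oplus>\<^bsub>W\<^esub> w') - frag_of (r, w) - frag_of (r, w') | r w w'.
        r \<in> carrier H \<and> w \<in> carrier W \<and> w' \<in> carrier W} \<union>
     {frag_of (r \<otimes>\<^bsub>H\<^esub> b, w) - frag_of (r, u) | r b w u. r \<in> carrier H \<and> (b, w, u) \<in> X}"

lemma T_eq: "T = generate (add_monoid P) tensor_gens"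
  by (simp add: tensor_relations_def tensor_gens_def Let_def)

lemma tensor_gens_cases [consumes 1, case_names add_l add_r balance]:
  assumes "x \<in> tensor_gens"
  obtains r r' w where "r \<in> carrier H" "r' \<in> carrier H" "w \<in> carrier W"
      "x = frag_of (r \<oplus>\<^bsub>H\<^esub> r', w) - frag_of (r, w) - frag_of (r', w)"
  | r w w' where "r \<in> carrier H" "w \<in> carrier W" "w' \<in> carrier W"
      "x = frag_of (r, w \<oplus>\<^bsub>W\<^esub> w') - frag_of (r, w) - frag_of (r, w')"
  | r b w u where "r \<in> carrier H" "(b, w, u) \<in> X" "x = frag_of (r \<otimes>\<^bsub>H\<^esub> b, w) - frag_of (r, u)"
  using assms unfolding tensor_gens_def by blast

lemma tensor_gensI:
  "r \<in> carrier H \<Longrightarrow> r' \<in> carrier H \<Longrightarrow> w \<in> carrier W \<Longrightarrow>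
    frag_of (r \<oplus>\<^bsub>H\<^esub> r', w) - frag_of (r, w) - frag_of (r', w) \<in> tensor_gens"
  "r \<in> carrier H \<Longrightarrow> w \<in> carrier W \<Longrightarrow> w' \<in> carrier W \<Longrightarrow>
    frag_of (r, w \<oplus>\<^bsub>W\<^esub> w') - frag_of (r, w) - frag_of (r, w') \<in> tensor_gens"
  "r \<in> carrier H \<Longrightarrow> (b, w, u) \<in> X \<Longrightarrow> frag_of (r \<otimes>\<^bsub>H\<^esub> b, w) - frag_of (r, u) \<in> tensor_gens"
  unfolding tensor_gens_def by blast+

lemma tensor_gens_closed: "tensor_gens \<subseteq> carrier P"
proof
  fix x assume "x \<in> tensor_gens"
  thus "x \<in> carrier P"
    by (cases rule: tensor_gens_cases)
      (auto intro!: P_diff simp: ring.ring_simprules(1,5)[OF ring_H] dest: X_closed simp del: P_simps(1))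
qed

lemma P_group: "group (add_monoid P)"
  using abelian_group.a_group[OF P_abelian_group] .

lemma T_subgroup: "subgroup T (add_monoid P)"
  unfolding T_eq by (rule group.generate_is_subgroup[OF P_group]) (use tensor_gens_closed in simp)

lemma T_closed: "x \<in> T \<Longrightarrow> x \<in> carrier P"
  using subgroup.subset[OF T_subgroup] by (auto simp del: P_simps(1))

text \<open>Differences suffice to generate a subgroup, and the statements proved this way are compatible with
  differences.\<close>

lemma T_induct [consumes 1, case_names zero gen diff]:
  assumes "x \<in> T" and "Q 0" and "\<And>x. x \<in> tensor_gens \<Longrightarrow> Q x"
    and "\<And>x y. x \<in> T \<Longrightarrow> y \<in> T \<Longrightarrow> Q x \<Longrightarrow> Q y \<Longrightarrow> Q (x - y)"
  shows "Q x"
proof -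
  have inT: "x \<in> T" if "x \<in> tensor_gens" for x
    unfolding T_eq using that by (rule generate.incl)
  have T0: "0 \<in> T" using subgroup.one_closed[OF T_subgroup] by simp
  have Tm: "x - y \<in> T" if "x \<in> T" "y \<in> T" for x y
  proof -
    have "x \<oplus>\<^bsub>P\<^esub> (\<ominus>\<^bsub>P\<^esub> y) \<in> T"
      using subgroup.m_closed[OF T_subgroup that(1) subgroup.m_inv_closed[OF T_subgroup that(2)]]
      by (simp add: a_inv_def)
    thus ?thesis using P_a_inv[OF T_closed[OF that(2)]] by simp
  qed
  have "x \<in> generate (add_monoid P) tensor_gens \<Longrightarrow> x \<in> T \<and> Q x" for x
  proof (induction rule: generate.induct)
    case one
    then show ?case using T0 assms(2) by simp
  next
    case (incl h)
    then show ?case using inT assms(3) by simp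
  next
    case (inv h)
    have "inv\<^bsub>add_monoid P\<^esub> h = 0 - h"
      using P_a_inv[of h] inv tensor_gens_closed by (auto simp: a_inv_def simp del: P_simps(1))
    moreover have "Q (0 - h)" using assms(4)[OF T0 inT[OF inv] assms(2) assms(3)[OF inv]] .
    ultimately show ?case using Tm[OF T0 inT[OF inv]] by simp
  next
    case (eng h1 h2)
    hence 1: "h1 \<in> T" "Q h1" "h2 \<in> T" "Q h2" by simp_all
    have "Q (h1 - (0 - h2))" by (intro assms(4) Tm T0 1 assms(2))
    moreover have "h1 - (0 - h2) \<in> T" by (intro Tm T0 1)
    ultimately show ?case by simp
  qed
  thus ?thesis using assms(1) T_eq by blast
qed

lemma P_smult: "r \<odot>\<^bsub>P\<^esub> f = frag_extend (\<lambda>(r', w). frag_of (r \<otimes>\<^bsub>H\<^esub> r', w)) f"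
  by (simp add: pairs_def Let_def)

lemma P_smult_frag: "r \<odot>\<^bsub>P\<^esub> frag_of (r', w) = frag_of (r \<otimes>\<^bsub>H\<^esub> r', w)"
  by (simp add: P_smult)

lemma P_smult_add: "r \<odot>\<^bsub>P\<^esub> (f + g) = r \<odot>\<^bsub>P\<^esub> f + r \<odot>\<^bsub>P\<^esub> g"
  by (simp add: P_smult frag_extend_add)

lemma P_smult_diff: "r \<odot>\<^bsub>P\<^esub> (f - g) = r \<odot>\<^bsub>P\<^esub> f - r \<odot>\<^bsub>P\<^esub> g"
  by (simp add: P_smult frag_extend_diff)

lemma P_smult_closed:
  assumes "r \<in> carrier H" "f \<in> carrier P"
  shows "r \<odot>\<^bsub>P\<^esub> f \<in> carrier P"
proof -
  have "Poly_Mapping.keys f \<subseteq> carrier H \<times> carrier W" using assms(2) by simp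
  thus ?thesis
  proof (induction rule: frag_induction)
    case zero
    then show ?case by (simp add: P_smult)
  next
    case (one x)
    then show ?case using assms(1) ring.ring_simprules(5)[OF ring_H]
      by (cases x) (auto simp: P_smult_frag simp del: P_simps(1))
  next
    case (diff a b)
    then show ?case unfolding P_smult_diff by (rule P_diff)
  qed
qed

lemma P_smult_T:
  assumes r: "r \<in> carrier H" and "x \<in> T"
  shows "r \<odot>\<^bsub>P\<^esub> x \<in> T"
  using assms(2)
proof (induction rule: T_induct)
  case zero
  show ?case using subgroup.one_closed[OF T_subgroup] by (simp add: P_smult)
next
  case (gen x)
  interpret H: ring H by (rule ring_H)
  from gen have "r \<odot>\<^bsub>P\<^esub> x \<in> tensor_gens"
  proof (cases rule: tensor_gens_cases)
    case (add_l r1 r2 w)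
    then show ?thesis using r tensor_gensI(1)[of "r \<otimes>\<^bsub>H\<^esub> r1" "r \<otimes>\<^bsub>H\<^esub> r2" w]
      by (simp add: P_smult_diff P_smult_frag H.r_distr)
  next
    case (add_r r1 w w')
    then show ?thesis using r tensor_gensI(2)[of "r \<otimes>\<^bsub>H\<^esub> r1" w w']
      by (simp add: P_smult_diff P_smult_frag)
  next
    case (balance r1 b w u)
    then show ?thesis using r X_closed[OF balance(2)] tensor_gensI(3)[of "r \<otimes>\<^bsub>H\<^esub> r1" b w u]
      by (simp add: P_smult_diff P_smult_frag H.m_assoc)
  qed
  thus ?case unfolding T_eq by (rule generate.incl)
next
  case (diff x y)
  have "r \<odot>\<^bsub>P\<^esub> x \<oplus>\<^bsub>P\<^esub> (\<ominus>\<^bsub>P\<^esub> (r \<odot>\<^bsub>P\<^esub> y)) \<in> T"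
    using subgroup.m_closed[OF T_subgroup diff.IH(1) subgroup.m_inv_closed[OF T_subgroup diff.IH(2)]]
    by (simp add: a_inv_def)
  thus ?case using P_a_inv[OF T_closed[OF diff.IH(2)]] by (simp add: P_smult_diff)
qed

sublocale quo: module_quotient "carrier H" P T
  by (intro module_quotient.intro P_abelian_group T_subgroup P_smult_closed P_smult_T)
    (simp_all add: P_smult_add)

lemma M_eq: "gquot P T = M" by (simp add: verma_def)

lemma M_surj: "m \<in> carrier M \<Longrightarrow> \<exists>f\<in>carrier P. m = quo.q f"
  using quo.q_surj[unfolded M_eq] .

lemma M_grade: "grade M i = quo.q ` {f. Poly_Mapping.keys f \<subseteq> cher_grade G V t c i \<times> carrier W}"
proof -
  have "grade P i = {f. Poly_Mapping.keys f \<subseteq> cher_grade G V t c i \<times> carrier W}"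
    by (simp add: pairs_def Let_def)
  thus ?thesis using quo.q_grade[of i] by (simp only: M_eq)
qed

lemma pt_eq: "pt r w = quo.q (frag_of (r, w))" by (simp add: pure_tensor_def)

lemma pt_closed [simp]: "r \<in> carrier H \<Longrightarrow> w \<in> carrier W \<Longrightarrow> pt r w \<in> carrier M"
  using quo.q_closed[of "frag_of (r, w)"] by (simp add: pt_eq M_eq)

lemma q_gen:
  assumes "f - g \<in> tensor_gens" "f \<in> carrier P" "g \<in> carrier P"
  shows "quo.q f = quo.q g"
proof -
  have "f - g \<in> T" unfolding T_eq using assms(1) by (rule generate.incl)
  thus ?thesis unfolding quo.q_eq_iff[OF assms(2,3)] P_a_minus[OF assms(2,3)] .
qed

lemma q_plus: "f \<in> carrier P \<Longrightarrow> g \<in> carrier P \<Longrightarrow> quo.q (f + g) = quo.q f \<oplus>\<^bsub>M\<^esub> quo.q g"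
  using quo.q_add[of f g] by (simp add: M_eq del: P_simps(1))

lemma pt_add_l:
  assumes "r \<in> carrier H" "r' \<in> carrier H" "w \<in> carrier W"
  shows "pt (r \<oplus>\<^bsub>H\<^esub> r') w = pt r w \<oplus>\<^bsub>M\<^esub> pt r' w"
proof -
  have "quo.q (frag_of (r \<oplus>\<^bsub>H\<^esub> r', w)) = quo.q (frag_of (r, w) + frag_of (r', w))"
    by (rule q_gen)
      (use assms tensor_gensI(1)[OF assms] ring.ring_simprules(1)[OF ring_H] in
        \<open>auto intro!: P_add simp: diff_diff_eq simp del: P_simps(1)\<close>)
  thus ?thesis using assms by (simp add: pt_eq q_plus)
qed

lemma pt_add_r:
  assumes "r \<in> carrier H" "w \<in> carrier W" "w' \<in> carrier W"
  shows "pt r (w \<oplus>\<^bsub>W\<^esub> w') = pt r w \<oplus>\<^bsub>M\<^esub> pt r w'"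
proof -
  have "quo.q (frag_of (r, w \<oplus>\<^bsub>W\<^esub> w')) = quo.q (frag_of (r, w) + frag_of (r, w'))"
    by (rule q_gen)
      (use assms tensor_gensI(2)[OF assms] in
        \<open>auto intro!: P_add simp: diff_diff_eq simp del: P_simps(1)\<close>)
  thus ?thesis using assms by (simp add: pt_eq q_plus)
qed

lemma pt_balance:
  assumes "r \<in> carrier H" "(b, w, u) \<in> X"
  shows "pt (r \<otimes>\<^bsub>H\<^esub> b) w = pt r u"
  unfolding pt_eq
  by (rule q_gen[OF tensor_gensI(3)[OF assms]])
    (use assms X_closed[OF assms(2)] ring.ring_simprules(5)[OF ring_H] in auto)

lemma pt_smult:
  assumes "s \<in> carrier H" "r \<in> carrier H" "w \<in> carrier W"
  shows "s \<odot>\<^bsub>M\<^esub> pt r w = pt (s \<otimes>\<^bsub>H\<^esub> r) w"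
  using quo.q_smult[OF assms(1), of "frag_of (r, w)"] assms
  by (simp add: pt_eq M_eq P_smult_frag)

lemma M_abelian_group: "abelian_group M"
  using quo.Q_abelian_group by (simp add: M_eq)

lemma M_smult_closed: "r \<in> carrier H \<Longrightarrow> m \<in> carrier M \<Longrightarrow> r \<odot>\<^bsub>M\<^esub> m \<in> carrier M"
  using quo.q_surj[of m] quo.q_smult quo.q_closed P_smult_closed
  by (auto simp: M_eq simp del: P_simps(1))

lemma M_smult_add:
  "r \<in> carrier H \<Longrightarrow> m \<in> carrier M \<Longrightarrow> n \<in> carrier M \<Longrightarrow>
    r \<odot>\<^bsub>M\<^esub> (m \<oplus>\<^bsub>M\<^esub> n) = r \<odot>\<^bsub>M\<^esub> m \<oplus>\<^bsub>M\<^esub> r \<odot>\<^bsub>M\<^esub> n"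
  using quo.q_surj[of m] quo.q_surj[of n]
  by (auto simp: M_eq quo.q_smult[unfolded M_eq] P_smult_add P_smult_closed P_add simp del: P_simps(1)
      simp flip: q_plus)

lemma pt_zero_l: "w \<in> carrier W \<Longrightarrow> pt \<zero>\<^bsub>H\<^esub> w = \<zero>\<^bsub>M\<^esub>"
proof -
  interpret H: ring H by (rule ring_H)
  interpret M: abelian_group M by (rule M_abelian_group)
  assume w: "w \<in> carrier W"
  have "pt \<zero>\<^bsub>H\<^esub> w \<oplus>\<^bsub>M\<^esub> pt \<zero>\<^bsub>H\<^esub> w = pt \<zero>\<^bsub>H\<^esub> w"
    using pt_add_l[of "\<zero>\<^bsub>H\<^esub>" "\<zero>\<^bsub>H\<^esub>" w] w by simp
  thus ?thesis using pt_closed[of "\<zero>\<^bsub>H\<^esub>" w] w M.add.l_cancel_one by simp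
qed

lemma pt_zero_r: "r \<in> carrier H \<Longrightarrow> pt r \<zero>\<^bsub>W\<^esub> = \<zero>\<^bsub>M\<^esub>"
proof -
  interpret M: abelian_group M by (rule M_abelian_group)
  interpret W: vectorspace class_ring W by (rule W_vs)
  assume r: "r \<in> carrier H"
  have "pt r \<zero>\<^bsub>W\<^esub> \<oplus>\<^bsub>M\<^esub> pt r \<zero>\<^bsub>W\<^esub> = pt r \<zero>\<^bsub>W\<^esub>"
    using pt_add_r[OF r, of "\<zero>\<^bsub>W\<^esub>" "\<zero>\<^bsub>W\<^esub>"] by simp
  thus ?thesis using pt_closed[OF r, of "\<zero>\<^bsub>W\<^esub>"] M.add.l_cancel_one by simp
qed

lemma pt_minus_l: "r \<in> carrier H \<Longrightarrow> w \<in> carrier W \<Longrightarrow> pt (\<ominus>\<^bsub>H\<^esub> r) w = \<ominus>\<^bsub>M\<^esub> pt r w"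
proof -
  interpret H: ring H by (rule ring_H)
  interpret M: abelian_group M by (rule M_abelian_group)
  assume *: "r \<in> carrier H" "w \<in> carrier W"
  have "pt (\<ominus>\<^bsub>H\<^esub> r) w \<oplus>\<^bsub>M\<^esub> pt r w = \<zero>\<^bsub>M\<^esub>"
    using pt_add_l[of "\<ominus>\<^bsub>H\<^esub> r" r w] * pt_zero_l by (simp add: H.l_neg)
  thus ?thesis using M.minus_equality * by simp
qed

text \<open>The set \<open>C\<close> is the whole algebra or one graded piece of it. A negative multiple of a pair is
  avoided by moving the sign into the algebra element.\<close>

lemma q_induct:
  assumes "C \<subseteq> carrier H" "\<zero>\<^bsub>H\<^esub> \<in> C" "\<And>r. r \<in> C \<Longrightarrow> \<ominus>\<^bsub>H\<^esub> r \<in> C"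
    and "Poly_Mapping.keys f \<subseteq> C \<times> carrier W"
    and pure: "\<And>r w. r \<in> C \<Longrightarrow> w \<in> carrier W \<Longrightarrow> Q (pt r w)"
    and add: "\<And>m n. m \<in> carrier M \<Longrightarrow> n \<in> carrier M \<Longrightarrow> Q m \<Longrightarrow> Q n \<Longrightarrow> Q (m \<oplus>\<^bsub>M\<^esub> n)"
  shows "Q (quo.q f)"
proof -
  interpret M: abelian_group M by (rule M_abelian_group)
  have q0: "quo.q 0 = pt \<zero>\<^bsub>H\<^esub> \<zero>\<^bsub>W\<^esub>"
    using quo.q_zero pt_zero_l[of "\<zero>\<^bsub>W\<^esub>"] by (simp add: M_eq)
  have qm: "quo.q (- f) = \<ominus>\<^bsub>M\<^esub> quo.q f" if "f \<in> carrier P" for f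
  proof -
    have "quo.q (- f) \<oplus>\<^bsub>M\<^esub> quo.q f = \<zero>\<^bsub>M\<^esub>"
      using q_plus[of "- f" f] that P_uminus quo.q_zero by (simp add: M_eq)
    thus ?thesis using M.minus_equality quo.q_closed that P_uminus by (simp add: M_eq)
  qed
  from assms(4) have "f \<in> carrier P \<and> Q (quo.q f) \<and> Q (quo.q (- f))"
  proof (induction rule: frag_induction)
    case zero
    then show ?case using pure[OF assms(2), of "\<zero>\<^bsub>W\<^esub>"] by (simp add: q0)
  next
    case (one x)
    then obtain r w where x: "x = (r, w)" "r \<in> C" "w \<in> carrier W" by auto
    have r: "r \<in> carrier H" using x assms(1) by blast
    have "quo.q (- frag_of (r, w)) = pt (\<ominus>\<^bsub>H\<^esub> r) w"
      using qm[of "frag_of (r, w)"] r x by (simp add: pt_minus_l flip: pt_eq)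
    thus ?case using x r pure assms(3) by (simp flip: pt_eq)
  next
    case (diff a b)
    hence a: "a \<in> carrier P" "Q (quo.q a)" "Q (quo.q (- a))"
      and b: "b \<in> carrier P" "Q (quo.q b)" "Q (quo.q (- b))" by blast+
    have 1: "quo.q (a - b) = quo.q a \<oplus>\<^bsub>M\<^esub> quo.q (- b)"
      using q_plus[OF a(1) P_uminus[OF b(1)]] by simp
    have 2: "quo.q (- (a - b)) = quo.q b \<oplus>\<^bsub>M\<^esub> quo.q (- a)"
      using q_plus[OF b(1) P_uminus[OF a(1)]] by simp
    have cl: "quo.q f \<in> carrier M" if "f \<in> carrier P" for f
      using quo.q_closed[OF that] by (simp add: M_eq)
    show ?case unfolding 1 2
      by (intro conjI add P_diff cl P_uminus a b)
  qed
  thus ?thesis by blast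
qed

lemma verma_induct [consumes 1, case_names pure add]:
  assumes "m \<in> carrier M"
    and pure: "\<And>i r w. r \<in> cher_grade G V t c i \<Longrightarrow> w \<in> carrier W \<Longrightarrow> Q (pt r w)"
    and add: "\<And>m n. m \<in> carrier M \<Longrightarrow> n \<in> carrier M \<Longrightarrow> Q m \<Longrightarrow> Q n \<Longrightarrow> Q (m \<oplus>\<^bsub>M\<^esub> n)"
  shows "Q m"
proof -
  interpret H: ring H by (rule ring_H)
  obtain f where f: "f \<in> carrier P" "m = quo.q f" using M_surj[OF assms(1)] by blast
  have "Q (quo.q f)"
  proof (rule q_induct[of "carrier H"])
    show "Q (pt r w)" if "r \<in> carrier H" "w \<in> carrier W" for r w
      using that(1)
    proof (induction rule: homogeneous_induct)
      case (homogeneous i r)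
      then show ?case using pure that(2) by blast
    next
      case (add r s)
      then show ?case using that(2) by (simp add: pt_add_l assms(3))
    qed
  qed (use f add in auto)
  thus ?thesis using f by simp
qed

lemma verma_grade_induct [consumes 1, case_names pure add]:
  assumes "m \<in> grade M i"
    and pure: "\<And>r w. r \<in> cher_grade G V t c i \<Longrightarrow> w \<in> carrier W \<Longrightarrow> Q (pt r w)"
    and add: "\<And>m n. m \<in> carrier M \<Longrightarrow> n \<in> carrier M \<Longrightarrow> Q m \<Longrightarrow> Q n \<Longrightarrow> Q (m \<oplus>\<^bsub>M\<^esub> n)"
  shows "Q m"
proof -
  obtain f where f: "Poly_Mapping.keys f \<subseteq> cher_grade G V t c i \<times> carrier W" "m = quo.q f"
    using assms(1) unfolding M_grade by blast
  have "Q (quo.q f)"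
  proof (rule q_induct[of "cher_grade G V t c i"])
    show "cher_grade G V t c i \<subseteq> carrier H" using grade_carrier by blast
    show "\<zero>\<^bsub>H\<^esub> \<in> cher_grade G V t c i"
      unfolding cher_grade_def E_zero[symmetric] by (intro imageI) auto
    show "\<ominus>\<^bsub>H\<^esub> r \<in> cher_grade G V t c i" if r: "r \<in> cher_grade G V t c i" for r
    proof -
      obtain f where f: "f \<in> carrier F" "r = E f" "\<forall>w\<in>Poly_Mapping.keys f. sum_list (map letter_deg w) = i"
        using r by (auto simp: cher_grade_def)
      have "\<ominus>\<^bsub>H\<^esub> r = E (- f)" using f E_uminus by simp
      thus ?thesis using f free_algebra_closed(4)[OF f(1,1)]
        unfolding cher_grade_def by (intro image_eqI[of _ _ "- f"]) auto
    qed
  qed (use f pure add in auto)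
  thus ?thesis using f by simp
qed

lemma pt_grade:
  "r \<in> cher_grade G V t c i \<Longrightarrow> w \<in> carrier W \<Longrightarrow> pt r w \<in> grade M i"
  unfolding M_grade pt_eq by (intro imageI) simp

lemma grade_M_closed: "m \<in> grade M i \<Longrightarrow> m \<in> carrier M"
proof (induction rule: verma_grade_induct)
  case (pure r w)
  then show ?case using grade_carrier by simp
next
  case (add m n)
  then show ?case using abelian_groupE(1)[OF M_abelian_group] by blast
qed

lemma M_left_module: "left_module H M"
proof -
  interpret H: ring H by (rule ring_H)
  interpret M: abelian_group M by (rule M_abelian_group)
  have ldistr: "(r \<oplus>\<^bsub>H\<^esub> s) \<odot>\<^bsub>M\<^esub> m = r \<odot>\<^bsub>M\<^esub> m \<oplus>\<^bsub>M\<^esub> s \<odot>\<^bsub>M\<^esub> m"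
    if rs: "r \<in> carrier H" "s \<in> carrier H" and "m \<in> carrier M" for r s m
    using that(3)
  proof (induction rule: verma_induct)
    case (pure i x w)
    have "x \<in> carrier H" using pure grade_carrier by blast
    thus ?case using rs pure by (simp add: pt_smult H.l_distr pt_add_l)
  next
    case (add m n)
    thus ?case using rs by (simp add: M_smult_add M_smult_closed M.a_ac)
  qed
  have assoc: "(r \<otimes>\<^bsub>H\<^esub> s) \<odot>\<^bsub>M\<^esub> m = r \<odot>\<^bsub>M\<^esub> (s \<odot>\<^bsub>M\<^esub> m)"
    if rs: "r \<in> carrier H" "s \<in> carrier H" and "m \<in> carrier M" for r s m
    using that(3)
  proof (induction rule: verma_induct)
    case (pure i x w)
    have "x \<in> carrier H" using pure grade_carrier by blast
    thus ?case using rs pure by (simp add: pt_smult H.m_assoc)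
  next
    case (add m n)
    thus ?case using rs by (simp add: M_smult_add M_smult_closed)
  qed
  have one: "\<one>\<^bsub>H\<^esub> \<odot>\<^bsub>M\<^esub> m = m" if "m \<in> carrier M" for m
    using that
  proof (induction rule: verma_induct)
    case (pure i x w)
    have "x \<in> carrier H" using pure grade_carrier by blast
    thus ?case using pure by (simp add: pt_smult)
  next
    case (add m n)
    thus ?case by (simp add: M_smult_add)
  qed
  show ?thesis
    by (rule left_module.intro[OF ring_H M_abelian_group left_module_axioms.intro])
      (simp_all add: ldistr assoc one M_smult_add M_smult_closed)
qed

sublocale vm: cherednik_module G V t c M
  by (rule cherednik_module.intro[OF cherednik_algebra_axioms cherednik_module_axioms.intro[OF M_left_module]])

lemma verma_grade_zero_in: "\<zero>\<^bsub>M\<^esub> \<in> grade M i"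
  unfolding M_grade using quo.q_zero by (intro image_eqI[of _ _ 0]) (auto simp: M_eq)

lemma verma_grade_add:
  assumes "m \<in> grade M i" "n \<in> grade M i"
  shows "m \<oplus>\<^bsub>M\<^esub> n \<in> grade M i"
proof -
  obtain f g where fg: "Poly_Mapping.keys f \<subseteq> cher_grade G V t c i \<times> carrier W" "m = quo.q f"
    "Poly_Mapping.keys g \<subseteq> cher_grade G V t c i \<times> carrier W" "n = quo.q g"
    using assms unfolding M_grade by blast
  have "f \<in> carrier P" "g \<in> carrier P" using fg grade_carrier by fastforce+
  hence "m \<oplus>\<^bsub>M\<^esub> n = quo.q (f + g)" using q_plus fg by simp
  moreover have "Poly_Mapping.keys (f + g) \<subseteq> cher_grade G V t c i \<times> carrier W"
    using Poly_Mapping.keys_add[of f g] fg by blast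
  ultimately show ?thesis unfolding M_grade by blast
qed

lemma verma_grade_smult:
  assumes "r \<in> cher_grade G V t c j" "m \<in> grade M i"
  shows "r \<odot>\<^bsub>M\<^esub> m \<in> grade M (j + i)"
  using assms(2)
proof (induction rule: verma_grade_induct)
  case (pure s w)
  then show ?case using grade_carrier assms(1) grade_mult by (simp add: pt_smult pt_grade)
next
  case (add m n)
  then show ?case using grade_carrier[OF assms(1)] by (simp add: M_smult_add verma_grade_add)
qed

text \<open>An additive map on the free abelian group of pairs factors through the tensor product if it kills
  the generators of the tensor relations. The target is only an abelian group, so that the lemma
  provides both maps to modules and pairings with values in the field.\<close>

lemma verma_universal:
  assumes A: "abelian_group A"
    and closed: "\<And>r w. r \<in> carrier H \<Longrightarrow> w \<in> carrier W \<Longrightarrow> \<beta> r w \<in> carrier A"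
    and add_l: "\<And>r r' w. r \<in> carrier H \<Longrightarrow> r' \<in> carrier H \<Longrightarrow> w \<in> carrier W \<Longrightarrow>
      \<beta> (r \<oplus>\<^bsub>H\<^esub> r') w = \<beta> r w \<oplus>\<^bsub>A\<^esub> \<beta> r' w"
    and add_r: "\<And>r w w'. r \<in> carrier H \<Longrightarrow> w \<in> carrier W \<Longrightarrow> w' \<in> carrier W \<Longrightarrow>
      \<beta> r (w \<oplus>\<^bsub>W\<^esub> w') = \<beta> r w \<oplus>\<^bsub>A\<^esub> \<beta> r w'"
    and balance: "\<And>r b w u. r \<in> carrier H \<Longrightarrow> (b, w, u) \<in> X \<Longrightarrow> \<beta> (r \<otimes>\<^bsub>H\<^esub> b) w = \<beta> r u"
  obtains \<pi> where "\<And>m. m \<in> carrier M \<Longrightarrow> \<pi> m \<in> carrier A"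
    "\<And>m n. m \<in> carrier M \<Longrightarrow> n \<in> carrier M \<Longrightarrow> \<pi> (m \<oplus>\<^bsub>M\<^esub> n) = \<pi> m \<oplus>\<^bsub>A\<^esub> \<pi> n"
    "\<And>r w. r \<in> carrier H \<Longrightarrow> w \<in> carrier W \<Longrightarrow> \<pi> (pt r w) = \<beta> r w"
proof -
  interpret A: abelian_group A by (rule A)
  let ?S = "carrier H \<times> carrier W"
  have img: "(\<lambda>(r, w). \<beta> r w) ` ?S \<subseteq> carrier (add_monoid A)" using closed by auto
  obtain h where h: "h \<in> hom (free_Abelian_group ?S) (add_monoid A)"
    and h_frag: "\<And>x. x \<in> ?S \<Longrightarrow> h (frag_of x) = (\<lambda>(r, w). \<beta> r w) x"
    using comm_group.free_Abelian_group_universal[OF A.a_comm_group img] by blast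
  have h_closed: "h f \<in> carrier A" if "f \<in> carrier P" for f
    using h that by (auto simp: hom_def)
  have h_add: "h (f + g) = h f \<oplus>\<^bsub>A\<^esub> h g" if "f \<in> carrier P" "g \<in> carrier P" for f g
    using h that by (auto simp: hom_def)
  have h_diff: "h (f - g) = h f \<ominus>\<^bsub>A\<^esub> h g" if fg: "f \<in> carrier P" "g \<in> carrier P" for f g
  proof -
    have "h f = h (f - g) \<oplus>\<^bsub>A\<^esub> h g" using h_add[OF P_diff[OF fg] fg(2)] by simp
    thus ?thesis using h_closed[OF P_diff[OF fg]] h_closed[OF fg(2)]
      by (simp add: a_minus_def A.a_assoc A.r_neg)
  qed
  have h_pure: "h (frag_of (r, w)) = \<beta> r w" if "r \<in> carrier H" "w \<in> carrier W" for r w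
    using h_frag[of "(r, w)"] that by simp
  have cancel: "a \<oplus>\<^bsub>A\<^esub> b \<ominus>\<^bsub>A\<^esub> a \<ominus>\<^bsub>A\<^esub> b = \<zero>\<^bsub>A\<^esub>" if "a \<in> carrier A" "b \<in> carrier A" for a b
  proof -
    have "a \<oplus>\<^bsub>A\<^esub> b \<ominus>\<^bsub>A\<^esub> a = b"
      using that by (simp add: a_minus_def A.a_assoc A.r_neg A.a_comm[of a b])
    thus ?thesis using that by (simp add: a_minus_def A.r_neg)
  qed
  have zero: "h x = \<zero>\<^bsub>A\<^esub>" if "x \<in> T" for x
    using that
  proof (induction rule: T_induct)
    case zero
    have z: "0 \<in> carrier P" by simp
    have "h 0 = h 0 \<ominus>\<^bsub>A\<^esub> h 0" using h_diff[OF z z] by simp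
    then show ?case using h_closed[OF z] by (simp add: a_minus_def A.r_neg)
  next
    case (gen x)
    interpret H: ring H by (rule ring_H)
    from gen show ?case
    proof (cases rule: tensor_gens_cases)
      case (add_l r1 r2 w)
      have c: "frag_of (r1 \<oplus>\<^bsub>H\<^esub> r2, w) \<in> carrier P" "frag_of (r1, w) \<in> carrier P" "frag_of (r2, w) \<in> carrier P"
        using add_l by auto
      show ?thesis unfolding add_l(4) h_diff[OF P_diff[OF c(1,2)] c(3)] h_diff[OF c(1,2)]
        using add_l(1-3) closed
        by (simp add: h_pure assms(3) cancel)
    next
      case (add_r r w w')
      have c: "frag_of (r, w \<oplus>\<^bsub>W\<^esub> w') \<in> carrier P" "frag_of (r, w) \<in> carrier P" "frag_of (r, w') \<in> carrier P"
        using add_r by auto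
      show ?thesis unfolding add_r(4) h_diff[OF P_diff[OF c(1,2)] c(3)] h_diff[OF c(1,2)]
        using add_r(1-3) closed
        by (simp add: h_pure assms(4) cancel)
    next
      case (balance r b w u)
      have c: "frag_of (r \<otimes>\<^bsub>H\<^esub> b, w) \<in> carrier P" "frag_of (r, u) \<in> carrier P"
        using balance X_closed by auto
      show ?thesis unfolding balance(3) h_diff[OF c]
        using balance(1,2) closed X_closed[OF balance(2)]
        by (simp add: h_pure assms(5) a_minus_def A.r_neg)
    qed
  next
    case (diff x y)
    then show ?case using h_diff[OF T_closed T_closed] by (simp add: a_minus_def)
  qed
  have wd: "h f = h g" if fg: "f \<in> carrier P" "g \<in> carrier P" "quo.q f = quo.q g" for f g
  proof -
    have "f - g \<in> T" using quo.q_eq_iff[OF fg(1,2)] fg P_a_minus by simp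
    hence "h ((f - g) + g) = h g"
      using h_add[OF P_diff[OF fg(1,2)] fg(2)] zero h_closed[OF fg(2)] by simp
    thus ?thesis by simp
  qed
  define \<pi> where "\<pi> m = h (SOME f. f \<in> carrier P \<and> quo.q f = m)" for m
  have \<pi>: "\<pi> (quo.q f) = h f" if f: "f \<in> carrier P" for f
  proof -
    have "(SOME g. g \<in> carrier P \<and> quo.q g = quo.q f) \<in> carrier P \<and>
        quo.q (SOME g. g \<in> carrier P \<and> quo.q g = quo.q f) = quo.q f"
      by (rule someI[of _ f]) (use f in blast)
    thus ?thesis unfolding \<pi>_def using wd f by blast
  qed
  show ?thesis
  proof (rule that)
    show "\<pi> m \<in> carrier A" if "m \<in> carrier M" for m
      using M_surj[OF that] \<pi> h_closed by auto
    show "\<pi> (m \<oplus>\<^bsub>M\<^esub> n) = \<pi> m \<oplus>\<^bsub>A\<^esub> \<pi> n" if mn: "m \<in> carrier M" "n \<in> carrier M" for m n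
    proof -
      obtain f g where fg: "f \<in> carrier P" "m = quo.q f" "g \<in> carrier P" "n = quo.q g"
        using M_surj mn by blast
      show ?thesis unfolding fg(2,4) q_plus[OF fg(1,3), symmetric]
        using \<pi>[OF fg(1)] \<pi>[OF fg(3)] \<pi>[OF P_add[OF fg(1,3)]] h_add[OF fg(1,3)] by simp
    qed
    show "\<pi> (pt r w) = \<beta> r w" if "r \<in> carrier H" "w \<in> carrier W" for r w
      unfolding pt_eq using \<pi>[of "frag_of (r, w)"] h_pure that by simp
  qed
qed

lemma one_H [simp]: "\<one>\<^bsub>H\<^esub> \<in> carrier H" using ring.ring_simprules(6)[OF ring_H] .

lemma pt_one_smult: "r \<in> carrier H \<Longrightarrow> w \<in> carrier W \<Longrightarrow> r \<odot>\<^bsub>M\<^esub> pt \<one>\<^bsub>H\<^esub> w = pt r w"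
  using pt_smult[of r "\<one>\<^bsub>H\<^esub>" w] ring.ring_simprules(13)[OF ring_H] by (simp add: monoid.r_one[OF ring.is_monoid[OF ring_H]])

lemma X_smult_pt_one:
  assumes "(b, w, u) \<in> X"
  shows "b \<odot>\<^bsub>M\<^esub> pt \<one>\<^bsub>H\<^esub> w = pt \<one>\<^bsub>H\<^esub> u"
  using pt_one_smult[of b w] pt_balance[OF one_H assms] X_closed[OF assms]
    monoid.l_one[OF ring.is_monoid[OF ring_H], of b] by simp

lemma pt_one_zero: "\<zero>\<^bsub>M\<^esub> \<in> pt \<one>\<^bsub>H\<^esub> ` carrier W"
  using pt_zero_r[OF one_H] W_closed(4) by (metis imageI)

sublocale low: lowest_weight_space G V t c M "pt \<one>\<^bsub>H\<^esub> ` carrier W"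
proof (rule lowest_weight_space.intro[OF vm.cherednik_module_axioms lowest_weight_space_axioms.intro])
  show "pt \<one>\<^bsub>H\<^esub> ` carrier W \<subseteq> carrier M" by auto
  show "\<zero>\<^bsub>M\<^esub> \<in> pt \<one>\<^bsub>H\<^esub> ` carrier W" by (rule pt_one_zero)
  show "u \<oplus>\<^bsub>M\<^esub> v \<in> pt \<one>\<^bsub>H\<^esub> ` carrier W"
    if "u \<in> pt \<one>\<^bsub>H\<^esub> ` carrier W" "v \<in> pt \<one>\<^bsub>H\<^esub> ` carrier W" for u v
    using that by (auto simp: pt_add_r[OF one_H, symmetric])
  show "E (sc a) \<odot>\<^bsub>M\<^esub> u \<in> pt \<one>\<^bsub>H\<^esub> ` carrier W" if "u \<in> pt \<one>\<^bsub>H\<^esub> ` carrier W" for a u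
    using that by (auto simp: X_smult_pt_one[OF kGSh_action.scalar])
  show "E (lt (Grp g)) \<odot>\<^bsub>M\<^esub> u \<in> pt \<one>\<^bsub>H\<^esub> ` carrier W"
    if "g \<in> carrier G" "u \<in> pt \<one>\<^bsub>H\<^esub> ` carrier W" for g u
    using that by (auto simp: X_smult_pt_one[OF kGSh_action.grp])
  show "E (lt (Vec y)) \<odot>\<^bsub>M\<^esub> u = \<zero>\<^bsub>M\<^esub>"
    if "y \<in> carrier V" "u \<in> pt \<one>\<^bsub>H\<^esub> ` carrier W" for y u
    using that by (auto simp: X_smult_pt_one[OF kGSh_action.vec] pt_zero_r)
qed

text \<open>The grading of the Verma module is the one by the number of factors from \<open>\<hh>\<^sup>*\<close>; in particular its
  part of degree zero is \<open>1 \<otimes> W\<close>.\<close>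

lemma cov_span_verma:
  assumes "m \<in> grade M i"
  shows "low.cov_span i m"
  using assms
proof (induction rule: verma_grade_induct)
  case (pure r w)
  have "low.cov_span (i + 0) (r \<odot>\<^bsub>M\<^esub> pt \<one>\<^bsub>H\<^esub> w)"
    using pure by (intro low.cov_span_smult low.cov_span.base) auto
  thus ?case using pure grade_carrier by (simp add: pt_one_smult)
next
  case (add m n)
  then show ?case by (intro low.cov_span.add)
qed

lemma verma_grade_zero: "m \<in> grade M 0 \<Longrightarrow> \<exists>w\<in>carrier W. m = pt \<one>\<^bsub>H\<^esub> w"
  using low.cov_span_degree_zero[OF cov_span_verma] by blast

lemma verma_grade_negative: "m \<in> grade M i \<Longrightarrow> i < 0 \<Longrightarrow> m = \<zero>\<^bsub>M\<^esub>"
  using low.cov_span_negative[OF cov_span_verma] .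

end

section \<open>The anti-isomorphism with the algebra of the dual representation\<close>

lemma eval_at_apply: "f \<in> carrier (dual_rep G V) \<Longrightarrow> eval_at G V v f = f v"
  by (simp add: eval_at_def)

locale cherednik_duality = cherednik_algebra G V t c + dual: cherednik_algebra G "dual_rep G V" t "cbar G c"
  for G :: "'g monoid" and V :: "('g, 'k::field, 'v) rep" and t :: 'k and c :: "'g \<Rightarrow> 'k"
begin

abbreviation "eval \<equiv> eval_at G V"

text \<open>The inverse of the identification of \<open>\<hh>\<close> with its bidual.\<close>

definition coeval :: "(('v \<Rightarrow> 'k) \<Rightarrow> 'k) \<Rightarrow> 'v" where
  "coeval = inv_into (carrier V) eval"

lemma eval_closed: "y \<in> carrier V \<Longrightarrow> eval y \<in> carrier dual.D"
  by (rule eval_at_closed[OF vs])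

lemma coeval_eval [simp]: "y \<in> carrier V \<Longrightarrow> coeval (eval y) = y"
  unfolding coeval_def using eval_at_bij[OF vs fd] by (auto simp: bij_betw_def)

lemma eval_surj: "\<xi> \<in> carrier dual.D \<Longrightarrow> \<exists>y\<in>carrier V. \<xi> = eval y"
  using eval_at_bij[OF vs fd, of G] by (auto simp: bij_betw_def)

lemma D_apply:
  "x \<in> carrier D \<Longrightarrow> u \<in> carrier V \<Longrightarrow> v \<in> carrier V \<Longrightarrow> x (u \<oplus>\<^bsub>V\<^esub> v) = x u + x v"
  "x \<in> carrier D \<Longrightarrow> v \<in> carrier V \<Longrightarrow> x (a \<odot>\<^bsub>V\<^esub> v) = a * x v"
  "v \<in> carrier V \<Longrightarrow> act D g x v = x (act V (inv\<^bsub>G\<^esub> g) v)"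
  using functionalsD[of x V] by (auto simp: dual_rep_simps)

lemmas eval_add = eval_at_add[OF vs] and eval_smult = eval_at_smult[OF vs] and eval_act = eval_at_act[OF grp rep]

lemma inv_inv [simp]: "g \<in> carrier G \<Longrightarrow> inv\<^bsub>G\<^esub> (inv\<^bsub>G\<^esub> g) = g"
  by (rule group.inv_inv[OF grp])

text \<open>The anti-isomorphism on generators. It is the identity on \<open>\<hh>\<close> and \<open>\<hh>\<^sup>*\<close>, but a vector of one algebra
  is a covector of the other, and \<open>\<hh>\<close> appears as a bidual in the second one.\<close>

fun swap :: "('g, 'v \<Rightarrow> 'k, ('v \<Rightarrow> 'k) \<Rightarrow> 'k) letter \<Rightarrow> ('g, 'v, 'v \<Rightarrow> 'k) letter" where
  "swap (Grp g) = Grp (inv\<^bsub>G\<^esub> g)"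
| "swap (Vec x) = Cov x"
| "swap (Cov \<xi>) = Vec (coeval \<xi>)"

lemma swap_letters: "z \<in> letters G (dual_rep G V) \<Longrightarrow> swap z \<in> letters G V"
  by (cases z) (auto dest: eval_surj)

lemma swap_deg: "letter_deg (swap z) = - letter_deg z"
  by (cases z) auto

text \<open>Products are reversed, so words are read backwards.\<close>

definition anti :: "('g, 'k, 'v \<Rightarrow> 'k) word_alg \<Rightarrow> ('g, 'k, 'v) word_alg" where
  "anti f = (\<Sum>w\<in>Poly_Mapping.keys f. Poly_Mapping.single (rev (map swap w)) (Poly_Mapping.lookup f w))"

lemma anti_eq:
  assumes "finite A" "Poly_Mapping.keys f \<subseteq> A"
  shows "anti f = (\<Sum>w\<in>A. Poly_Mapping.single (rev (map swap w)) (Poly_Mapping.lookup f w))"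
  unfolding anti_def by (rule sum.mono_neutral_left) (use assms in \<open>auto simp: in_keys_iff\<close>)

lemma anti_add: "anti (f + g) = anti f + anti g"
proof -
  let ?A = "Poly_Mapping.keys f \<union> Poly_Mapping.keys g"
  have "anti (f + g) = (\<Sum>w\<in>?A. Poly_Mapping.single (rev (map swap w)) (Poly_Mapping.lookup (f + g) w))"
    using Poly_Mapping.keys_add[of f g] by (intro anti_eq) auto
  also have "\<dots> = anti f + anti g"
    by (simp add: anti_eq[of ?A f] anti_eq[of ?A g] lookup_add single_add sum.distrib)
  finally show ?thesis .
qed

lemma anti_single: "anti (Poly_Mapping.single w a) = Poly_Mapping.single (rev (map swap w)) a"
  by (simp add: anti_def)

lemma anti_sc [simp]: "anti (sc a) = sc a" by (simp add: anti_single)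
lemma anti_lt [simp]: "anti (lt z) = lt (swap z)" by (simp add: anti_single)
lemma anti_one [simp]: "anti 1 = 1" using anti_sc[of 1] by (simp add: sc_one)
lemma anti_zero [simp]: "anti 0 = 0" using anti_sc[of 0] by simp

lemma anti_uminus: "anti (- f) = - anti f"
  using anti_add[of "- f" f] by (simp add: eq_neg_iff_add_eq_0)

lemma anti_diff: "anti (f - g) = anti f - anti g"
  using anti_add[of f "- g"] by (simp add: anti_uminus)

lemma anti_sum: "anti (sum f A) = (\<Sum>a\<in>A. anti (f a))"
  by (induction A rule: infinite_finite_induct) (auto simp: anti_add)

lemma anti_mult: "anti (f * g) = anti g * anti f"
proof (induction f rule: poly_mapping_add_induct)
  case (single w a)
  show ?case
  proof (induction g rule: poly_mapping_add_induct)
    case (single w' b)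
    show ?case by (simp add: mult_single anti_single plus_list_def mult.commute)
  qed (auto simp: distrib_left distrib_right anti_add)
qed (auto simp: distrib_left distrib_right anti_add)

lemma anti_closed:
  assumes "f \<in> carrier dual.F"
  shows "anti f \<in> carrier F"
  unfolding anti_def
proof (rule free_algebra_sum)
  fix w assume w: "w \<in> Poly_Mapping.keys f"
  hence "set w \<subseteq> letters G (dual_rep G V)" using assms by (auto simp: free_algebra_carrier)
  hence "set (rev (map swap w)) \<subseteq> letters G V" using swap_letters by auto
  thus "Poly_Mapping.single (rev (map swap w)) (Poly_Mapping.lookup f w) \<in> carrier F" by simp
qed

abbreviation "Rel \<equiv> smash_relations G V \<union> cherednik_relations G V t c"

lemma E_zeroI: "f \<in> Rel \<Longrightarrow> g = f \<or> g = - f \<Longrightarrow> E g = \<zero>\<^bsub>H\<^esub>"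
proof -
  assume f: "f \<in> Rel" and g: "g = f \<or> g = - f"
  interpret H: ring H by (rule ring_H)
  have "f \<in> carrier F" using f relations_carrier by blast
  thus "E g = \<zero>\<^bsub>H\<^esub>" using g E_relation[OF f] E_uminus by auto
qed

text \<open>Each relation goes to a relation of the other algebra, up to sign.\<close>

lemma anti_smash: "f \<in> smash_relations G (dual_rep G V) \<Longrightarrow> E (anti f) = \<zero>\<^bsub>H\<^esub>"
proof -
  have comm: "lt z * sc a = sc a * lt z" for z :: "('g, 'v, 'v \<Rightarrow> 'k) letter" and a :: 'k
    by (simp add: sc_mult_single single_mult_sc)
  assume "f \<in> smash_relations G (dual_rep G V)"
  then consider
    (1) u v where "u \<in> carrier D" "v \<in> carrier D"
      "f = lt (Vec (u \<oplus>\<^bsub>D\<^esub> v)) - lt (Vec u) - lt (Vec v)"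
  | (2) a v where "v \<in> carrier D" "f = lt (Vec (a \<odot>\<^bsub>D\<^esub> v)) - sc a * lt (Vec v)"
  | (3) x x' where "x \<in> carrier dual.D" "x' \<in> carrier dual.D"
      "f = lt (Cov (x \<oplus>\<^bsub>dual.D\<^esub> x')) - lt (Cov x) - lt (Cov x')"
  | (4) a x where "x \<in> carrier dual.D" "f = lt (Cov (a \<odot>\<^bsub>dual.D\<^esub> x)) - sc a * lt (Cov x)"
  | (5) "f = lt (Grp \<one>\<^bsub>G\<^esub>) - 1"
  | (6) g h where "g \<in> carrier G" "h \<in> carrier G"
      "f = lt (Grp (g \<otimes>\<^bsub>G\<^esub> h)) - lt (Grp g) * lt (Grp h)"
  | (7) g v where "g \<in> carrier G" "v \<in> carrier D"
      "f = lt (Grp g) * lt (Vec v) - lt (Vec (act D g v)) * lt (Grp g)"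
  | (8) g x where "g \<in> carrier G" "x \<in> carrier dual.D"
      "f = lt (Grp g) * lt (Cov x) - lt (Cov (act dual.D g x)) * lt (Grp g)"
    unfolding smash_relations_def Let_def by blast
  thus "E (anti f) = \<zero>\<^bsub>H\<^esub>"
  proof cases
    case 1
    have "lt (Cov (u \<oplus>\<^bsub>D\<^esub> v)) - lt (Cov u) - lt (Cov v) \<in> Rel"
      unfolding smash_relations_def Let_def using 1 by blast
    thus ?thesis by (rule E_zeroI) (simp add: 1 anti_diff)
  next
    case 2
    have "lt (Cov (a \<odot>\<^bsub>D\<^esub> v)) - sc a * lt (Cov v) \<in> Rel"
      unfolding smash_relations_def Let_def using 2 by blast
    thus ?thesis by (rule E_zeroI) (simp add: 2 anti_diff anti_mult comm)
  next
    case 3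
    then obtain u v where uv: "u \<in> carrier V" "v \<in> carrier V" "x = eval u" "x' = eval v"
      using eval_surj by blast
    have "lt (Vec (u \<oplus>\<^bsub>V\<^esub> v)) - lt (Vec u) - lt (Vec v) \<in> Rel"
      unfolding smash_relations_def Let_def using uv by blast
    thus ?thesis by (rule E_zeroI) (simp add: 3 uv anti_diff eval_add)
  next
    case 4
    then obtain u where u: "u \<in> carrier V" "x = eval u" using eval_surj by blast
    have "lt (Vec (a \<odot>\<^bsub>V\<^esub> u)) - sc a * lt (Vec u) \<in> Rel"
      unfolding smash_relations_def Let_def using u by blast
    thus ?thesis by (rule E_zeroI) (simp add: 4 u anti_diff anti_mult eval_smult comm)
  next
    case 5
    have "lt (Grp \<one>\<^bsub>G\<^esub>) - 1 \<in> Rel" unfolding smash_relations_def Let_def by blast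
    thus ?thesis
      by (rule E_zeroI) (simp add: 5 anti_diff monoid.inv_one[OF group.is_monoid[OF grp]])
  next
    case 6
    have "lt (Grp (inv\<^bsub>G\<^esub> h \<otimes>\<^bsub>G\<^esub> inv\<^bsub>G\<^esub> g)) - lt (Grp (inv\<^bsub>G\<^esub> h)) * lt (Grp (inv\<^bsub>G\<^esub> g)) \<in> Rel"
      unfolding smash_relations_def Let_def using 6 inv_closed by blast
    thus ?thesis
      by (rule E_zeroI) (simp add: 6 anti_diff anti_mult group.inv_mult_group[OF grp])
  next
    case 7
    have "lt (Grp (inv\<^bsub>G\<^esub> g)) * lt (Cov (act D g v)) -
        lt (Cov (act D (inv\<^bsub>G\<^esub> g) (act D g v))) * lt (Grp (inv\<^bsub>G\<^esub> g)) \<in> Rel"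
      unfolding smash_relations_def Let_def using inv_closed[OF 7(1)] D_closed(3)[OF 7(1,2)] by blast
    thus ?thesis
      by (rule E_zeroI) (simp add: 7 anti_diff anti_mult rep_inv_act(2)[OF grp D_rep])
  next
    case 8
    then obtain u where u: "u \<in> carrier V" "x = eval u" using eval_surj by blast
    have "lt (Grp (inv\<^bsub>G\<^esub> g)) * lt (Vec (act V g u)) -
        lt (Vec (act V (inv\<^bsub>G\<^esub> g) (act V g u))) * lt (Grp (inv\<^bsub>G\<^esub> g)) \<in> Rel"
      unfolding smash_relations_def Let_def using inv_closed[OF 8(1)] V_closed(3)[OF 8(1) u(1)] by blast
    thus ?thesis
      by (rule E_zeroI)
        (simp add: 8 u eval_act anti_diff anti_mult rep_inv_act(2)[OF grp rep])
  qed
qed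

text \<open>In the commutation relation the sum over reflections is reindexed by \<open>s \<mapsto> s\<^sup>-\<^sup>1\<close>; this turns the
  parameter \<open>cbar G c\<close> back into \<open>c\<close>.\<close>

lemma anti_cherednik:
  assumes "f \<in> cherednik_relations G (dual_rep G V) t (cbar G c)"
  shows "E (anti f) = \<zero>\<^bsub>H\<^esub>"
proof -
  have comm: "lt z * sc a = sc a * lt z" for z :: "('g, 'v, 'v \<Rightarrow> 'k) letter" and a :: 'k
    by (simp add: sc_mult_single single_mult_sc)
  from assms consider
    (1) x x' where "x \<in> carrier dual.D" "x' \<in> carrier dual.D"
      "f = lt (Cov x) * lt (Cov x') - lt (Cov x') * lt (Cov x)"
  | (2) y y' where "y \<in> carrier D" "y' \<in> carrier D"
      "f = lt (Vec y) * lt (Vec y') - lt (Vec y') * lt (Vec y)"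
  | (3) x y where "x \<in> carrier dual.D" "y \<in> carrier D"
      "f = lt (Vec y) * lt (Cov x) - lt (Cov x) * lt (Vec y) - (sc (t * x y) -
        (\<Sum>s\<in>reflections G (dual_rep G V). sc (cbar G c s * (x y - act dual.D s x y)) * lt (Grp s)))"
    unfolding cherednik_relations_def Let_def by blast
  thus ?thesis
  proof cases
    case 1
    then obtain u v where uv: "u \<in> carrier V" "v \<in> carrier V" "x = eval u" "x' = eval v"
      using eval_surj by blast
    have "lt (Vec u) * lt (Vec v) - lt (Vec v) * lt (Vec u) \<in> Rel"
      unfolding cherednik_relations_def Let_def using uv by blast
    thus ?thesis by (rule E_zeroI) (simp add: 1 uv anti_diff anti_mult)
  next
    case 2
    have "lt (Cov y) * lt (Cov y') - lt (Cov y') * lt (Cov y) \<in> Rel"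
      unfolding cherednik_relations_def Let_def using 2 by blast
    thus ?thesis by (rule E_zeroI) (simp add: 2 anti_diff anti_mult)
  next
    case 3
    then obtain u where u: "u \<in> carrier V" "x = eval u" using eval_surj by blast
    have r: "reflections G (dual_rep G V) = reflections G V" by (rule reflections_dual[OF grp fdr])
    have xs: "act dual.D s x y = y (act V s u)" "act D (inv\<^bsub>G\<^esub> s) y u = y (act V s u)"
      if "s \<in> reflections G V" for s
    proof -
      have "s \<in> carrier G" using that reflections_subset by blast
      thus "act dual.D s x y = y (act V s u)" "act D (inv\<^bsub>G\<^esub> s) y u = y (act V s u)"
        using 3(2) u by (simp_all add: eval_act eval_at_apply D_apply(3))
    qed
    have xy: "x y = y u" using 3(2) u by (simp add: eval_at_apply)
    have "(\<Sum>s\<in>reflections G V. sc (cbar G c s * (x y - act dual.D s x y)) * lt (Grp (inv\<^bsub>G\<^esub> s))) =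
      (\<Sum>s\<in>reflections G V. sc (c (inv\<^bsub>G\<^esub> s) * (y u - act D (inv\<^bsub>G\<^esub> s) y u)) * lt (Grp (inv\<^bsub>G\<^esub> s)))"
      by (rule sum.cong) (simp_all add: cbar_def xs xy)
    also have "\<dots> = (\<Sum>s\<in>reflections G V. sc (c s * (y u - act D s y u)) * lt (Grp s))"
    proof (rule sum.reindex_bij_witness[of _ "\<lambda>s. inv\<^bsub>G\<^esub> s" "\<lambda>s. inv\<^bsub>G\<^esub> s"])
      fix s assume "s \<in> reflections G V"
      thus "inv\<^bsub>G\<^esub> (inv\<^bsub>G\<^esub> s) = s" "inv\<^bsub>G\<^esub> s \<in> reflections G V"
        "inv\<^bsub>G\<^esub> (inv\<^bsub>G\<^esub> s) = s" "inv\<^bsub>G\<^esub> s \<in> reflections G V"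
        using reflections_subset reflections_inv[OF grp fdr] by auto
    qed simp
    finally have sum: "(\<Sum>s\<in>reflections G V. sc (cbar G c s * (x y - act dual.D s x y)) * lt (Grp (inv\<^bsub>G\<^esub> s))) =
      (\<Sum>s\<in>reflections G V. sc (c s * (y u - act D s y u)) * lt (Grp s))" .
    have "lt (Vec u) * lt (Cov y) - lt (Cov y) * lt (Vec u) - (sc (t * y u) -
        (\<Sum>s\<in>reflections G V. sc (c s * (y u - act D s y u)) * lt (Grp s))) \<in> Rel"
      unfolding cherednik_relations_def Let_def using 3(2) u(1) by blast
    thus ?thesis
    proof (rule E_zeroI)
      show "anti f = lt (Vec u) * lt (Cov y) - lt (Cov y) * lt (Vec u) - (sc (t * y u) -
        (\<Sum>s\<in>reflections G V. sc (c s * (y u - act D s y u)) * lt (Grp s))) \<or>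
        anti f = - (lt (Vec u) * lt (Cov y) - lt (Cov y) * lt (Vec u) - (sc (t * y u) -
        (\<Sum>s\<in>reflections G V. sc (c s * (y u - act D s y u)) * lt (Grp s))))"
        unfolding 3(3) anti_diff anti_mult anti_sum anti_lt anti_sc swap.simps comm r u(2)
          coeval_eval[OF u(1)] xy[unfolded u(2)] sum[unfolded u(2), unfolded xy[unfolded u(2)]] by (rule disjI1 refl)+
    qed
  qed
qed

lemma anti_kernel:
  assumes "f \<in> carrier dual.F" "dual.E f = \<zero>\<^bsub>dual.H\<^esub>"
  shows "E (anti f) = \<zero>\<^bsub>H\<^esub>"
proof -
  interpret H: ring H by (rule ring_H)
  interpret DF: ring dual.F by (rule ring_free_algebra)
  let ?K = "{f \<in> carrier dual.F. E (anti f) = \<zero>\<^bsub>H\<^esub>}"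
  have "ideal ?K dual.F"
  proof (rule idealI[OF ring_free_algebra])
    show "subgroup ?K (add_monoid dual.F)"
    proof (rule group.subgroupI)
      show "group (add_monoid dual.F)" by (rule DF.add.is_group)
      have "0 \<in> ?K" by (simp add: E_zero)
      thus "?K \<noteq> {}" by blast
    next
      fix f assume f: "f \<in> ?K"
      hence fF: "f \<in> carrier dual.F" by blast
      have "inv\<^bsub>add_monoid dual.F\<^esub> f = - f"
        unfolding a_inv_def[symmetric] by (rule free_algebra_uminus[OF fF])
      moreover have "- f \<in> ?K"
        using f anti_closed[OF fF] free_algebra_closed(4)[OF fF fF] by (simp add: anti_uminus E_uminus)
      ultimately show "inv\<^bsub>add_monoid dual.F\<^esub> f \<in> ?K" by simp
    next
      fix f g assume "f \<in> ?K" "g \<in> ?K"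
      thus "f \<otimes>\<^bsub>add_monoid dual.F\<^esub> g \<in> ?K"
        using anti_closed by (auto simp: anti_add E_add)
    qed auto
  next
    fix f g assume "f \<in> ?K" "g \<in> carrier dual.F"
    thus "g \<otimes>\<^bsub>dual.F\<^esub> f \<in> ?K" "f \<otimes>\<^bsub>dual.F\<^esub> g \<in> ?K"
      using anti_closed by (auto simp: anti_mult E_mult)
  qed
  moreover have "smash_relations G (dual_rep G V) \<union> cherednik_relations G (dual_rep G V) t (cbar G c) \<subseteq> ?K"
    using anti_smash anti_cherednik dual.relations_carrier by blast
  ultimately show ?thesis using dual.E_kernel_subset assms by blast
qed

text \<open>The map that \<open>anti\<close> induces on the algebras; by \<open>anti_kernel\<close> the choice of a preimage is immaterial.\<close>

definition adjoint :: "('g, 'k, 'v \<Rightarrow> 'k) cher \<Rightarrow> ('g, 'k, 'v) cher" where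
  "adjoint r = E (anti (SOME f. f \<in> carrier dual.F \<and> dual.E f = r))"

lemma adjoint_E:
  assumes f: "f \<in> carrier dual.F"
  shows "adjoint (dual.E f) = E (anti f)"
proof -
  let ?g = "SOME g. g \<in> carrier dual.F \<and> dual.E g = dual.E f"
  have g: "?g \<in> carrier dual.F \<and> dual.E ?g = dual.E f"
    by (rule someI[of _ f]) (use f in blast)
  hence "dual.E (?g - f) = \<zero>\<^bsub>dual.H\<^esub>" using dual.E_diff_zero f by blast
  hence "E (anti ?g - anti f) = \<zero>\<^bsub>H\<^esub>"
    using anti_kernel[of "?g - f"] g f by (auto simp: anti_diff)
  thus ?thesis unfolding adjoint_def using E_diff_zero[OF anti_closed anti_closed] g f by blast
qed

lemma adjoint_closed [simp]: "r \<in> carrier dual.H \<Longrightarrow> adjoint r \<in> carrier H"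
  using anti_closed by (auto simp: dual.carrier_H adjoint_E)

lemma adjoint_add: "r \<in> carrier dual.H \<Longrightarrow> s \<in> carrier dual.H \<Longrightarrow>
    adjoint (r \<oplus>\<^bsub>dual.H\<^esub> s) = adjoint r \<oplus>\<^bsub>H\<^esub> adjoint s"
  by (auto simp: dual.carrier_H adjoint_E adjoint_E[OF free_algebra_closed(1)] anti_closed anti_add E_add
      simp flip: dual.E_add)

lemma adjoint_mult: "r \<in> carrier dual.H \<Longrightarrow> s \<in> carrier dual.H \<Longrightarrow>
    adjoint (r \<otimes>\<^bsub>dual.H\<^esub> s) = adjoint s \<otimes>\<^bsub>H\<^esub> adjoint r"
  by (auto simp: dual.carrier_H adjoint_E adjoint_E[OF free_algebra_closed(3)] anti_closed anti_mult E_mult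
      simp flip: dual.E_mult)

lemma adjoint_scalar: "adjoint (dual.E (sc a)) = E (sc a)"
  by (simp add: adjoint_E)

lemma adjoint_letter: "z \<in> letters G (dual_rep G V) \<Longrightarrow> adjoint (dual.E (lt z)) = E (lt (swap z))"
  by (simp add: adjoint_E)

lemma adjoint_one: "adjoint \<one>\<^bsub>dual.H\<^esub> = \<one>\<^bsub>H\<^esub>"
  using adjoint_E[of 1] by (simp add: dual.E_one E_one)

lemma adjoint_grade:
  assumes "r \<in> cher_grade G (dual_rep G V) t (cbar G c) i"
  shows "adjoint r \<in> cher_grade G V t c (- i)"
proof -
  obtain f where f: "f \<in> carrier dual.F" "r = dual.E f"
      "\<forall>w\<in>Poly_Mapping.keys f. sum_list (map letter_deg w) = i"
    using assms by (auto simp: cher_grade_def)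
  have "\<forall>w\<in>Poly_Mapping.keys (anti f). sum_list (map letter_deg w) = - i"
  proof
    fix w assume "w \<in> Poly_Mapping.keys (anti f)"
    then obtain v where v: "v \<in> Poly_Mapping.keys f" "w = rev (map swap v)"
      unfolding anti_def using Poly_Mapping.keys_sum by (fastforce split: if_splits)
    have "sum_list (map letter_deg (rev (map swap u))) = - sum_list (map letter_deg u)" for u
      by (induction u) (auto simp: swap_deg)
    thus "sum_list (map letter_deg w) = - i" using v f(3) by simp
  qed
  thus ?thesis unfolding cher_grade_def f(2) adjoint_E[OF f(1)] using anti_closed[OF f(1)] by blast
qed

text \<open>Every generator is the image of a generator.\<close>

lemma adjoint_surj:
  assumes "s \<in> carrier H"
  shows "\<exists>r\<in>carrier dual.H. adjoint r = s"
  using assms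
proof (induction rule: H_induct)
  case (scalar a)
  then show ?case using adjoint_scalar by (intro bexI[of _ "dual.E (sc a)"]) auto
next
  case (letter z)
  have "\<exists>z'\<in>letters G (dual_rep G V). swap z' = z"
  proof (cases z)
    case (Grp g)
    then show ?thesis using letter by (intro bexI[of _ "Grp (inv\<^bsub>G\<^esub> g)"]) auto
  next
    case (Vec y)
    then show ?thesis using letter eval_closed by (intro bexI[of _ "Cov (eval y)"]) auto
  next
    case (Cov x)
    then show ?thesis using letter by (intro bexI[of _ "Vec x"]) auto
  qed
  then obtain z' where "z' \<in> letters G (dual_rep G V)" "swap z' = z" by blast
  thus ?case using adjoint_letter[of z'] by (intro bexI[of _ "dual.E (lt z')"]) auto
next
  case (add r s)
  then obtain r' s' where "r' \<in> carrier dual.H" "adjoint r' = r" "s' \<in> carrier dual.H" "adjoint s' = s"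
    by blast
  thus ?case using adjoint_add ring.ring_simprules(1)[OF dual.ring_H] by (metis)
next
  case (mult r s)
  then obtain r' s' where "r' \<in> carrier dual.H" "adjoint r' = r" "s' \<in> carrier dual.H" "adjoint s' = s"
    by blast
  thus ?case using adjoint_mult ring.ring_simprules(5)[OF dual.ring_H] by (metis)
qed

end

lemma (in cherednik_algebra) duality: "cherednik_duality G V"
  by (intro cherednik_duality.intro cherednik_algebra_axioms cherednik_algebra.intro grp
      dual_fin_dim_rep[OF grp fdr])

section \<open>Contravariant forms\<close>

locale contravariant = cherednik_duality G V t c
    + ver: verma_setting G V t c W
    + ver': verma_setting G "dual_rep G V" t "cbar G c" "dual_rep G W"
  for G :: "'g monoid" and V :: "('g, 'k::field, 'v) rep" and t :: 'k and c :: "'g \<Rightarrow> 'k"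
    and W :: "('g, 'k, 'w) rep"
begin

lemma contravariant_formD:
  assumes "contravariant_form G V t c W B"
  shows "\<And>m n m'. m \<in> carrier ver.M \<Longrightarrow> n \<in> carrier ver.M \<Longrightarrow> m' \<in> carrier ver'.M \<Longrightarrow>
      B (m \<oplus>\<^bsub>ver.M\<^esub> n) m' = B m m' + B n m'"
    and "\<And>m m' n'. m \<in> carrier ver.M \<Longrightarrow> m' \<in> carrier ver'.M \<Longrightarrow> n' \<in> carrier ver'.M \<Longrightarrow>
      B m (m' \<oplus>\<^bsub>ver'.M\<^esub> n') = B m m' + B m n'"
    and "\<And>a m m'. m \<in> carrier ver.M \<Longrightarrow> m' \<in> carrier ver'.M \<Longrightarrow> B (E (sc a) \<odot>\<^bsub>ver.M\<^esub> m) m' = a * B m m'"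
    and "\<And>a m m'. m \<in> carrier ver.M \<Longrightarrow> m' \<in> carrier ver'.M \<Longrightarrow> B m (dual.E (sc a) \<odot>\<^bsub>ver'.M\<^esub> m') = a * B m m'"
    and "\<And>g m m'. g \<in> carrier G \<Longrightarrow> m \<in> carrier ver.M \<Longrightarrow> m' \<in> carrier ver'.M \<Longrightarrow>
      B (E (lt (Grp g)) \<odot>\<^bsub>ver.M\<^esub> m) m' = B m (dual.E (lt (Grp (inv\<^bsub>G\<^esub> g))) \<odot>\<^bsub>ver'.M\<^esub> m')"
    and "\<And>y m m'. y \<in> carrier V \<Longrightarrow> m \<in> carrier ver.M \<Longrightarrow> m' \<in> carrier ver'.M \<Longrightarrow>
      B (E (lt (Vec y)) \<odot>\<^bsub>ver.M\<^esub> m) m' = B m (dual.E (lt (Cov (eval y))) \<odot>\<^bsub>ver'.M\<^esub> m')"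
    and "\<And>x m m'. x \<in> carrier D \<Longrightarrow> m \<in> carrier ver.M \<Longrightarrow> m' \<in> carrier ver'.M \<Longrightarrow>
      B (E (lt (Cov x)) \<odot>\<^bsub>ver.M\<^esub> m) m' = B m (dual.E (lt (Vec x)) \<odot>\<^bsub>ver'.M\<^esub> m')"
    and "\<And>i j m m'. i \<noteq> j \<Longrightarrow> m \<in> grade ver.M i \<Longrightarrow> m' \<in> grade ver'.M j \<Longrightarrow> B m m' = 0"
    and "\<And>w f. w \<in> carrier W \<Longrightarrow> f \<in> carrier (dual_rep G W) \<Longrightarrow>
      B (ver.pt \<one>\<^bsub>H\<^esub> w) (ver'.pt \<one>\<^bsub>dual.H\<^esub> f) = f w"
  using assms by (simp_all add: contravariant_form_def Let_def)

text \<open>The invariance clauses of a contravariant form are this identity for generators, and both sides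
  are compatible with sums and products.\<close>

lemma form_adjoint:
  assumes B: "contravariant_form G V t c W B"
    and "r \<in> carrier dual.H" "m \<in> carrier ver.M" "m' \<in> carrier ver'.M"
  shows "B m (r \<odot>\<^bsub>ver'.M\<^esub> m') = B (adjoint r \<odot>\<^bsub>ver.M\<^esub> m) m'"
  using assms(2-4)
proof (induction arbitrary: m m' rule: dual.H_induct)
  case (scalar a)
  then show ?case by (simp add: adjoint_scalar contravariant_formD(3,4)[OF B])
next
  case (letter z)
  show ?case
  proof (cases z)
    case (Grp g)
    then show ?thesis using letter contravariant_formD(5)[OF B, of "inv\<^bsub>G\<^esub> g" m m']
      by (simp add: adjoint_letter)
  next
    case (Vec x)
    then show ?thesis using letter contravariant_formD(7)[OF B, of x m m']
      by (simp add: adjoint_letter)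
  next
    case (Cov \<xi>)
    then obtain y where "y \<in> carrier V" "\<xi> = eval y" using letter eval_surj by auto
    then show ?thesis using letter Cov contravariant_formD(6)[OF B, of y m m']
      by (simp add: adjoint_letter)
  qed
next
  case (add r s)
  have "B m ((r \<oplus>\<^bsub>dual.H\<^esub> s) \<odot>\<^bsub>ver'.M\<^esub> m') = B m (r \<odot>\<^bsub>ver'.M\<^esub> m') + B m (s \<odot>\<^bsub>ver'.M\<^esub> m')"
    using add by (simp add: ver'.vm.lm.smult_l_distr contravariant_formD(2)[OF B] ver'.M_smult_closed)
  also have "\<dots> = B (adjoint (r \<oplus>\<^bsub>dual.H\<^esub> s) \<odot>\<^bsub>ver.M\<^esub> m) m'"
    using add by (simp add: adjoint_add ver.vm.lm.smult_l_distr contravariant_formD(1)[OF B] ver.M_smult_closed)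
  finally show ?case .
next
  case (mult r s)
  thus ?case
    by (simp add: adjoint_mult ver'.vm.lm.smult_assoc ver.vm.lm.smult_assoc ver'.M_smult_closed ver.M_smult_closed)
qed

abbreviation "K \<equiv> form_kernel G V t c W"

lemma form_kernel_iff:
  "m \<in> K \<longleftrightarrow> m \<in> carrier ver.M \<and>
    (\<forall>B. contravariant_form G V t c W B \<longrightarrow> (\<forall>m'\<in>carrier ver'.M. B m m' = 0))"
  by (auto simp: form_kernel_def)

text \<open>Stability under the algebra holds because every element is an adjoint and can be moved to the second
  argument.\<close>

lemma form_kernel_submodule: "Module.submodule K H ver.M"
proof (rule ver.vm.submodule_crit)
  show "K \<subseteq> carrier ver.M" by (auto simp: form_kernel_iff)
  have "B \<zero>\<^bsub>ver.M\<^esub> m' = 0" if "contravariant_form G V t c W B" "m' \<in> carrier ver'.M" for B m'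
  proof -
    have z: "\<zero>\<^bsub>ver.M\<^esub> \<in> carrier ver.M" "\<zero>\<^bsub>ver.M\<^esub> \<oplus>\<^bsub>ver.M\<^esub> \<zero>\<^bsub>ver.M\<^esub> = \<zero>\<^bsub>ver.M\<^esub>" by simp_all
    show ?thesis
      using contravariant_formD(1)[OF that(1) z(1) z(1) that(2)] unfolding z(2)
      by (simp only: add_cancel_right_right)
  qed
  thus "\<zero>\<^bsub>ver.M\<^esub> \<in> K" by (simp add: form_kernel_iff)
  show "u \<oplus>\<^bsub>ver.M\<^esub> v \<in> K" if "u \<in> K" "v \<in> K" for u v
    using that by (auto simp: form_kernel_iff contravariant_formD(1))
  show "r \<odot>\<^bsub>ver.M\<^esub> u \<in> K" if r: "r \<in> carrier H" and u: "u \<in> K" for r u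
  proof -
    obtain s where s: "s \<in> carrier dual.H" "adjoint s = r" using adjoint_surj[OF r] by blast
    have "B (r \<odot>\<^bsub>ver.M\<^esub> u) m' = 0" if "contravariant_form G V t c W B" "m' \<in> carrier ver'.M" for B m'
      using form_adjoint[OF that(1) s(1), of u m'] that u s ver'.M_smult_closed by (auto simp: form_kernel_iff)
    thus ?thesis using u r ver.M_smult_closed by (auto simp: form_kernel_iff)
  qed
qed

sublocale kq: module_quotient "carrier H" ver.M K
  using form_kernel_submodule ver.M_abelian_group ver.M_smult_closed ver.M_smult_add
  by (intro module_quotient.intro) (auto simp: Module.submodule_def Module.submodule_axioms_def)

end

lemma (in cherednik_duality) contravariantI: "is_rep G W \<Longrightarrow> contravariant G V W"
  by (intro contravariant.intro verma_setting.intro verma_setting_axioms.intro cherednik_duality_axioms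
      cherednik_algebra_axioms dual.cherednik_algebra_axioms dual_is_rep[OF grp])

section \<open>The lowest degree of an irreducible module\<close>

locale irreducible_module = cherednik_duality G V t c
  for G :: "'g monoid" and V :: "('g, 'k::field, 'v) rep" and t :: 'k and c :: "'g \<Rightarrow> 'k" +
  fixes L :: "(('g, 'k, 'v) cher, 'l) gmodule"
  assumes irr: "irreducible_O G V t c L"
begin

lemma L_gmodule: "is_gmodule H (cher_grade G V t c) L"
  using irr by (simp add: irreducible_O_def category_O_def)

lemma L_fin_dim: "vectorspace.fin_dim class_ring (scalars G V t c L)"
  using irr by (simp add: irreducible_O_def category_O_def)

lemma L_nonzero: "carrier L \<noteq> {\<zero>\<^bsub>L\<^esub>}"
  using irr by (simp add: irreducible_O_def)

lemma L_simple: "is_gsubmodule H N L \<Longrightarrow> N = {\<zero>\<^bsub>L\<^esub>} \<or> N = carrier L"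
  using irr by (simp add: irreducible_O_def)

sublocale gr: graded_module H "cher_grade G V t c" L
  by (rule graded_module.intro[OF L_gmodule]) (use grade_carrier in blast)

sublocale cm: cherednik_module G V t c L
  by (rule cherednik_module.intro[OF cherednik_algebra_axioms cherednik_module_axioms.intro])
    (rule gr.lm.left_module_axioms)

lemma gsubmodule_crit:
  assumes "U \<subseteq> carrier L" "\<zero>\<^bsub>L\<^esub> \<in> U" "\<And>u v. u \<in> U \<Longrightarrow> v \<in> U \<Longrightarrow> u \<oplus>\<^bsub>L\<^esub> v \<in> U"
    and "\<And>r u. r \<in> carrier H \<Longrightarrow> u \<in> U \<Longrightarrow> r \<odot>\<^bsub>L\<^esub> u \<in> U"
    and "\<And>k u. u \<in> U \<Longrightarrow> component L k u \<in> U"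
  shows "U = {\<zero>\<^bsub>L\<^esub>} \<or> U = carrier L"
proof (rule L_simple)
  have "homog_decomp L u (\<lambda>k. component L k u)" if "u \<in> U" for u
    using gr.component_decomp assms(1) that by blast
  thus "is_gsubmodule H U L"
    unfolding is_gsubmodule_def using cm.submodule_crit[OF assms(1-4)] assms(5) by blast
qed

lemma comp_scalar: "v \<in> carrier L \<Longrightarrow> component L k (E (sc a) \<odot>\<^bsub>L\<^esub> v) = E (sc a) \<odot>\<^bsub>L\<^esub> component L k v"
  using gr.component_smult[OF grade_scalar, of v k a] by simp

lemma scalars_vs: "vectorspace class_ring (scalars G V t c L)"
  by (rule cm.scalar_vectorspace) (auto simp: scalars_def)

lemma scalars_simps [simp]:
  "carrier (scalars G V t c L) = carrier L" "\<zero>\<^bsub>scalars G V t c L\<^esub> = \<zero>\<^bsub>L\<^esub>"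
  "add (scalars G V t c L) = add L" "a \<odot>\<^bsub>scalars G V t c L\<^esub> v = E (sc a) \<odot>\<^bsub>L\<^esub> v"
  by (simp_all add: scalars_def)

text \<open>A finite spanning set has only finitely many nonzero homogeneous components.\<close>

lemma grades_bounded_below: "\<exists>b. \<forall>k<b. grade L k = {\<zero>\<^bsub>L\<^esub>}"
proof -
  let ?S = "scalars G V t c L"
  interpret S: vectorspace class_ring ?S by (rule scalars_vs)
  obtain A where A: "finite A" "A \<subseteq> carrier L" "S.span A = carrier ?S"
    using L_fin_dim unfolding S.fin_dim_def by auto
  have "finite (\<Union>a\<in>A. {k. component L k a \<noteq> \<zero>\<^bsub>L\<^esub>})"
    using A gr.homog_decompD(2)[OF gr.component_decomp] by auto
  then obtain b where b: "\<forall>k\<in>(\<Union>a\<in>A. {k. component L k a \<noteq> \<zero>\<^bsub>L\<^esub>}). b \<le> k"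
    using bdd_below_finite unfolding bdd_below_def by blast
  let ?U = "{v \<in> carrier L. \<forall>k<b. component L k v = \<zero>\<^bsub>L\<^esub>}"
  have "LinearCombinations.submodule class_ring ?U ?S"
    by (rule LinearCombinations.submodule.intro[OF S.module_axioms])
      (auto simp: gr.component_add comp_scalar)
  moreover have "A \<subseteq> ?U"
  proof
    fix a assume a: "a \<in> A"
    have "component L k a = \<zero>\<^bsub>L\<^esub>" if "k < b" for k
    proof (rule ccontr)
      assume "component L k a \<noteq> \<zero>\<^bsub>L\<^esub>"
      hence "b \<le> k" using b a by blast
      thus False using that by simp
    qed
    thus "a \<in> ?U" using a A(2) by blast
  qed
  ultimately have "carrier L \<subseteq> ?U" using S.span_is_subset[of A ?U] A(3) by simp
  hence "grade L k \<subseteq> {\<zero>\<^bsub>L\<^esub>}" if "k < b" for k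
    using that gr.component_homogeneous gr.grade_closed by fastforce
  thus ?thesis using gr.grade_zero by blast
qed

lemma exists_lowest_degree: "\<exists>d. grade L d \<noteq> {\<zero>\<^bsub>L\<^esub>} \<and> (\<forall>k<d. grade L k = {\<zero>\<^bsub>L\<^esub>})"
proof -
  obtain b where b: "\<And>k. k < b \<Longrightarrow> grade L k = {\<zero>\<^bsub>L\<^esub>}" using grades_bounded_below by blast
  have "\<exists>k. grade L k \<noteq> {\<zero>\<^bsub>L\<^esub>}"
  proof (rule ccontr)
    assume "\<not> (\<exists>k. grade L k \<noteq> {\<zero>\<^bsub>L\<^esub>})"
    hence g: "grade L k = {\<zero>\<^bsub>L\<^esub>}" for k by simp
    have "v = \<zero>\<^bsub>L\<^esub>" if "v \<in> carrier L" for v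
    proof (rule gr.component_eqI[OF that])
      show "component L k v = component L k \<zero>\<^bsub>L\<^esub>" for k using gr.component_grade[OF that, of k] g[of k] by simp
    qed simp
    thus False using L_nonzero by auto
  qed
  then obtain k where k: "grade L k \<noteq> {\<zero>\<^bsub>L\<^esub>}" ..
  hence "b \<le> k" using b by force
  \<comment> \<open>Degrees are counted from the bound \<open>b\<close>, so that the least one is a least natural number.\<close>
  hence ex: "grade L (b + int (nat (k - b))) \<noteq> {\<zero>\<^bsub>L\<^esub>}" using k by simp
  define n where "n = (LEAST n. grade L (b + int n) \<noteq> {\<zero>\<^bsub>L\<^esub>})"
  have "grade L (b + int n) \<noteq> {\<zero>\<^bsub>L\<^esub>}" unfolding n_def using ex by (rule LeastI)
  moreover have "grade L j = {\<zero>\<^bsub>L\<^esub>}" if "j < b + int n" for j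
  proof (cases "j < b")
    case False
    hence j: "j = b + int (nat (j - b))" "nat (j - b) < n" using that by auto
    show ?thesis using not_less_Least[OF j(2)[unfolded n_def]] j(1) by simp
  qed (use b in simp)
  ultimately show ?thesis by blast
qed

end

locale lowest_degree = irreducible_module G V t c L
  for G :: "'g monoid" and V :: "('g, 'k::field, 'v) rep" and t :: 'k and c :: "'g \<Rightarrow> 'k"
    and L :: "(('g, 'k, 'v) cher, 'l) gmodule" +
  fixes d :: int
  assumes d_nonzero: "grade L d \<noteq> {\<zero>\<^bsub>L\<^esub>}" and below_d: "\<And>k. k < d \<Longrightarrow> grade L k = {\<zero>\<^bsub>L\<^esub>}"
begin

lemma grade_scalar_closed: "v \<in> grade L k \<Longrightarrow> E (sc a) \<odot>\<^bsub>L\<^esub> v \<in> grade L k"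
  using gr.grade_smult[OF grade_scalar] by fastforce

lemma grade_grp_closed: "g \<in> carrier G \<Longrightarrow> v \<in> grade L k \<Longrightarrow> E (lt (Grp g)) \<odot>\<^bsub>L\<^esub> v \<in> grade L k"
  using gr.grade_smult[OF grade_letter, of "Grp g" v k] by simp

lemma vec_kills_lowest: "y \<in> carrier V \<Longrightarrow> v \<in> grade L d \<Longrightarrow> E (lt (Vec y)) \<odot>\<^bsub>L\<^esub> v = \<zero>\<^bsub>L\<^esub>"
  using gr.grade_smult[OF grade_letter, of "Vec y" v d] below_d[of "d - 1"] by simp

text \<open>The elements whose components lie in the spaces \<open>cov_span\<close> over \<open>U\<close> form a nonzero graded submodule,
  hence all of \<open>L\<close>.\<close>

lemma generated_by_lowest:
  assumes U: "U \<subseteq> grade L d" "\<zero>\<^bsub>L\<^esub> \<in> U" "U \<noteq> {\<zero>\<^bsub>L\<^esub>}"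
    and add: "\<And>u v. u \<in> U \<Longrightarrow> v \<in> U \<Longrightarrow> u \<oplus>\<^bsub>L\<^esub> v \<in> U"
    and sc: "\<And>a v. v \<in> U \<Longrightarrow> E (sc a) \<odot>\<^bsub>L\<^esub> v \<in> U"
    and grp: "\<And>g v. g \<in> carrier G \<Longrightarrow> v \<in> U \<Longrightarrow> E (lt (Grp g)) \<odot>\<^bsub>L\<^esub> v \<in> U"
  shows "lowest_weight_space G V t c L U"
    and "\<And>v k. v \<in> grade L k \<Longrightarrow> lowest_weight_space.cov_span G V t c L U (k - d) v"
proof -
  have UL: "U \<subseteq> carrier L" using U(1) gr.grade_closed by blast
  show low: "lowest_weight_space G V t c L U"
  proof (rule lowest_weight_space.intro[OF cm.cherednik_module_axioms lowest_weight_space_axioms.intro])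
    show "E (lt (Vec y)) \<odot>\<^bsub>L\<^esub> w = \<zero>\<^bsub>L\<^esub>" if "y \<in> carrier V" "w \<in> U" for y w
      using vec_kills_lowest[OF that(1)] that(2) U(1) by blast
  qed (simp_all add: UL U(2) add sc grp)
  interpret low: lowest_weight_space G V t c L U by (rule low)
  let ?N = "{v \<in> carrier L. \<forall>k. low.cov_span (k - d) (component L k v)}"
  have sm: "low.cov_span (k - d) (component L k (r \<odot>\<^bsub>L\<^esub> u))"
    if r: "r \<in> carrier H" and u: "u \<in> ?N" for r u k
    using r
  proof (induction rule: homogeneous_induct)
    case (homogeneous i r)
    have "low.cov_span (i + (k - i - d)) (r \<odot>\<^bsub>L\<^esub> component L (k - i) u)"
      using u by (intro low.cov_span_smult[OF homogeneous]) blast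
    thus ?case using gr.component_smult[OF homogeneous] u by simp
  next
    case (add r s)
    thus ?case using u
      by (simp add: gr.lm.smult_l_distr gr.component_add gr.lm.smult_closed low.cov_span.add)
  qed
  have "?N = {\<zero>\<^bsub>L\<^esub>} \<or> ?N = carrier L"
  proof (rule gsubmodule_crit)
    show "r \<odot>\<^bsub>L\<^esub> u \<in> ?N" if "r \<in> carrier H" "u \<in> ?N" for r u
      using sm[OF that] that gr.lm.smult_closed by blast
    show "component L k u \<in> ?N" if "u \<in> ?N" for k u
    proof -
      have u: "u \<in> carrier L" "\<And>j. low.cov_span (j - d) (component L j u)" using that by auto
      have "low.cov_span (j - d) (component L j (component L k u))" for j
        using gr.component_homogeneous[OF gr.component_grade[OF u(1)], of j k] u(2)[of k]
        by (simp add: low.cov_span.zero)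
      thus ?thesis using u by simp
    qed
  qed (auto simp: low.cov_span.zero gr.component_add intro: low.cov_span.add)
  moreover obtain u where u: "u \<in> U" "u \<noteq> \<zero>\<^bsub>L\<^esub>" using U by blast
  have "u \<in> ?N"
  proof -
    have "u \<in> grade L d" using u U by blast
    hence "low.cov_span (k - d) (component L k u)" for k
      using gr.component_homogeneous[of u d k] low.cov_span.base[OF u(1)]
      by (auto simp: low.cov_span.zero)
    thus ?thesis using u UL by blast
  qed
  ultimately have N: "?N = carrier L" using u(2) by blast
  fix v k assume v: "v \<in> grade L k"
  hence "v \<in> ?N" unfolding N using gr.grade_closed by blast
  hence "low.cov_span (k - d) (component L k v)" by blast
  thus "low.cov_span (k - d) v" using gr.component_homogeneous[OF v, of k] by simp
qed

abbreviation "\<tau> \<equiv> cm.subspace_rep (grade L d)"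

lemma \<tau>_rep: "is_rep G \<tau>"
  by (rule cm.subspace_is_rep)
    (use gr.grade_closed gr.grade_add grade_scalar_closed grade_grp_closed in auto)

lemma \<tau>_fin_dim: "vectorspace.fin_dim class_ring \<tau>"
proof -
  let ?S = "scalars G V t c L"
  have "linear_map class_ring ?S \<tau> (component L d)"
    by (rule linear_mapI[OF scalars_vs is_repD(1)[OF \<tau>_rep]]) (simp_all add: gr.component_add comp_scalar)
  then interpret T: linear_map class_ring ?S \<tau> "component L d" .
  have "component L d ` carrier ?S = carrier \<tau>"
  proof
    show "carrier \<tau> \<subseteq> component L d ` carrier ?S"
    proof
      fix v assume "v \<in> carrier \<tau>"
      hence v: "v \<in> grade L d" by simp
      show "v \<in> component L d ` carrier ?S"
        using gr.component_homogeneous[OF v, of d] gr.grade_closed[OF v] by (intro image_eqI[of _ _ v]) auto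
    qed
  qed auto
  thus ?thesis using T.rank_nullity_main(2) L_fin_dim by blast
qed

text \<open>A nonzero stable subspace \<open>U\<close> generates \<open>L\<close>, but the part of degree \<open>d\<close> of what it generates is only \<open>U\<close>.\<close>

lemma \<tau>_irreducible: "irreducible_rep G \<tau>"
  unfolding irreducible_rep_def fin_dim_rep_def
proof (intro conjI allI impI \<tau>_rep \<tau>_fin_dim)
  show "carrier \<tau> \<noteq> {\<zero>\<^bsub>\<tau>\<^esub>}" using d_nonzero by simp
  fix U assume *: "VectorSpace.subspace class_ring U \<tau> \<and> (\<forall>g\<in>carrier G. \<forall>w\<in>U. act \<tau> g w \<in> U)"
  interpret U: LinearCombinations.submodule class_ring U \<tau>
    using * by (simp add: VectorSpace.subspace_def)
  show "U = {\<zero>\<^bsub>\<tau>\<^esub>} \<or> U = carrier \<tau>"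
  proof (rule disjCI)
    assume "U \<noteq> carrier \<tau>"
    show "U = {\<zero>\<^bsub>\<tau>\<^esub>}"
    proof (rule ccontr)
      assume nz: "U \<noteq> {\<zero>\<^bsub>\<tau>\<^esub>}"
      have sub: "U \<subseteq> grade L d" using U.subset by simp
      note gen = generated_by_lowest[OF sub]
      have 1: "\<zero>\<^bsub>L\<^esub> \<in> U" "U \<noteq> {\<zero>\<^bsub>L\<^esub>}" using U.zero_closed nz by simp_all
      have 2: "u \<oplus>\<^bsub>L\<^esub> v \<in> U" if "u \<in> U" "v \<in> U" for u v using U.m_closed[OF that] by simp
      have 3: "E (sc a) \<odot>\<^bsub>L\<^esub> v \<in> U" if "v \<in> U" for a v using U.smult_closed[of a v] that by simp
      have 4: "E (lt (Grp g)) \<odot>\<^bsub>L\<^esub> v \<in> U" if "g \<in> carrier G" "v \<in> U" for g v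
        using * that by simp
      interpret low: lowest_weight_space G V t c L U by (rule gen(1)[OF 1 2 3 4])
      have "v \<in> U" if "v \<in> grade L d" for v
        using gen(2)[OF 1 2 3 4 that] low.cov_span_degree_zero by simp
      hence "U = carrier \<tau>" using sub by auto
      thus False using \<open>U \<noteq> carrier \<tau>\<close> by blast
    qed
  qed
qed

sublocale low: lowest_weight_space G V t c L "grade L d"
  by (rule generated_by_lowest(1))
    (use d_nonzero gr.grade_add grade_scalar_closed grade_grp_closed in auto)

lemma cov_span_grade: "v \<in> grade L k \<Longrightarrow> low.cov_span (k - d) v"
  by (rule generated_by_lowest(2))
    (use d_nonzero gr.grade_add grade_scalar_closed grade_grp_closed in auto)

lemma contravariant_\<tau>: "contravariant G V \<tau>"
  by (rule contravariantI[OF \<tau>_rep])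

sublocale contravariant G V t c \<tau>
  by (rule contravariant_\<tau>)

section \<open>The projection of the Verma module\<close>

lemma action_on_lowest: "(b, w, u) \<in> ver.X \<Longrightarrow> b \<odot>\<^bsub>L\<^esub> w = u"
proof (induction rule: kGSh_action.induct)
  case (vec y w)
  then show ?case by (simp add: vec_kills_lowest)
next
  case (sum b w u b' u')
  have "b \<in> carrier H" "b' \<in> carrier H" "w \<in> carrier L"
    using ver.X_closed[OF sum.hyps(1)] ver.X_closed[OF sum.hyps(2)] gr.grade_closed by auto
  then show ?case using sum.IH by (simp add: gr.lm.smult_l_distr)
next
  case (prod b w u b' u')
  have "b \<in> carrier H" "b' \<in> carrier H" "w \<in> carrier L"
    using ver.X_closed[OF prod.hyps(1)] ver.X_closed[OF prod.hyps(2)] gr.grade_closed by auto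
  then show ?case using prod.IH by (simp add: gr.lm.smult_assoc)
qed auto

lemma projection_exists:
  "\<exists>\<pi>. (\<forall>m\<in>carrier ver.M. \<pi> m \<in> carrier L) \<and>
    (\<forall>m\<in>carrier ver.M. \<forall>n\<in>carrier ver.M. \<pi> (m \<oplus>\<^bsub>ver.M\<^esub> n) = \<pi> m \<oplus>\<^bsub>L\<^esub> \<pi> n) \<and>
    (\<forall>r\<in>carrier H. \<forall>w\<in>grade L d. \<pi> (ver.pt r w) = r \<odot>\<^bsub>L\<^esub> w)"
proof -
  have cl: "w \<in> carrier L" if "w \<in> carrier \<tau>" for w using that gr.grade_closed by simp
  obtain \<pi> where "\<And>m. m \<in> carrier ver.M \<Longrightarrow> \<pi> m \<in> carrier L"
    "\<And>m n. m \<in> carrier ver.M \<Longrightarrow> n \<in> carrier ver.M \<Longrightarrow> \<pi> (m \<oplus>\<^bsub>ver.M\<^esub> n) = \<pi> m \<oplus>\<^bsub>L\<^esub> \<pi> n"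
    "\<And>r w. r \<in> carrier H \<Longrightarrow> w \<in> carrier \<tau> \<Longrightarrow> \<pi> (ver.pt r w) = r \<odot>\<^bsub>L\<^esub> w"
  proof (rule ver.verma_universal[of L "\<lambda>r w. r \<odot>\<^bsub>L\<^esub> w"])
    show "abelian_group L" by (rule gr.lm.M.abelian_group_axioms)
    show "(r \<otimes>\<^bsub>H\<^esub> b) \<odot>\<^bsub>L\<^esub> w = r \<odot>\<^bsub>L\<^esub> u" if "r \<in> carrier H" "(b, w, u) \<in> ver.X" for r b w u
      using action_on_lowest[OF that(2)] ver.X_closed[OF that(2)] that(1) cl
      by (auto simp: gr.lm.smult_assoc)
  qed (use cl in \<open>auto simp: gr.lm.smult_l_distr gr.lm.smult_r_distr gr.lm.smult_closed\<close>)
  thus ?thesis by (intro exI[of _ \<pi>]) auto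
qed

text \<open>The projection \<open>r \<otimes> w \<mapsto> r w\<close> of the Verma module of the lowest weight space.\<close>

definition \<pi> where "\<pi> = (SOME \<pi>. (\<forall>m\<in>carrier ver.M. \<pi> m \<in> carrier L) \<and>
    (\<forall>m\<in>carrier ver.M. \<forall>n\<in>carrier ver.M. \<pi> (m \<oplus>\<^bsub>ver.M\<^esub> n) = \<pi> m \<oplus>\<^bsub>L\<^esub> \<pi> n) \<and>
    (\<forall>r\<in>carrier H. \<forall>w\<in>grade L d. \<pi> (ver.pt r w) = r \<odot>\<^bsub>L\<^esub> w))"

lemma \<pi>_closed [simp]: "m \<in> carrier ver.M \<Longrightarrow> \<pi> m \<in> carrier L"
  and \<pi>_add: "m \<in> carrier ver.M \<Longrightarrow> n \<in> carrier ver.M \<Longrightarrow>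
    \<pi> (m \<oplus>\<^bsub>ver.M\<^esub> n) = \<pi> m \<oplus>\<^bsub>L\<^esub> \<pi> n"
  and \<pi>_pt: "r \<in> carrier H \<Longrightarrow> w \<in> grade L d \<Longrightarrow> \<pi> (ver.pt r w) = r \<odot>\<^bsub>L\<^esub> w"
  using someI_ex[OF projection_exists] unfolding \<pi>_def[symmetric] by blast+

lemma \<pi>_smult:
  assumes s: "s \<in> carrier H" and "m \<in> carrier ver.M"
  shows "\<pi> (s \<odot>\<^bsub>ver.M\<^esub> m) = s \<odot>\<^bsub>L\<^esub> \<pi> m"
  using assms(2)
proof (induction rule: ver.verma_induct)
  case (pure i r w)
  have "r \<in> carrier H" "w \<in> grade L d" "w \<in> carrier L" using pure grade_carrier gr.grade_closed by auto
  moreover have "s \<otimes>\<^bsub>H\<^esub> r \<in> carrier H" using calculation s by simp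
  ultimately show ?case using s by (simp add: ver.pt_smult \<pi>_pt gr.lm.smult_assoc)
next
  case (add m n)
  then show ?case using s by (simp add: ver.M_smult_add ver.M_smult_closed \<pi>_add gr.lm.smult_r_distr)
qed

lemma \<pi>_zero [simp]: "\<pi> \<zero>\<^bsub>ver.M\<^esub> = \<zero>\<^bsub>L\<^esub>"
proof -
  have "\<pi> \<zero>\<^bsub>ver.M\<^esub> = \<zero>\<^bsub>H\<^esub> \<odot>\<^bsub>L\<^esub> \<pi> \<zero>\<^bsub>ver.M\<^esub>"
    using \<pi>_smult[of "\<zero>\<^bsub>H\<^esub>" "\<zero>\<^bsub>ver.M\<^esub>"] by simp
  thus ?thesis by simp
qed

lemma \<pi>_grade: "m \<in> grade ver.M i \<Longrightarrow> \<pi> m \<in> grade L (i + d)"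
proof (induction rule: ver.verma_grade_induct)
  case (pure r w)
  then show ?case using grade_carrier gr.grade_smult by (simp add: \<pi>_pt)
next
  case (add m n)
  then show ?case by (simp add: \<pi>_add gr.grade_add)
qed

text \<open>The generating process of \<open>cov_span\<close> can be repeated in the Verma module.\<close>

lemma \<pi>_grade_surj:
  assumes "v \<in> grade L k"
  shows "\<exists>m\<in>grade ver.M (k - d). \<pi> m = v"
proof -
  have "\<exists>m\<in>grade ver.M j. \<pi> m = v" if "low.cov_span j v" for j v
    using that
  proof (induction rule: low.cov_span.induct)
    case (base w)
    have "\<one>\<^bsub>H\<^esub> \<in> cher_grade G V t c 0" using grade_scalar[of 1] by (simp add: sc_one E_one)
    hence "ver.pt \<one>\<^bsub>H\<^esub> w \<in> grade ver.M 0" using base by (intro ver.pt_grade) auto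
    moreover have "\<pi> (ver.pt \<one>\<^bsub>H\<^esub> w) = w"
      using base gr.grade_closed by (simp add: \<pi>_pt gr.lm.smult_one)
    ultimately show ?case by blast
  next
    case (zero k)
    show ?case using ver.verma_grade_zero_in \<pi>_zero by blast
  next
    case (add k u v)
    then show ?case using ver.verma_grade_add ver.grade_M_closed \<pi>_add by metis
  next
    case (cov k u x)
    then obtain m where m: "m \<in> grade ver.M k" "\<pi> m = u" by blast
    have "E (lt (Cov x)) \<odot>\<^bsub>ver.M\<^esub> m \<in> grade ver.M (k + 1)"
      using ver.verma_grade_smult[OF grade_letter m(1), of "Cov x"] cov by (simp add: add.commute)
    moreover have "\<pi> (E (lt (Cov x)) \<odot>\<^bsub>ver.M\<^esub> m) = E (lt (Cov x)) \<odot>\<^bsub>L\<^esub> u"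
      using \<pi>_smult m cov ver.grade_M_closed by simp
    ultimately show ?case by blast
  qed
  from this[OF cov_span_grade[OF assms]] show ?thesis .
qed

lemma \<pi>_minus:
  assumes "m \<in> carrier ver.M" "n \<in> carrier ver.M"
  shows "\<pi> (m \<ominus>\<^bsub>ver.M\<^esub> n) = \<pi> m \<ominus>\<^bsub>L\<^esub> \<pi> n"
proof -
  have "\<pi> m = \<pi> (m \<ominus>\<^bsub>ver.M\<^esub> n) \<oplus>\<^bsub>L\<^esub> \<pi> n"
    using \<pi>_add[of "m \<ominus>\<^bsub>ver.M\<^esub> n" n] assms
    by (simp add: a_minus_def ver.vm.lm.M.a_assoc ver.vm.lm.M.l_neg)
  moreover have "m \<ominus>\<^bsub>ver.M\<^esub> n \<in> carrier ver.M" using assms by simp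
  ultimately show ?thesis using assms by (simp add: a_minus_def gr.lm.M.a_assoc gr.lm.M.r_neg)
qed

lemma \<pi>_surj:
  assumes "v \<in> carrier L"
  shows "\<exists>m\<in>carrier ver.M. \<pi> m = v"
proof -
  let ?U = "\<pi> ` carrier ver.M"
  have comp: "component L k v \<in> ?U" for k
  proof -
    obtain m where m: "m \<in> grade ver.M (k - d)" "\<pi> m = component L k v"
      using \<pi>_grade_surj[OF gr.component_grade[OF assms]] by blast
    show ?thesis unfolding m(2)[symmetric] using ver.grade_M_closed[OF m(1)] by (rule imageI)
  qed
  have zero: "\<zero>\<^bsub>L\<^esub> \<in> ?U"
  proof -
    have "\<pi> \<zero>\<^bsub>ver.M\<^esub> \<in> ?U" by (rule imageI[OF ver.vm.lm.M.zero_closed])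
    thus ?thesis by (simp only: \<pi>_zero)
  qed
  have add: "x \<oplus>\<^bsub>L\<^esub> y \<in> ?U" if xy: "x \<in> ?U" "y \<in> ?U" for x y
  proof -
    obtain m where m: "x = \<pi> m" "m \<in> carrier ver.M" using xy(1) by (rule imageE)
    obtain n where n: "y = \<pi> n" "n \<in> carrier ver.M" using xy(2) by (rule imageE)
    have "\<pi> (m \<oplus>\<^bsub>ver.M\<^esub> n) \<in> ?U" by (rule imageI[OF ver.vm.lm.M.a_closed[OF m(2) n(2)]])
    thus ?thesis by (simp only: \<pi>_add[OF m(2) n(2)] m(1) n(1))
  qed
  have "v \<in> ?U" by (rule gr.component_sum_closed[OF assms comp zero add])
  thus ?thesis by blast
qed

section \<open>The contravariant form through the irreducible module\<close>

lemma functional_props: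
  assumes "f \<in> carrier (dual_rep G \<tau>)"
  shows "\<And>u v. u \<in> grade L d \<Longrightarrow> v \<in> grade L d \<Longrightarrow> f (u \<oplus>\<^bsub>L\<^esub> v) = f u + f v"
    and "\<And>a v. v \<in> grade L d \<Longrightarrow> f (E (sc a) \<odot>\<^bsub>L\<^esub> v) = a * f v"
    and "f \<zero>\<^bsub>L\<^esub> = 0"
proof -
  have f: "f \<in> functionals \<tau>" using assms by (simp add: dual_rep_simps)
  show "f (u \<oplus>\<^bsub>L\<^esub> v) = f u + f v" if "u \<in> grade L d" "v \<in> grade L d" for u v
    using functionalsD(1)[OF f, of u v] that by simp
  show "f (E (sc a) \<odot>\<^bsub>L\<^esub> v) = a * f v" if "v \<in> grade L d" for a v
    using functionalsD(2)[OF f, of v a] that by simp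
  show "f \<zero>\<^bsub>L\<^esub> = 0" using functional_zero[OF is_repD(1)[OF \<tau>_rep] f] by simp
qed

text \<open>This is the balancing condition for the pairing of the dual Verma module with \<open>L\<close>. The adjoint of
  \<open>x \<in> \<hh>\<^sup>*\<close> is multiplication by \<open>x\<close>, which has no component in degree \<open>d\<close> because \<open>L\<close> vanishes in degree
  \<open>d - 1\<close>.\<close>

lemma dual_action_on_lowest:
  assumes "(b, f, u) \<in> ver'.X" "v \<in> carrier L"
  shows "f (component L d (adjoint b \<odot>\<^bsub>L\<^esub> v)) = u (component L d v)"
  using assms
proof (induction arbitrary: v rule: kGSh_action.induct)
  case (scalar f a)
  have "component L d v \<in> grade L d" using scalar by simp
  thus ?case using scalar
    by (simp add: adjoint_scalar comp_scalar functional_props dual_rep_simps)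
next
  case (grp g f)
  have "component L d v \<in> grade L d" using grp by simp
  thus ?case using grp gr.component_smult[OF grade_letter, of "Grp (inv\<^bsub>G\<^esub> g)" v d]
    by (simp add: adjoint_letter dual_rep_simps)
next
  case (vec x f)
  have "component L d (E (lt (Cov x)) \<odot>\<^bsub>L\<^esub> v) = E (lt (Cov x)) \<odot>\<^bsub>L\<^esub> component L (d - 1) v"
    using gr.component_smult[OF grade_letter, of "Cov x" v d] vec by simp
  also have "component L (d - 1) v = \<zero>\<^bsub>L\<^esub>"
    using below_d[of "d - 1"] gr.component_grade[OF vec(3), of "d - 1"] by simp
  finally show ?case using vec functional_props(3)[OF vec(2)]
    by (simp add: adjoint_letter dual_rep_simps)
next
  case (sum b f u b' u')
  have cl: "b \<in> carrier dual.H" "b' \<in> carrier dual.H" "f \<in> carrier (dual_rep G \<tau>)"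
    using ver'.X_closed[OF sum.hyps(1)] ver'.X_closed[OF sum.hyps(2)] by auto
  have "component L d (adjoint (b \<oplus>\<^bsub>dual.H\<^esub> b') \<odot>\<^bsub>L\<^esub> v) =
      component L d (adjoint b \<odot>\<^bsub>L\<^esub> v) \<oplus>\<^bsub>L\<^esub> component L d (adjoint b' \<odot>\<^bsub>L\<^esub> v)"
    using cl sum.prems by (simp add: adjoint_add gr.lm.smult_l_distr gr.component_add gr.lm.smult_closed)
  moreover have "component L d (adjoint b \<odot>\<^bsub>L\<^esub> v) \<in> grade L d" "component L d (adjoint b' \<odot>\<^bsub>L\<^esub> v) \<in> grade L d"
    using cl sum.prems by (simp_all add: gr.lm.smult_closed)
  ultimately show ?case using cl sum.IH sum.prems
    by (simp add: functional_props(1) dual_rep_simps)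
next
  case (prod b f u b' u')
  have cl: "b \<in> carrier dual.H" "b' \<in> carrier dual.H"
    using ver'.X_closed[OF prod.hyps(1)] ver'.X_closed[OF prod.hyps(2)] by auto
  have "f (component L d (adjoint (b' \<otimes>\<^bsub>dual.H\<^esub> b) \<odot>\<^bsub>L\<^esub> v)) =
      f (component L d (adjoint b \<odot>\<^bsub>L\<^esub> (adjoint b' \<odot>\<^bsub>L\<^esub> v)))"
    using cl prod.prems by (simp add: adjoint_mult gr.lm.smult_assoc)
  also have "\<dots> = u (component L d (adjoint b' \<odot>\<^bsub>L\<^esub> v))"
    using prod.IH(1)[of "adjoint b' \<odot>\<^bsub>L\<^esub> v"] cl prod.prems by (simp add: gr.lm.smult_closed)
  also have "\<dots> = u' (component L d v)" using prod.IH(2)[OF prod.prems] .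
  finally show ?case .
qed

lemma pairing_exists:
  assumes v: "v \<in> carrier L"
  shows "\<exists>h. (\<forall>m\<in>carrier ver'.M. \<forall>n\<in>carrier ver'.M. h (m \<oplus>\<^bsub>ver'.M\<^esub> n) = h m + h n) \<and>
    (\<forall>r\<in>carrier dual.H. \<forall>f\<in>carrier (dual_rep G \<tau>).
      h (ver'.pt r f) = f (component L d (adjoint r \<odot>\<^bsub>L\<^esub> v)))"
proof -
  let ?b = "\<lambda>r f. f (component L d (adjoint r \<odot>\<^bsub>L\<^esub> v))"
  have cl: "component L d (adjoint r \<odot>\<^bsub>L\<^esub> v) \<in> grade L d" if "r \<in> carrier dual.H" for r
    using that v by (simp add: gr.lm.smult_closed)
  obtain h :: "_ \<Rightarrow> 'k" where "\<And>m. m \<in> carrier ver'.M \<Longrightarrow> h m \<in> carrier class_ring"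
    "\<And>m n. m \<in> carrier ver'.M \<Longrightarrow> n \<in> carrier ver'.M \<Longrightarrow>
      h (m \<oplus>\<^bsub>ver'.M\<^esub> n) = h m \<oplus>\<^bsub>class_ring\<^esub> h n"
    "\<And>r f. r \<in> carrier dual.H \<Longrightarrow> f \<in> carrier (dual_rep G \<tau>) \<Longrightarrow> h (ver'.pt r f) = ?b r f"
  proof (rule ver'.verma_universal[of "class_ring" ?b])
    show "abelian_group (class_ring :: 'k ring)"
      using field_class_ring[where 'k = 'k] by (simp add: field_def domain_def cring_def ring_def)
    fix r r' f assume *: "r \<in> carrier dual.H" "r' \<in> carrier dual.H" "f \<in> carrier (dual_rep G \<tau>)"
    show "?b (r \<oplus>\<^bsub>dual.H\<^esub> r') f = ?b r f \<oplus>\<^bsub>class_ring\<^esub> ?b r' f"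
      using * v cl[OF *(1)] cl[OF *(2)]
      by (simp add: adjoint_add gr.lm.smult_l_distr gr.component_add gr.lm.smult_closed functional_props(1))
  next
    fix r f f' assume *: "r \<in> carrier dual.H" "f \<in> carrier (dual_rep G \<tau>)" "f' \<in> carrier (dual_rep G \<tau>)"
    show "?b r (f \<oplus>\<^bsub>dual_rep G \<tau>\<^esub> f') = ?b r f \<oplus>\<^bsub>class_ring\<^esub> ?b r f'"
      using cl[OF *(1)] by (simp add: dual_rep_simps)
  next
    fix r b f u assume *: "r \<in> carrier dual.H" "(b, f, u) \<in> ver'.X"
    have b: "b \<in> carrier dual.H" using ver'.X_closed[OF *(2)] by simp
    show "?b (r \<otimes>\<^bsub>dual.H\<^esub> b) f = ?b r u"
      using dual_action_on_lowest[OF *(2), of "adjoint r \<odot>\<^bsub>L\<^esub> v"] *(1) b v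
      by (simp add: adjoint_mult gr.lm.smult_assoc gr.lm.smult_closed)
  qed auto
  thus ?thesis by (intro exI[of _ h]) auto
qed

text \<open>The pairing of \<open>L\<close> with the dual Verma module, \<open>\<psi> v (r \<otimes> f) = f ((adjoint r \<cdot> v)\<^sub>d)\<close>.\<close>

definition \<psi> where "\<psi> v = (SOME h.
    (\<forall>m\<in>carrier ver'.M. \<forall>n\<in>carrier ver'.M. h (m \<oplus>\<^bsub>ver'.M\<^esub> n) = h m + h n) \<and>
    (\<forall>r\<in>carrier dual.H. \<forall>f\<in>carrier (dual_rep G \<tau>).
      h (ver'.pt r f) = f (component L d (adjoint r \<odot>\<^bsub>L\<^esub> v))))"

lemma \<psi>_add: "v \<in> carrier L \<Longrightarrow> m \<in> carrier ver'.M \<Longrightarrow> n \<in> carrier ver'.M \<Longrightarrow>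
    \<psi> v (m \<oplus>\<^bsub>ver'.M\<^esub> n) = \<psi> v m + \<psi> v n"
  and \<psi>_pt: "v \<in> carrier L \<Longrightarrow> r \<in> carrier dual.H \<Longrightarrow> f \<in> carrier (dual_rep G \<tau>) \<Longrightarrow>
    \<psi> v (ver'.pt r f) = f (component L d (adjoint r \<odot>\<^bsub>L\<^esub> v))"
  using someI_ex[OF pairing_exists[of v]] unfolding \<psi>_def[symmetric] by blast+

lemma \<psi>_add_left:
  assumes uv: "u \<in> carrier L" "v \<in> carrier L" and "m \<in> carrier ver'.M"
  shows "\<psi> (u \<oplus>\<^bsub>L\<^esub> v) m = \<psi> u m + \<psi> v m"
  using assms(3)
proof (induction rule: ver'.verma_induct)
  case (pure i r f)
  have r: "r \<in> carrier dual.H" using pure dual.grade_carrier by blast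
  have "component L d (adjoint r \<odot>\<^bsub>L\<^esub> w) \<in> grade L d" if "w \<in> carrier L" for w
    using that r by (simp add: gr.lm.smult_closed)
  thus ?case using r uv pure(2)
    by (simp add: \<psi>_pt gr.lm.smult_r_distr gr.component_add gr.lm.smult_closed functional_props(1))
next
  case (add m n)
  thus ?case using uv by (simp add: \<psi>_add)
qed

lemma \<psi>_scalar_left:
  assumes v: "v \<in> carrier L" and "m \<in> carrier ver'.M"
  shows "\<psi> (E (sc a) \<odot>\<^bsub>L\<^esub> v) m = a * \<psi> v m"
  using assms(2)
proof (induction rule: ver'.verma_induct)
  case (pure i r f)
  have r: "r \<in> carrier dual.H" using pure dual.grade_carrier by blast
  have "component L d (adjoint r \<odot>\<^bsub>L\<^esub> v) \<in> grade L d" using v r by (simp add: gr.lm.smult_closed)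
  thus ?case using r v pure(2)
    by (simp add: \<psi>_pt comp_scalar gr.lm.smult_closed functional_props(2) flip: cm.act_scalar_central)
next
  case (add m n)
  thus ?case using v by (simp add: \<psi>_add distrib_left)
qed

lemma \<psi>_adjoint:
  assumes v: "v \<in> carrier L" and s: "s \<in> carrier dual.H" and "m \<in> carrier ver'.M"
  shows "\<psi> v (s \<odot>\<^bsub>ver'.M\<^esub> m) = \<psi> (adjoint s \<odot>\<^bsub>L\<^esub> v) m"
  using assms(3)
proof (induction rule: ver'.verma_induct)
  case (pure i r f)
  have r: "r \<in> carrier dual.H" using pure dual.grade_carrier by blast
  have "s \<otimes>\<^bsub>dual.H\<^esub> r \<in> carrier dual.H" using r s by simp
  thus ?case using r s v pure(2)
    by (simp add: \<psi>_pt ver'.pt_smult adjoint_mult gr.lm.smult_assoc gr.lm.smult_closed)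
next
  case (add m n)
  thus ?case using v s
    by (simp add: \<psi>_add ver'.M_smult_add ver'.M_smult_closed gr.lm.smult_closed)
qed

lemma \<psi>_grade:
  assumes v: "v \<in> grade L (i + d)" and "i \<noteq> j" and "m \<in> grade ver'.M j"
  shows "\<psi> v m = 0"
  using assms(3)
proof (induction rule: ver'.verma_grade_induct)
  case (pure r f)
  have r: "r \<in> carrier dual.H" using pure dual.grade_carrier by blast
  have "adjoint r \<odot>\<^bsub>L\<^esub> v \<in> grade L (- j + (i + d))"
    by (rule gr.grade_smult[OF adjoint_grade[OF pure(1)] v])
  hence "component L d (adjoint r \<odot>\<^bsub>L\<^esub> v) = \<zero>\<^bsub>L\<^esub>"
    using gr.component_homogeneous[of _ "- j + (i + d)" d] assms(2) by simp
  thus ?case using r pure(2) gr.grade_closed[OF v] by (simp add: \<psi>_pt functional_props(3))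
next
  case (add m n)
  thus ?case using gr.grade_closed[OF v] by (simp add: \<psi>_add)
qed

lemma \<psi>_form: "contravariant_form G V t c \<tau> (\<lambda>m m'. \<psi> (\<pi> m) m')"
  unfolding contravariant_form_def Let_def
proof (intro conjI ballI allI impI)
  fix m n m' assume "m \<in> carrier ver.M" "n \<in> carrier ver.M" "m' \<in> carrier ver'.M"
  thus "\<psi> (\<pi> (m \<oplus>\<^bsub>ver.M\<^esub> n)) m' = \<psi> (\<pi> m) m' + \<psi> (\<pi> n) m'"
    by (simp add: \<pi>_add \<psi>_add_left)
next
  fix m m' n' assume "m \<in> carrier ver.M" "m' \<in> carrier ver'.M" "n' \<in> carrier ver'.M"
  thus "\<psi> (\<pi> m) (m' \<oplus>\<^bsub>ver'.M\<^esub> n') = \<psi> (\<pi> m) m' + \<psi> (\<pi> m) n'"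
    by (simp add: \<psi>_add)
next
  fix a m m' assume "m \<in> carrier ver.M" "m' \<in> carrier ver'.M"
  thus "\<psi> (\<pi> (E (sc a) \<odot>\<^bsub>ver.M\<^esub> m)) m' = a * \<psi> (\<pi> m) m'"
    by (simp add: \<pi>_smult \<psi>_scalar_left)
next
  fix a m m' assume "m \<in> carrier ver.M" "m' \<in> carrier ver'.M"
  thus "\<psi> (\<pi> m) (dual.E (sc a) \<odot>\<^bsub>ver'.M\<^esub> m') = a * \<psi> (\<pi> m) m'"
    by (simp add: \<psi>_adjoint adjoint_scalar \<psi>_scalar_left)
next
  fix g m m' assume "g \<in> carrier G" "m \<in> carrier ver.M" "m' \<in> carrier ver'.M"
  thus "\<psi> (\<pi> (E (lt (Grp g)) \<odot>\<^bsub>ver.M\<^esub> m)) m' =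
    \<psi> (\<pi> m) (dual.E (lt (Grp (inv\<^bsub>G\<^esub> g))) \<odot>\<^bsub>ver'.M\<^esub> m')"
    by (simp add: \<pi>_smult \<psi>_adjoint adjoint_letter)
next
  fix y m m' assume "y \<in> carrier V" "m \<in> carrier ver.M" "m' \<in> carrier ver'.M"
  thus "\<psi> (\<pi> (E (lt (Vec y)) \<odot>\<^bsub>ver.M\<^esub> m)) m' =
    \<psi> (\<pi> m) (dual.E (lt (Cov (eval y))) \<odot>\<^bsub>ver'.M\<^esub> m')"
    by (simp add: \<pi>_smult \<psi>_adjoint adjoint_letter eval_closed)
next
  fix x m m' assume "x \<in> carrier D" "m \<in> carrier ver.M" "m' \<in> carrier ver'.M"
  thus "\<psi> (\<pi> (E (lt (Cov x)) \<odot>\<^bsub>ver.M\<^esub> m)) m' =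
    \<psi> (\<pi> m) (dual.E (lt (Vec x)) \<odot>\<^bsub>ver'.M\<^esub> m')"
    by (simp add: \<pi>_smult \<psi>_adjoint adjoint_letter)
next
  fix i j :: int and m m' assume "i \<noteq> j" "m \<in> grade ver.M i" "m' \<in> grade ver'.M j"
  thus "\<psi> (\<pi> m) m' = 0" using \<psi>_grade[OF \<pi>_grade] by blast
next
  fix w f assume w: "w \<in> carrier \<tau>" and f: "f \<in> carrier (dual_rep G \<tau>)"
  have "w \<in> carrier L" "component L d w = w"
    using w gr.grade_closed gr.component_homogeneous[of w d d] by auto
  thus "\<psi> (\<pi> (ver.pt \<one>\<^bsub>H\<^esub> w)) (ver'.pt \<one>\<^bsub>dual.H\<^esub> f) = f w"
    using w f by (simp add: \<pi>_pt gr.lm.smult_one \<psi>_pt adjoint_one)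
qed

text \<open>These elements form a graded submodule that meets degree \<open>d\<close> in zero.\<close>

lemma no_component_in_lowest_degree:
  assumes "v \<in> carrier L" "\<And>r. r \<in> carrier H \<Longrightarrow> component L d (r \<odot>\<^bsub>L\<^esub> v) = \<zero>\<^bsub>L\<^esub>"
  shows "v = \<zero>\<^bsub>L\<^esub>"
proof -
  let ?N = "{v \<in> carrier L. \<forall>r\<in>carrier H. component L d (r \<odot>\<^bsub>L\<^esub> v) = \<zero>\<^bsub>L\<^esub>}"
  have "?N = {\<zero>\<^bsub>L\<^esub>} \<or> ?N = carrier L"
  proof (rule gsubmodule_crit)
    show "u \<oplus>\<^bsub>L\<^esub> v \<in> ?N" if "u \<in> ?N" "v \<in> ?N" for u v
      using that by (simp add: gr.lm.smult_r_distr gr.component_add gr.lm.smult_closed)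
    show "r \<odot>\<^bsub>L\<^esub> u \<in> ?N" if "r \<in> carrier H" "u \<in> ?N" for r u
      using that by (simp add: gr.lm.smult_closed flip: gr.lm.smult_assoc)
    show "component L k u \<in> ?N" if u: "u \<in> ?N" for k u
    proof -
      have uL: "u \<in> carrier L" using u by simp
      have "component L d (r \<odot>\<^bsub>L\<^esub> component L k u) = \<zero>\<^bsub>L\<^esub>" if "r \<in> carrier H" for r
        using that
      proof (induction rule: homogeneous_induct)
        case (homogeneous i r)
        have r: "r \<in> carrier H" using grade_carrier[OF homogeneous] .
        have g: "r \<odot>\<^bsub>L\<^esub> component L k u \<in> grade L (i + k)"
          using gr.grade_smult[OF homogeneous gr.component_grade[OF uL]] .
        show ?case
        proof (cases "d = i + k")
          case True
          hence "component L d (r \<odot>\<^bsub>L\<^esub> u) = r \<odot>\<^bsub>L\<^esub> component L k u"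
            using gr.component_smult[OF homogeneous uL, of d] by simp
          thus ?thesis using u r gr.component_homogeneous[OF g, of d] by auto
        next
          case False
          thus ?thesis using gr.component_homogeneous[OF g, of d] by simp
        qed
      next
        case (add r s)
        thus ?case using uL by (simp add: gr.lm.smult_l_distr gr.component_add gr.lm.smult_closed)
      qed
      thus ?thesis using uL by simp
    qed
  qed auto
  moreover have "?N \<noteq> carrier L"
  proof
    assume N: "?N = carrier L"
    have "w = \<zero>\<^bsub>L\<^esub>" if w: "w \<in> grade L d" for w
    proof -
      have "w \<in> ?N" unfolding N using gr.grade_closed[OF w] .
      hence "component L d (\<one>\<^bsub>H\<^esub> \<odot>\<^bsub>L\<^esub> w) = \<zero>\<^bsub>L\<^esub>" by simp
      thus ?thesis using gr.component_homogeneous[OF w, of d] gr.grade_closed[OF w]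
        by (simp add: gr.lm.smult_one)
    qed
    thus False using d_nonzero gr.grade_zero by blast
  qed
  ultimately have "?N = {\<zero>\<^bsub>L\<^esub>}" by blast
  moreover have "v \<in> ?N" using assms by simp
  ultimately show ?thesis by blast
qed

text \<open>By the grading \<open>1 \<otimes> f\<close> pairs only with the part of degree zero, which is \<open>1 \<otimes> \<tau>\<close>, where the form is
  prescribed. So every contravariant form factors through the projection.\<close>

lemma form_lowest:
  assumes B: "contravariant_form G V t c \<tau> B" and f: "f \<in> carrier (dual_rep G \<tau>)"
    and "m \<in> carrier ver.M"
  shows "B m (ver'.pt \<one>\<^bsub>dual.H\<^esub> f) = f (component L d (\<pi> m))"
  using assms(3)
proof (induction rule: ver.verma_induct)
  case (pure i r w)
  have r: "r \<in> carrier H" using pure grade_carrier by blast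
  have g: "ver.pt r w \<in> grade ver.M i" using ver.pt_grade[OF pure] .
  have one: "\<one>\<^bsub>dual.H\<^esub> \<in> cher_grade G (dual_rep G V) t (cbar G c) 0"
    using dual.grade_scalar[of 1] by (simp add: sc_one dual.E_one)
  have g': "ver'.pt \<one>\<^bsub>dual.H\<^esub> f \<in> grade ver'.M 0" using ver'.pt_grade[OF one f] .
  show ?case
  proof (cases "i = 0")
    case True
    then obtain w' where w': "w' \<in> carrier \<tau>" "ver.pt r w = ver.pt \<one>\<^bsub>H\<^esub> w'"
      using ver.verma_grade_zero g by blast
    have "\<pi> (ver.pt r w) = w'" "component L d w' = w'"
      unfolding w'(2) using w'(1) gr.grade_closed gr.component_homogeneous[of w' d d]
      by (auto simp: \<pi>_pt gr.lm.smult_one)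
    thus ?thesis unfolding w'(2) using contravariant_formD(9)[OF B w'(1) f] by simp
  next
    case False
    have "component L d (\<pi> (ver.pt r w)) = \<zero>\<^bsub>L\<^esub>"
      using gr.component_homogeneous[OF \<pi>_grade[OF g], of d] False by simp
    thus ?thesis using contravariant_formD(8)[OF B False g g'] functional_props(3)[OF f] by simp
  qed
next
  case (add m n)
  have "ver'.pt \<one>\<^bsub>dual.H\<^esub> f \<in> carrier ver'.M" using f by simp
  thus ?case using add f
    by (simp add: contravariant_formD(1)[OF B] \<pi>_add gr.component_add functional_props(1))
qed

text \<open>One inclusion uses the form given by \<open>\<psi>\<close>: as \<open>adjoint\<close> is surjective and functionals separate points,
  its kernel consists of elements whose image has no component in degree \<open>d\<close> after any action. The other
  inclusion holds for every contravariant form, by moving \<open>r\<close> to the first argument.\<close>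

lemma form_kernel_eq: "K = {m \<in> carrier ver.M. \<pi> m = \<zero>\<^bsub>L\<^esub>}"
proof (intro Set.set_eqI iffI)
  fix m assume m: "m \<in> K"
  hence mM: "m \<in> carrier ver.M" by (simp add: form_kernel_iff)
  have "\<pi> m = \<zero>\<^bsub>L\<^esub>"
  proof (rule no_component_in_lowest_degree)
    show "\<pi> m \<in> carrier L" using mM by simp
    fix r assume "r \<in> carrier H"
    then obtain s where s: "s \<in> carrier dual.H" "adjoint s = r" using adjoint_surj by blast
    show "component L d (r \<odot>\<^bsub>L\<^esub> \<pi> m) = \<zero>\<^bsub>L\<^esub>"
    proof (rule functionals_separate[OF is_repD(1)[OF \<tau>_rep] \<tau>_fin_dim])
      fix f assume "f \<in> functionals \<tau>"
      hence f: "f \<in> carrier (dual_rep G \<tau>)" by (simp add: dual_rep_simps)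
      have "ver'.pt s f \<in> carrier ver'.M" using s f by simp
      hence "\<psi> (\<pi> m) (ver'.pt s f) = 0" using m \<psi>_form unfolding form_kernel_iff by blast
      thus "f (component L d (r \<odot>\<^bsub>L\<^esub> \<pi> m)) = f \<zero>\<^bsub>L\<^esub>"
        using s f mM by (simp add: \<psi>_pt functional_props(3))
    qed (use mM \<open>r \<in> carrier H\<close> in \<open>simp_all add: gr.lm.smult_closed\<close>)
  qed
  thus "m \<in> {m \<in> carrier ver.M. \<pi> m = \<zero>\<^bsub>L\<^esub>}" using mM by simp
next
  fix m assume "m \<in> {m \<in> carrier ver.M. \<pi> m = \<zero>\<^bsub>L\<^esub>}"
  hence m: "m \<in> carrier ver.M" "\<pi> m = \<zero>\<^bsub>L\<^esub>" by auto
  have "B m m' = 0" if B: "contravariant_form G V t c \<tau> B" and "m' \<in> carrier ver'.M" for B m'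
    using that(2)
  proof (induction rule: ver'.verma_induct)
    case (pure i r f)
    have r: "r \<in> carrier dual.H" using pure dual.grade_carrier by blast
    have one: "ver'.pt \<one>\<^bsub>dual.H\<^esub> f \<in> carrier ver'.M" using pure(2) by simp
    have "B m (ver'.pt r f) = B m (r \<odot>\<^bsub>ver'.M\<^esub> ver'.pt \<one>\<^bsub>dual.H\<^esub> f)"
      using ver'.pt_one_smult[OF r pure(2)] by simp
    also have "\<dots> = f (component L d (\<pi> (adjoint r \<odot>\<^bsub>ver.M\<^esub> m)))"
      using form_adjoint[OF B r m(1) one]
        form_lowest[OF B pure(2) ver.M_smult_closed[OF adjoint_closed[OF r] m(1)]] by simp
    also have "\<dots> = 0" using m r functional_props(3)[OF pure(2)] by (simp add: \<pi>_smult)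
    finally show ?case .
  next
    case (add m1 m2)
    then show ?case using contravariant_formD(2)[OF B m(1)] by simp
  qed
  thus "m \<in> K" using m by (simp add: form_kernel_iff)
qed

text \<open>The projection sends the part of degree \<open>k - d\<close> onto \<open>L\<^sub>k\<close>, which fixes the shift.\<close>

lemma simple_quotient_iso: "gmodule_iso H L (shift (simple_quotient G V t c \<tau>) (- d))"
proof -
  let ?M = "ver.M" and ?q = "kq.q" and ?Q = "kq.Q"
  let ?S = "shift (simple_quotient G V t c \<tau>) (- d)"
  \<comment> \<open>A section of \<open>\<pi>\<close>; the isomorphism sends \<open>v\<close> to the class of \<open>s v\<close>.\<close>
  define s where "s v = (SOME m. m \<in> carrier ?M \<and> \<pi> m = v)" for v
  have s: "s v \<in> carrier ?M" "\<pi> (s v) = v" if v: "v \<in> carrier L" for v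
  proof -
    have "\<exists>m. m \<in> carrier ?M \<and> \<pi> m = v" using \<pi>_surj[OF v] by blast
    from someI_ex[OF this] have "s v \<in> carrier ?M \<and> \<pi> (s v) = v" unfolding s_def .
    thus "s v \<in> carrier ?M" "\<pi> (s v) = v" by auto
  qed
  have q_eq: "?q m = ?q n \<longleftrightarrow> \<pi> m = \<pi> n" if mn: "m \<in> carrier ?M" "n \<in> carrier ?M" for m n
  proof -
    have "?q m = ?q n \<longleftrightarrow> m \<ominus>\<^bsub>?M\<^esub> n \<in> K" by (rule kq.q_eq_iff[OF mn])
    also have "\<dots> \<longleftrightarrow> \<pi> m \<ominus>\<^bsub>L\<^esub> \<pi> n = \<zero>\<^bsub>L\<^esub>" unfolding form_kernel_eq using mn \<pi>_minus[OF mn] by simp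
    also have "\<dots> \<longleftrightarrow> \<pi> m = \<pi> n" using mn by simp
    finally show ?thesis .
  qed
  define h where "h v = ?q (s v)" for v
  have h: "h (\<pi> m) = ?q m" if m: "m \<in> carrier ?M" for m
    unfolding h_def using q_eq[OF s(1) m] s(2) m by simp
  have Q: "simple_quotient G V t c \<tau> = ?Q" by (simp add: simple_quotient_def)
  show ?thesis
    unfolding gmodule_iso_def
  proof (intro exI[of _ h] conjI ballI allI)
    show "bij_betw h (carrier L) (carrier (?S))"
      unfolding bij_betw_def
    proof
      show "inj_on h (carrier L)"
      proof (rule inj_onI)
        fix u v assume uv: "u \<in> carrier L" "v \<in> carrier L" "h u = h v"
        thus "u = v" unfolding h_def using q_eq[OF s(1) s(1), of u v] s(2) by metis
      qed
      show "h ` carrier L = carrier (?S)"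
      proof
        show "h ` carrier L \<subseteq> carrier (?S)"
          using s(1) kq.q_closed by (auto simp: shift_def Q h_def)
        show "carrier (?S) \<subseteq> h ` carrier L"
        proof
          fix Y assume "Y \<in> carrier (?S)"
          hence "Y \<in> carrier ?Q" by (simp add: shift_def Q)
          then obtain m where m: "m \<in> carrier ?M" "Y = ?q m" using kq.q_surj by blast
          show "Y \<in> h ` carrier L" unfolding m(2) h[OF m(1), symmetric] using m(1) by simp
        qed
      qed
    qed
  next
    fix u v assume uv: "u \<in> carrier L" "v \<in> carrier L"
    have "h (u \<oplus>\<^bsub>L\<^esub> v) = h (\<pi> (s u \<oplus>\<^bsub>?M\<^esub> s v))" using s uv by (simp add: \<pi>_add)
    also have "\<dots> = h u \<oplus>\<^bsub>?Q\<^esub> h v"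
      using h[of "s u \<oplus>\<^bsub>?M\<^esub> s v"] kq.q_add[OF s(1)[OF uv(1)] s(1)[OF uv(2)]] s(1) uv
      by (simp add: h_def)
    finally show "h (u \<oplus>\<^bsub>L\<^esub> v) = h u \<oplus>\<^bsub>?S\<^esub> h v"
      by (simp add: shift_def Q)
  next
    fix r v assume rv: "r \<in> carrier H" "v \<in> carrier L"
    have "h (r \<odot>\<^bsub>L\<^esub> v) = h (\<pi> (r \<odot>\<^bsub>?M\<^esub> s v))" using s rv by (simp add: \<pi>_smult)
    also have "\<dots> = r \<odot>\<^bsub>?Q\<^esub> h v"
      using h[of "r \<odot>\<^bsub>?M\<^esub> s v"] kq.q_smult[OF rv(1) s(1)[OF rv(2)]] s(1) rv ver.M_smult_closed
      by (simp add: h_def)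
    finally show "h (r \<odot>\<^bsub>L\<^esub> v) = r \<odot>\<^bsub>?S\<^esub> h v"
      by (simp add: shift_def Q)
  next
    fix k
    have "h ` grade L k = ?q ` grade ?M (k - d)"
    proof
      show "h ` grade L k \<subseteq> ?q ` grade ?M (k - d)"
      proof
        fix Y assume "Y \<in> h ` grade L k"
        then obtain v where v: "v \<in> grade L k" "Y = h v" by blast
        obtain m where m: "m \<in> grade ?M (k - d)" "\<pi> m = v" using \<pi>_grade_surj[OF v(1)] by blast
        show "Y \<in> ?q ` grade ?M (k - d)"
          unfolding v(2) m(2)[symmetric] h[OF ver.grade_M_closed[OF m(1)]] using m(1) by simp
      qed
      show "?q ` grade ?M (k - d) \<subseteq> h ` grade L k"
      proof
        fix Y assume "Y \<in> ?q ` grade ?M (k - d)"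
        then obtain m where m: "m \<in> grade ?M (k - d)" "Y = ?q m" by blast
        have "\<pi> m \<in> grade L k" using \<pi>_grade[OF m(1)] by simp
        thus "Y \<in> h ` grade L k"
          unfolding m(2) h[OF ver.grade_M_closed[OF m(1)], symmetric] by simp
      qed
    qed
    thus "h ` grade L k = grade (?S) k"
      by (simp add: shift_def Q kq.q_grade)
  qed
qed

section \<open>Uniqueness of the lowest weight and of the shift\<close>

text \<open>The inverse isomorphism, composed with the quotient map, is a surjection \<open>\<rho>\<close> from the Verma module of
  \<open>\<sigma>\<close>. The Verma module starts in degree \<open>0\<close>, so \<open>L\<close> starts in degree \<open>- j\<close>, and the restriction
  of \<open>\<rho>\<close> to \<open>1 \<otimes> \<sigma>\<close> is a map of representations onto \<open>\<tau>\<close>.\<close>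

lemma lowest_weight_unique:
  fixes \<sigma> :: "('g, 'k, 'w) rep"
  assumes irr\<sigma>: "irreducible_rep G \<sigma>" and iso: "gmodule_iso H L (shift (simple_quotient G V t c \<sigma>) j)"
  shows "rep_iso G \<sigma> \<tau> \<and> j = - d"
proof -
  have \<sigma>: "is_rep G \<sigma>" using irr\<sigma> by (simp add: irreducible_rep_def fin_dim_rep_def)
  interpret s: contravariant G V t c \<sigma> by (rule contravariantI[OF \<sigma>])
  let ?M = "s.ver.M" and ?q = "s.kq.q" and ?Q = "s.kq.Q"
  have Q: "simple_quotient G V t c \<sigma> = ?Q" by (simp add: simple_quotient_def)
  obtain h where h: "bij_betw h (carrier L) (carrier ?Q)"
    and h_add: "\<And>u v. u \<in> carrier L \<Longrightarrow> v \<in> carrier L \<Longrightarrow> h (u \<oplus>\<^bsub>L\<^esub> v) = h u \<oplus>\<^bsub>?Q\<^esub> h v"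
    and h_smult: "\<And>r v. r \<in> carrier H \<Longrightarrow> v \<in> carrier L \<Longrightarrow> h (r \<odot>\<^bsub>L\<^esub> v) = r \<odot>\<^bsub>?Q\<^esub> h v"
    and h_grade: "\<And>k. h ` grade L k = grade ?Q (k + j)"
    using iso unfolding gmodule_iso_def by (auto simp: shift_def Q)
  have h_inj: "u = v" if "h u = h v" "u \<in> carrier L" "v \<in> carrier L" for u v
    using h that by (auto simp: bij_betw_def inj_on_def)
  define \<rho> where "\<rho> m = inv_into (carrier L) h (?q m)" for m
  have \<rho>: "\<rho> m \<in> carrier L" "h (\<rho> m) = ?q m" if m: "m \<in> carrier ?M" for m
  proof -
    have "?q m \<in> h ` carrier L" using h s.kq.q_closed[OF m] by (simp add: bij_betw_def)
    thus "\<rho> m \<in> carrier L" "h (\<rho> m) = ?q m"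
      unfolding \<rho>_def by (rule inv_into_into, rule f_inv_into_f)
  qed
  have \<rho>_add: "\<rho> (m \<oplus>\<^bsub>?M\<^esub> n) = \<rho> m \<oplus>\<^bsub>L\<^esub> \<rho> n" if mn: "m \<in> carrier ?M" "n \<in> carrier ?M" for m n
    by (rule h_inj) (use mn \<rho> in \<open>simp_all add: h_add s.kq.q_add\<close>)
  have \<rho>_smult: "\<rho> (r \<odot>\<^bsub>?M\<^esub> m) = r \<odot>\<^bsub>L\<^esub> \<rho> m" if rm: "r \<in> carrier H" "m \<in> carrier ?M" for r m
    by (rule h_inj) (use rm \<rho> in \<open>simp_all add: h_smult s.kq.q_smult s.ver.M_smult_closed gr.lm.smult_closed\<close>)
  have \<rho>_grade: "\<rho> m \<in> grade L (i - j)" if m: "m \<in> grade ?M i" for m i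
  proof -
    have mM: "m \<in> carrier ?M" using s.ver.grade_M_closed[OF m] .
    have "?q m \<in> h ` grade L (i - j)" using h_grade[of "i - j"] m by (simp add: s.kq.q_grade)
    then obtain v where v: "v \<in> grade L (i - j)" "h v = ?q m" by auto
    have "\<rho> m = v" by (rule h_inj) (use v \<rho>[OF mM] gr.grade_closed in simp_all)
    thus ?thesis using v by simp
  qed
  have \<rho>_surj: "\<exists>m\<in>grade ?M (k + j). \<rho> m = v" if v: "v \<in> grade L k" for v k
  proof -
    have "h v \<in> ?q ` grade ?M (k + j)" using h_grade[of k] v by (auto simp: s.kq.q_grade)
    then obtain m where m: "m \<in> grade ?M (k + j)" "h v = ?q m" by blast
    have "\<rho> m = v"
      by (rule h_inj) (use m v \<rho>[OF s.ver.grade_M_closed[OF m(1)]] gr.grade_closed in simp_all)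
    thus ?thesis using m by blast
  qed
  have \<rho>_zero: "\<rho> \<zero>\<^bsub>?M\<^esub> = \<zero>\<^bsub>L\<^esub>"
    using \<rho>_smult[of "\<zero>\<^bsub>H\<^esub>" "\<zero>\<^bsub>?M\<^esub>"] \<rho>(1)[of "\<zero>\<^bsub>?M\<^esub>"] by simp
  have one: "\<one>\<^bsub>H\<^esub> \<in> cher_grade G V t c 0" using grade_scalar[of 1] by (simp add: sc_one E_one)
  let ?h = "\<lambda>w. \<rho> (s.ver.pt \<one>\<^bsub>H\<^esub> w)"
  have pt_one: "s.ver.pt \<one>\<^bsub>H\<^esub> w \<in> grade ?M 0" "s.ver.pt \<one>\<^bsub>H\<^esub> w \<in> carrier ?M" if "w \<in> carrier \<sigma>" for w
    using s.ver.pt_grade[OF one that] that by simp_all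
  have "grade L k = {\<zero>\<^bsub>L\<^esub>}" if k: "k < - j" for k
  proof -
    have "v = \<zero>\<^bsub>L\<^esub>" if v: "v \<in> grade L k" for v
    proof -
      obtain m where m: "m \<in> grade ?M (k + j)" "\<rho> m = v" using \<rho>_surj[OF v] by blast
      have "m = \<zero>\<^bsub>?M\<^esub>" by (rule s.ver.verma_grade_negative[OF m(1)]) (use k in simp)
      thus ?thesis using m \<rho>_zero by simp
    qed
    thus ?thesis using gr.grade_zero by blast
  qed
  hence "- j \<le> d" using d_nonzero not_le by blast
  moreover have "d \<le> - j"
  proof (rule ccontr)
    \<comment> \<open>Otherwise \<open>\<rho>\<close> kills the generators \<open>1 \<otimes> w\<close>, hence everything.\<close>
    assume "\<not> d \<le> - j"
    hence low0: "grade L (- j) = {\<zero>\<^bsub>L\<^esub>}" using below_d by simp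
    have "\<rho> m = \<zero>\<^bsub>L\<^esub>" if m: "m \<in> carrier ?M" for m
      using m
    proof (induction rule: s.ver.verma_induct)
      case (pure i r w)
      have r: "r \<in> carrier H" using pure grade_carrier by blast
      have "\<rho> (s.ver.pt \<one>\<^bsub>H\<^esub> w) = \<zero>\<^bsub>L\<^esub>" using \<rho>_grade[OF pt_one(1)[OF pure(2)]] low0 by simp
      thus ?case using \<rho>_smult[OF r pt_one(2)[OF pure(2)]] s.ver.pt_one_smult[OF r pure(2)] r by simp
    next
      case (add m n)
      then show ?case by (simp add: \<rho>_add)
    qed
    hence "grade L d = {\<zero>\<^bsub>L\<^esub>}" using \<rho>_surj[of _ d] s.ver.grade_M_closed gr.grade_zero by blast
    thus False using d_nonzero by simp
  qed
  ultimately have j: "j = - d" by simp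
  have h_closed: "?h w \<in> grade L d" if "w \<in> carrier \<sigma>" for w
    using \<rho>_grade[OF pt_one(1)[OF that]] j by simp
  have h_act: "?h u = b \<odot>\<^bsub>L\<^esub> ?h w" if X: "(b, w, u) \<in> s.ver.X" for b w u
    using s.ver.X_smult_pt_one[OF X] \<rho>_smult[of b "s.ver.pt \<one>\<^bsub>H\<^esub> w"] s.ver.X_closed[OF X] by simp
  have lin: "linear_map class_ring \<sigma> \<tau> ?h"
  proof (rule linear_mapI[OF is_repD(1)[OF \<sigma>] is_repD(1)[OF \<tau>_rep]])
    fix u v assume uv: "u \<in> carrier \<sigma>" "v \<in> carrier \<sigma>"
    show "?h (u \<oplus>\<^bsub>\<sigma>\<^esub> v) = ?h u \<oplus>\<^bsub>\<tau>\<^esub> ?h v"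
      using s.ver.pt_add_r[OF s.ver.one_H uv] \<rho>_add[OF pt_one(2)[OF uv(1)] pt_one(2)[OF uv(2)]] by simp
  next
    fix a v assume "v \<in> carrier \<sigma>"
    thus "?h (a \<odot>\<^bsub>\<sigma>\<^esub> v) = a \<odot>\<^bsub>\<tau>\<^esub> ?h v" using h_act[OF kGSh_action.scalar] by simp
  qed (use h_closed in simp)
  interpret T: linear_map class_ring \<sigma> \<tau> ?h by (rule lin)
  have equi: "?h (act \<sigma> g v) = act \<tau> g (?h v)" if "g \<in> carrier G" "v \<in> carrier \<sigma>" for g v
    using h_act[OF kGSh_action.grp[OF that]] by simp
  have surj: "?h ` carrier \<sigma> = carrier \<tau>"
  proof
    show "carrier \<tau> \<subseteq> ?h ` carrier \<sigma>"
    proof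
      fix v assume "v \<in> carrier \<tau>"
      hence v: "v \<in> grade L d" by simp
      obtain m where m: "m \<in> grade ?M (d + j)" "\<rho> m = v" using \<rho>_surj[OF v] by blast
      then obtain w where w: "w \<in> carrier \<sigma>" "m = s.ver.pt \<one>\<^bsub>H\<^esub> w"
        using s.ver.verma_grade_zero[of m] j by auto
      show "v \<in> ?h ` carrier \<sigma>" unfolding m(2)[symmetric] w(2) using w(1) by (rule imageI)
    qed
  qed (use h_closed in auto)
  have "T.kerT = {\<zero>\<^bsub>\<sigma>\<^esub>} \<or> T.kerT = carrier \<sigma>"
  proof -
    have "\<forall>g\<in>carrier G. \<forall>w\<in>T.kerT. act \<sigma> g w \<in> T.kerT"
    proof (intro ballI)
      fix g w assume g: "g \<in> carrier G" and "w \<in> T.kerT"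
      hence w: "w \<in> carrier \<sigma>" "?h w = \<zero>\<^bsub>L\<^esub>" by (auto simp: T.ker_def)
      have "E (lt (Grp g)) \<in> carrier H" using g by simp
      thus "act \<sigma> g w \<in> T.kerT"
        using equi[OF g w(1)] w is_repD(2)[OF \<sigma> g w(1)] by (simp add: T.ker_def)
    qed
    thus ?thesis using irr\<sigma> T.kerT_is_subspace unfolding irreducible_rep_def by blast
  qed
  moreover have "T.kerT \<noteq> carrier \<sigma>"
  proof
    assume k: "T.kerT = carrier \<sigma>"
    have "?h w = \<zero>\<^bsub>L\<^esub>" if "w \<in> carrier \<sigma>" for w
    proof -
      have "w \<in> T.kerT" unfolding k using that .
      thus ?thesis by (simp add: T.ker_def)
    qed
    hence "carrier \<tau> \<subseteq> {\<zero>\<^bsub>L\<^esub>}" unfolding surj[symmetric] by auto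
    thus False using d_nonzero gr.grade_zero by auto
  qed
  ultimately have "T.kerT = {\<zero>\<^bsub>\<sigma>\<^esub>}" by blast
  hence "inj_on ?h (carrier \<sigma>)" by (intro T.Ke0_imp_inj) simp
  hence "bij_betw ?h (carrier \<sigma>) (carrier \<tau>)" using surj by (simp add: bij_betw_def)
  hence "rep_iso G \<sigma> \<tau>" unfolding rep_iso_def using lin equi by (intro exI[of _ ?h]) blast
  thus ?thesis using j by simp
qed

end

section \<open>Classification of the irreducible modules\<close>

theorem proposition2p25:
  fixes G :: "'g monoid"
    and V :: "('g, 'k::alg_closed_field, 'v) rep"
    and t :: 'k
    and c :: "'g \<Rightarrow> 'k"
    and p :: nat
    and L :: "(('g, 'k, 'v) cher, 'l) gmodule"
  assumes "CHAR('k) = p" and "p > 0"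
    and "group G" and "finite (carrier G)"
    and "fin_dim_rep G V" and "faithful_rep G V"
    and "\<forall>g\<in>carrier G. \<forall>s\<in>reflections G V. c (g \<otimes>\<^bsub>G\<^esub> s \<otimes>\<^bsub>G\<^esub> inv\<^bsub>G\<^esub> g) = c s"
    and "irreducible_O G V t c L"
  shows "\<exists>(\<tau> :: ('g, 'k, 'l) rep) (i :: int).
     irreducible_rep G \<tau> \<and>
     gmodule_iso (cherednik G V t c) L (shift (simple_quotient G V t c \<tau>) i) \<and>
     (\<forall>(\<sigma> :: ('g, 'k, 'w) rep) (j :: int).
        irreducible_rep G \<sigma> \<and>
        gmodule_iso (cherednik G V t c) L (shift (simple_quotient G V t c \<sigma>) j) \<longrightarrow>
        rep_iso G \<sigma> \<tau> \<and> j = i)"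
proof -
  interpret alg: cherednik_algebra G V t c by (rule cherednik_algebra.intro[OF assms(3,5)])
  interpret irr: irreducible_module G V t c L
    by (rule irreducible_module.intro[OF alg.duality irreducible_module_axioms.intro[OF assms(8)]])
  obtain d where d: "grade L d \<noteq> {\<zero>\<^bsub>L\<^esub>}" "\<And>k. k < d \<Longrightarrow> grade L k = {\<zero>\<^bsub>L\<^esub>}"
    using irr.exists_lowest_degree by blast
  interpret low: lowest_degree G V t c L d
    by (rule lowest_degree.intro[OF irr.irreducible_module_axioms lowest_degree_axioms.intro[OF d]])
  show ?thesis
    using low.\<tau>_irreducible low.simple_quotient_iso low.lowest_weight_unique by blast
qed

end
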